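(* For every integer $k\ge 2$ there exists $N_k$ such that for all integers $n\ge N_k$ the following holds. If $k$ is even, then $$kn-2n<\left(1-\frac{2}{k}+\frac{6}{k\sqrt{\pi k+14}}-\frac{2}{k(k+2)}\right)kn\le f_k(n)\le kn .$$ If $k$ is odd, then $$kn-3n<\left(1-\frac{3}{k}+\frac{10}{k\sqrt{\pi k+7}}-\frac{6}{k(k+1)}\right)kn\le f_k(n)\le kn .$$
   Context: $f_k(n)$ denotes the maximum size of a set of points chosen from the $n\times n$ integer grid $\{1,\dots,n\}\times\{1,\dots,n\}$ such that every line of the Euclidean plane contains at most $k$ points of the set. *)

theory Defs
  imports "HOL-Analysis.Analysis"
begin

definition grid :: "nat \<Rightarrow> (real \<times> real) set" where
  "grid n = (\<lambda>(i, j). (real i, real j)) ` ({1..n} \<times> {1..n})"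

text \<open>Arbitrary lines of the Euclidean plane, not only those spanned by grid points.\<close>

definition is_line :: "(real \<times> real) set \<Rightarrow> bool" where
  "is_line L \<longleftrightarrow> affine L \<and> aff_dim L = 1"

definition at_most_per_line :: "nat \<Rightarrow> (real \<times> real) set \<Rightarrow> bool" where
  "at_most_per_line k S \<longleftrightarrow> (\<forall>L. is_line L \<longrightarrow> card (S \<inter> L) \<le> k)"

text \<open>The maximum is taken over a finite set, as \<^term>\<open>grid n\<close> is finite, and that set is
  nonempty, as \<^term>\<open>S = {}\<close> is always admissible.\<close>

definition max_pts :: "nat \<Rightarrow> nat \<Rightarrow> nat" where
  "max_pts k n = Max {card S | S. S \<subseteq> grid n \<and> at_most_per_line k S}"

end

theory Submission
  imports Defs "HOL-Number_Theory.Number_Theory" "HOL-Complex_Analysis.Complex_Analysis" "HOL-Real_Asymp.Real_Asymp"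
begin

text \<open>Let \<open>p = 2 h + 1\<close> be a prime slightly below \<open>n / 2\<close> and \<open>t = k div 2\<close>. On the \<open>2 p \<times> 2 p\<close> grid
  take \<open>t\<close> hyperbolas \<open>(x - (h + 1)) y \<equiv> m (mod p)\<close>, each repeated in the four \<open>p \<times> p\<close> blocks. A
  hyperbola meets every row and column at most twice. Three collinear points of it cannot be
  pairwise incongruent modulo \<open>p\<close>, and two congruent points of the grid span a line that is
  axis-parallel or of slope \<open>1\<close> or \<open>- 1\<close>, so any other line contains at most two points per hyperbola.
  Thus only the diagonals can carry more than \<open>k\<close> points, and the excess is deleted there.

  The shift by half a period makes the two roots on a diagonal antithetic: for random \<open>m\<close> a
  diagonal at relative distance \<open>u\<close> from the centre gets no point with probability \<open>1 / 2\<close>, and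
  otherwise 3 or 4 points if \<open>u < 1 / 2\<close> and 2 or 3 points if \<open>u > 1 / 2\<close>. Choosing the
  parameters \<open>m\<close> one after the other such that the conditional expectation of the total excess
  does not grow yields a loss of \<open>2 p L + O(1)\<close>, where \<open>L\<close> is an explicit binomial sum; up to an
  exponentially small term it has a closed form in central binomial coefficients, which
  Wallis' product estimates.

  That \<open>2 p\<close> can be chosen as \<open>(1 - o(1)) n\<close> is derived in the manner of Wiener and Ikehara:
  \<open>\<zeta>'(s) / \<zeta>(s) + \<zeta>(s)\<close> is regular on \<open>Re s \<ge> 1\<close>, so its integral against a Fejer weight and
  \<open>exp (i t y)\<close> is \<open>O(1 / y)\<close>; hence primes and integers have nearly the same weight near \<open>exp y\<close>,
  and Chebyshev's bound controls the tails of the Fejer kernel.\<close>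

section \<open>Chebyshev's bound\<close>

text \<open>Each hyperbola has at least \<open>4 * (p - 1)\<close> points, so \<open>t\<close> of
  them yield about \<open>2 * t * n\<close>, and the rate reached is \<open>2 * t - L\<close>. As
  \<open>L\<close> lies strictly below what the theorem needs, the gap absorbs the bounded errors
  and the ratio \<open>2 * p / n\<close>. That ratio must come arbitrarily close to 1, so a prime
  between \<open>x\<close> and \<open>2 * x\<close> would not do.

  The obstacle in choosing the parameters is that they must be distinct and serve about
  \<open>4 * p\<close> diagonals at once. Excluding the used parameters changes the hit frequencies
  on one diagonal by \<open>O(t / p)\<close>, hence the total loss by a constant. The frequencies
  are known only from above; this suffices because the truncated excess and all its averages are
  nondecreasing with increments at most 1.

  With \<open>n\<close> now for \<open>t + 1\<close> and \<open>e = k - 2 * t\<close>, the excess is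
  quadratic in the deviation \<open>2 * i - n\<close> of a binomial variable \<open>i\<close>. The
  second moment produces the leading 2 of \<open>L\<close>. The linear term, with coefficient
  \<open>3 + 2 * e\<close>, is a mean absolute deviation, hence a central binomial coefficient; it
  produces the square roots and the numerators 6 and 10.\<close>

lemma ln_fact_eq_sum_mangoldt:
  "ln (fact n) = (\<Sum>d=1..n. mangoldt d * real (n div d))"
proof (induction n)
  case (Suc n)
  have dv: "1 \<le> d" "d \<le> Suc n" if "d dvd Suc n" for d
    using dvd_pos_nat[OF _ that] dvd_imp_le[OF that] by auto
  \<comment> \<open>From \<open>n\<close> to \<open>Suc n\<close> the quotient by \<open>d\<close>
    grows by 1 exactly when \<open>d\<close> divides \<open>Suc n\<close>, and the Mangoldt function
    summed over these divisors is \<open>ln (Suc n)\<close>.\<close>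
  have "(\<Sum>d=1..Suc n. mangoldt d * real (Suc n div d)) =
      (\<Sum>d=1..Suc n. mangoldt d * real (n div d)) + (\<Sum>d=1..Suc n. if d dvd Suc n then mangoldt d else 0)"
    unfolding sum.distrib[symmetric]
    by (intro sum.cong refl) (auto simp: div_Suc algebra_simps mod_eq_0_iff_dvd)
  also have "(\<Sum>d=1..Suc n. mangoldt d * real (n div d)) = (\<Sum>d=1..n. mangoldt d * real (n div d))"
    by simp
  also have "(\<Sum>d=1..Suc n. if d dvd Suc n then mangoldt d else (0::real)) = (\<Sum>d | d dvd Suc n. mangoldt d)"
    by (intro sum.mono_neutral_cong_right) (use dv in auto)
  also have "\<dots> = ln (real (Suc n))"
    by (subst mangoldt_sum) auto
  finally show ?case using Suc
    by (simp add: ln_mult)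
qed auto

text \<open>In the logarithm of the central binomial coefficient, \<open>mangoldt d\<close> has
  coefficient \<open>2*n div d - 2 * (n div d)\<close>. It is never negative and at least 1 for
  \<open>n < d <= 2 * n\<close>.\<close>

lemma sum_mangoldt_dyadic_le: "(\<Sum>d=n+1..2*n. mangoldt d) \<le> 2 * real n * ln 2"
proof -
  have eq1: "ln (fact n) = (\<Sum>d=1..2*n. mangoldt d * real (n div d))"
    unfolding ln_fact_eq_sum_mangoldt by (rule sum.mono_neutral_left) auto
  have "(\<Sum>d=n+1..2*n. mangoldt d) \<le> (\<Sum>d=n+1..2*n. mangoldt d * (real (2*n div d) - 2 * real (n div d)))"
  proof (intro sum_mono)
    fix d assume d: "d \<in> {n+1..2*n}"
    then have "2 * n div d \<ge> 1" by (simp add: Suc_le_eq div_greater_zero_iff)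
    moreover have "n div d = 0" using d by simp
    ultimately have "real (2*n div d) - 2 * real (n div d) \<ge> 1" by simp
    then show "mangoldt d \<le> mangoldt d * (real (2*n div d) - 2 * real (n div d))"
      using mangoldt_nonneg[of d] mult_left_mono by fastforce
  qed
  also have "\<dots> \<le> (\<Sum>d=1..2*n. mangoldt d * (real (2*n div d) - 2 * real (n div d)))"
  proof (intro sum_mono2)
    fix d
    have "2 * (n div d) \<le> 2 * n div d" by (metis div_mult2_eq div_times_less_eq_dividend less_eq_div_iff_mult_less_eq mult.assoc mult.commute mult_le_mono2 div_by_0 gr0I le0 mult_0_right)
    then have "real (2*n div d) - 2 * real (n div d) \<ge> 0"
      by (metis diff_ge_0_iff_ge of_nat_le_iff of_nat_mult of_nat_numeral)
    then show "0 \<le> mangoldt d * (real (2*n div d) - 2 * real (n div d))"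
      using mangoldt_nonneg by (intro mult_nonneg_nonneg) auto
  qed auto
  also have "\<dots> = ln (fact (2*n)) - 2 * ln (fact n)"
    unfolding eq1 ln_fact_eq_sum_mangoldt[of "2*n"] sum_distrib_left sum_subtractf[symmetric]
    by (intro sum.cong) (auto simp: algebra_simps)
  also have "\<dots> = ln (real (2*n choose n))"
    by (subst binomial_fact) (auto simp: ln_div ln_mult algebra_simps mult_2[symmetric])
  also have "\<dots> \<le> ln (2 ^ (2*n))"
  proof -
    have "real (2*n choose n) \<le> real (2 ^ (2*n))" using binomial_le_pow2 of_nat_mono by blast
    moreover have "real (2*n choose n) > 0" by simp
    ultimately show ?thesis by (simp only: of_nat_power of_nat_numeral ln_le_cancel_iff zero_less_power zero_less_numeral)
  qed
  also have "\<dots> = 2 * real n * ln 2" by (simp add: ln_realpow)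
  finally show ?thesis .
qed

lemma sum_mangoldt_le: "(\<Sum>d=1..n. mangoldt d) \<le> 3 * real n"
proof -
  \<comment> \<open>Halving with rounding up gives \<open>3 * ln 2 * (n + 1)\<close>, which is at
    most \<open>4 * ln 2 * n\<close> from \<open>n = 3\<close> on; the constant 4 pays for the
    rounding.\<close>
  have *: "(\<Sum>d=1..n. mangoldt d) \<le> 4 * ln 2 * real n"
  proof (induction n rule: less_induct)
    case (less n)
    consider "n = 0" | "n = 1" | "n = 2" | "n \<ge> 3" by linarith
    then show ?case
    proof cases
      case 3
      have "(\<Sum>d=1..2. mangoldt d) = ln (2::real)"
        using mangoldt_prime[OF two_is_prime_nat, where ?'a=real] by (simp add: numeral_2_eq_2)
      then show ?thesis using 3 by simp
    next
      case 4
      define m where "m = (n + 1) div 2"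
      have m: "m < n" "n \<le> 2 * m" "2 * m \<le> n + 1" using 4 by (auto simp: m_def)
      have "(\<Sum>d=1..n. mangoldt d) \<le> (\<Sum>d=1..2*m. mangoldt d::real)"
        using m by (intro sum_mono2) (auto simp: mangoldt_nonneg)
      also have "{1..2*m} = {1..m} \<union> {m+1..2*m}" by auto
      also have "(\<Sum>d\<in>\<dots>. mangoldt d::real) = (\<Sum>d=1..m. mangoldt d) + (\<Sum>d=m+1..2*m. mangoldt d)"
        by (rule sum.union_disjoint) auto
      also have "\<dots> \<le> 4 * ln 2 * real m + 2 * real m * ln 2"
        by (intro add_mono less.IH m sum_mangoldt_dyadic_le)
      also have "\<dots> = 3 * ln 2 * real (2 * m)" by simp
      also have "\<dots> \<le> 3 * ln 2 * (real n + 1)"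
        using m by (intro mult_left_mono) (auto simp flip: of_nat_Suc)
      also have "\<dots> \<le> ln 2 * (4 * real n)" using 4 by (auto intro!: mult_left_mono simp: mult.commute[of _ "ln 2"] mult.assoc)
      finally show ?thesis by simp
    qed auto
  qed
  have "ln 2 < (3/4::real)" using ln2_le_25_over_36 by simp
  then show ?thesis using * mult_right_mono[of "4 * ln 2" 3 "real n"] by linarith
qed

section \<open>The zeta function on the line \<open>Re s = 1\<close>\<close>

text \<open>First-order Taylor expansion of \<open>z powr w\<close> on the segment from
  \<open>x\<close> to \<open>x + 1\<close>. For \<open>Re w <= 2\<close> the second derivative is
  largest in norm at the left end. With \<open>w = 1 - s\<close> this estimates the terms of
  \<open>zeta_reg\<close>.\<close>

lemma norm_powr_succ_diff_le:
  fixes w :: complex and x :: real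
  assumes "x \<ge> 1" "Re w \<le> 2"
  shows "norm (of_real (x + 1) powr w - of_real x powr w - w * of_real x powr (w - 1))
     \<le> norm w * norm (w - 1) * x powr (Re w - 2)"
proof -
  define S where "S = closed_segment (of_real x :: complex) (of_real (x + 1))"
  have S: "\<exists>r. y = of_real r \<and> r \<ge> x" if "y \<in> S" for y
  proof -
    from that obtain u where u: "0 \<le> u" "u \<le> 1" "y = (1-u) *\<^sub>R of_real x + u *\<^sub>R of_real (x+1)"
      unfolding S_def in_segment by blast
    have "y = of_real (x + u)" using u(3) by (simp add: scaleR_conv_of_real algebra_simps)
    then show ?thesis using u by (intro exI[of _ "x+u"]) auto
  qed
  define f where "f = (\<lambda>(i::nat) z. if i = 0 then z powr w else if i = 1 then w * z powr (w-1) 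
      else w * (w - 1) * z powr (w - 2) :: complex)"
  have "norm (f 0 (of_real (x+1)) - (\<Sum>i\<le>1. f i (of_real x) * (of_real (x+1) - of_real x) ^ i / fact i)) 
     \<le> (norm w * norm (w - 1) * x powr (Re w - 2)) * norm (of_real (x+1) - of_real x :: complex) ^ Suc 1 / fact 1"
  proof (rule complex_Taylor[of S])
    show "convex S" by (simp add: S_def)
    show "of_real x \<in> S" "of_real (x+1) \<in> S" by (auto simp: S_def)
    show "(f i has_field_derivative f (Suc i) z) (at z within S)" if zS: "z \<in> S" and i1: "i \<le> 1" for i z
    proof -
      obtain r where r: "z = of_real r" "r \<ge> x" using S[OF zS] by blast
      have z: "z \<notin> \<real>\<^sub>\<le>\<^sub>0" using r assms by (auto simp: complex_nonpos_Reals_iff)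
      consider "i = 0" | "i = 1" using i1 by linarith
      then show ?thesis
      proof cases
        case 1
        then show ?thesis using z unfolding f_def by (auto intro!: derivative_eq_intros)
      next
        case 2
        then show ?thesis using z unfolding f_def by (auto intro!: derivative_eq_intros simp: diff_diff_eq)
      qed
    qed
    show "norm (f (Suc 1) z) \<le> norm w * norm (w - 1) * x powr (Re w - 2)" if zS: "z \<in> S" for z
    proof -
      obtain r where r: "z = of_real r" "r \<ge> x" using S[OF zS] by blast
      have "norm (z powr (w - 2)) = r powr (Re w - 2)"
        using r assms by (simp add: norm_powr_real_powr)
      also have "\<dots> \<le> x powr (Re w - 2)"
        using r assms by (intro powr_mono2') auto
      finally show ?thesis by (simp add: f_def norm_mult mult_left_mono)
    qed
  qed
  then show ?thesis by (simp add: f_def algebra_simps)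
qed

section \<open>Dirichlet series in the half-plane of absolute convergence\<close>

definition dirichlet_coeff_series :: "(nat \<Rightarrow> complex) \<Rightarrow> complex \<Rightarrow> complex" where
  "dirichlet_coeff_series a s = (\<Sum>n. a n * of_nat (Suc n) powr (-s))"

lemma norm_nat_powr: "norm (of_nat (Suc n) powr s :: complex) = real (Suc n) powr (Re s)"
  using norm_powr_real_powr[of "of_nat (Suc n)" s] by simp

lemma summable_Suc_powr: "s > 1 \<Longrightarrow> summable (\<lambda>n. real (Suc n) powr (-s))"
  using summable_real_powr_iff[of "-s"] summable_Suc_iff[of "\<lambda>n. real n powr (-s)"] by simp

lemma ln_le_powr_div: "x \<ge> 1 \<Longrightarrow> d > 0 \<Longrightarrow> ln (x::real) \<le> x powr d / d"
  using ln_powr_bound[of x d] by simp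

lemma summable_ln_Suc_powr:
  assumes "s > 1"
  shows "summable (\<lambda>n. ln (real (Suc n)) * real (Suc n) powr (-s))"
proof (rule summable_comparison_test_ev)
  define d where "d = (s - 1) / 2"
  have d: "d > 0" using assms by (simp add: d_def)
  show "summable (\<lambda>n. real (Suc n) powr (-(1+d)) / d)"
    using d by (intro summable_divide summable_Suc_powr) auto
  show "\<forall>\<^sub>F n in sequentially. norm (ln (real (Suc n)) * real (Suc n) powr (-s)) \<le> real (Suc n) powr (-(1+d)) / d"
  proof (intro always_eventually allI)
    fix n
    have "ln (real (Suc n)) * real (Suc n) powr (-s) \<le> real (Suc n) powr d / d * real (Suc n) powr (-s)"
      using d by (intro mult_right_mono ln_le_powr_div) auto
    also have "\<dots> = real (Suc n) powr (-(1+d)) / d"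
    proof -
      have "-(1+d) = d + (-s)" by (simp add: d_def field_simps)
      then show ?thesis by (simp only: powr_add) (simp add: field_simps)
    qed
    finally show "norm (ln (real (Suc n)) * real (Suc n) powr (-s)) \<le> real (Suc n) powr (-(1+d)) / d"
      by (simp add: abs_mult)
  qed
qed

lemma dirichlet_summable:
  assumes "\<And>n. norm (a n) \<le> C * (1 + ln (real (Suc n)))" "Re s > 1"
  shows "summable (\<lambda>n. norm (a n * of_nat (Suc n) powr (-s)))"
proof (rule summable_comparison_test_ev)
  have "summable (\<lambda>n. real (Suc n) powr (-Re s) + ln (real (Suc n)) * real (Suc n) powr (-Re s))"
    using assms(2) by (intro summable_add summable_Suc_powr summable_ln_Suc_powr)
  then show "summable (\<lambda>n. C * (real (Suc n) powr (-Re s) + ln (real (Suc n)) * real (Suc n) powr (-Re s)))"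
    by (rule summable_mult)
  show "\<forall>\<^sub>F n in sequentially. norm (norm (a n * of_nat (Suc n) powr (-s))) \<le> 
      C * (real (Suc n) powr (-Re s) + ln (real (Suc n)) * real (Suc n) powr (-Re s))"
  proof (intro always_eventually allI)
    fix n
    have "norm (a n * of_nat (Suc n) powr (-s)) = norm (a n) * real (Suc n) powr (-Re s)"
      by (simp only: norm_mult norm_nat_powr uminus_complex.sel)
    also have "\<dots> \<le> C * (1 + ln (real (Suc n))) * real (Suc n) powr (-Re s)"
      using assms(1) by (intro mult_right_mono) auto
    finally show "norm (norm (a n * of_nat (Suc n) powr (-s))) \<le> 
      C * (real (Suc n) powr (-Re s) + ln (real (Suc n)) * real (Suc n) powr (-Re s))"
      by (simp add: algebra_simps)
  qed
qed

lemma dirichlet_sums: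
  assumes "\<And>n. norm (a n) \<le> C * (1 + ln (real (Suc n)))" "Re s > 1"
  shows "(\<lambda>n. a n * of_nat (Suc n) powr (-s)) sums dirichlet_coeff_series a s"
  unfolding dirichlet_coeff_series_def
  using summable_norm_cancel[OF dirichlet_summable[OF assms]] by (rule summable_sums)

abbreviation "zeta1 \<equiv> dirichlet_coeff_series (\<lambda>n. 1)"
abbreviation "zeta1_ln \<equiv> dirichlet_coeff_series (\<lambda>n. of_real (ln (real (Suc n))))"
abbreviation "zeta1_mangoldt \<equiv> dirichlet_coeff_series (\<lambda>n. mangoldt (Suc n))"

lemma coeff_bounds:
  "norm (1::complex) \<le> 1 * (1 + ln (real (Suc n)))"
  "norm (of_real (ln (real (Suc n))) :: complex) \<le> 1 * (1 + ln (real (Suc n)))"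
  "norm (mangoldt (Suc n) :: complex) \<le> 1 * (1 + ln (real (Suc n)))"
  using mangoldt_le[of "Suc n"] by auto

lemma zeta1_has_derivative:
  assumes "Re s > 1"
  shows "(zeta1 has_field_derivative (- zeta1_ln s)) (at s)"
proof -
  define S where "S = {z::complex. Re z > 1}"
  have opS: "open S" unfolding S_def by (rule open_halfspace_Re_gt)
  have "\<exists>g g'. \<forall>x \<in> S. ((\<lambda>n. of_nat (Suc n) powr (-x)) sums g x) \<and> 
      ((\<lambda>n. - of_real (ln (real (Suc n))) * of_nat (Suc n) powr (-x)) sums g' x) \<and> (g has_field_derivative g' x) (at x)"
  proof (rule series_and_derivative_comparison_complex[OF opS])
    show "((\<lambda>x. of_nat (Suc n) powr (-x)) has_field_derivative - of_real (ln (real (Suc n))) * of_nat (Suc n) powr (-x)) (at x)"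
      for n and x :: complex
    proof -
      have "((\<lambda>x. exp (- x * Ln (of_nat (Suc n)))) has_field_derivative - Ln (of_nat (Suc n)) * exp (- x * Ln (of_nat (Suc n)))) (at x)"
        by (auto intro!: derivative_eq_intros)
      moreover have "Ln (of_nat (Suc n)) = of_real (ln (real (Suc n)))" by (rule Ln_of_nat) simp
      ultimately show ?thesis by (simp add: powr_def del: of_nat_Suc)
    qed
    fix x assume x: "x \<in> S"
    \<comment> \<open>Half the distance to the line \<open>Re s = 1\<close>: on the ball of this
      radius the real part stays at least \<open>1 + d\<close>, so one convergent series majorises
      all terms.\<close>
    define d where "d = (Re x - 1) / 2"
    have d: "d > 0" using x by (simp add: d_def S_def)
    show "\<exists>d h. 0 < d \<and> summable h \<and> range h \<subseteq> \<real>\<^sub>\<ge>\<^sub>0 \<and> 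
       (\<forall>\<^sub>F n in sequentially. \<forall>y\<in>ball x d \<inter> S. cmod (of_nat (Suc n) powr (-y)) \<le> cmod (h n))"
    proof (intro exI[of _ d] exI[of _ "\<lambda>n. of_real (real (Suc n) powr (-(1+d)))"] conjI always_eventually allI ballI)
      show "summable (\<lambda>n. of_real (real (Suc n) powr (-(1+d))) :: complex)"
        unfolding summable_of_real_iff using d by (intro summable_Suc_powr) auto
      fix n y assume "y \<in> ball x d \<inter> S"
      then have "norm (x - y) < d" by (simp add: dist_norm)
      then have "Re x - Re y < d" using abs_Re_le_cmod[of "x - y"] by simp
      then have "Re y \<ge> 1 + d" by (simp add: d_def field_simps)
      then show "norm (of_nat (Suc n) powr (-y)) \<le> norm (of_real (real (Suc n) powr (-(1+d))) :: complex)"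
        unfolding norm_nat_powr by (simp add: powr_mono del: of_nat_Suc)
    qed (use d in \<open>auto simp: nonneg_Reals_def\<close>)
  qed
  then obtain g g' where g: "\<And>x. x \<in> S \<Longrightarrow> (\<lambda>n. of_nat (Suc n) powr (-x)) sums g x"
    "\<And>x. x \<in> S \<Longrightarrow> (\<lambda>n. - of_real (ln (real (Suc n))) * of_nat (Suc n) powr (-x)) sums g' x"
    "\<And>x. x \<in> S \<Longrightarrow> (g has_field_derivative g' x) (at x)" by blast
  have eq1: "zeta1 x = g x" if "x \<in> S" for x
    using g(1)[OF that] by (simp add: dirichlet_coeff_series_def sums_iff)
  have eq2: "- zeta1_ln s = g' s"
    using g(2)[of s] assms sums_minus[OF dirichlet_sums[OF coeff_bounds(2), of s]]
    by (auto simp: S_def dest: sums_unique2)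
  have "(g has_field_derivative (- zeta1_ln s)) (at s)"
    using g(3)[of s] assms unfolding eq2 by (simp add: S_def)
  then show ?thesis
    by (rule has_field_derivative_transform_within_open[OF _ opS]) (use assms in \<open>auto simp: S_def eq1\<close>)
qed


text \<open>\<open>(s - 1) \<zeta>(s)\<close>, continued to \<open>Re s > 0\<close>: the differences of powers telescope to \<open>-1\<close> for
  \<open>Re s > 1\<close> and make the series converge for \<open>Re s > 0\<close>.\<close>

definition zeta_reg_term :: "nat \<Rightarrow> complex \<Rightarrow> complex" where
  "zeta_reg_term n s = of_nat (Suc (Suc n)) powr (1 - s) - of_nat (Suc n) powr (1 - s) + (s - 1) * of_nat (Suc n) powr (-s)"

definition zeta_reg :: "complex \<Rightarrow> complex" where
  "zeta_reg s = 1 + (\<Sum>n. zeta_reg_term n s)"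

lemma norm_zeta_reg_term_le:
  assumes "Re s > 0"
  shows "norm (zeta_reg_term n s) \<le> norm (1 - s) * norm s * real (Suc n) powr (-1 - Re s)"
proof -
  have "norm (of_real (real (Suc n) + 1) powr (1-s) - of_real (real (Suc n)) powr (1-s) - (1-s) * of_real (real (Suc n)) powr ((1-s) - 1))
     \<le> norm (1-s) * norm ((1-s) - 1) * real (Suc n) powr (Re (1-s) - 2)"
    by (rule norm_powr_succ_diff_le) (use assms in auto)
  then show ?thesis
    by (simp add: zeta_reg_term_def algebra_simps)
qed

lemma zeta_reg_holomorphic: "zeta_reg holomorphic_on {s. Re s > 0}"
proof -
  define S where "S = {z::complex. Re z > 0}"
  have opS: "open S" unfolding S_def by (rule open_halfspace_Re_gt)
  have "\<exists>g g'. \<forall>x \<in> S. ((\<lambda>n. zeta_reg_term n x) sums g x) \<and> 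
      ((\<lambda>n. deriv (zeta_reg_term n) x) sums g' x) \<and> (g has_field_derivative g' x) (at x)"
  proof (rule series_and_derivative_comparison_complex[OF opS])
    show "(zeta_reg_term n has_field_derivative deriv (zeta_reg_term n) x) (at x)" for n x
    proof (rule holomorphic_derivI[of _ UNIV])
      show "zeta_reg_term n holomorphic_on UNIV"
        unfolding zeta_reg_term_def [abs_def] by (intro holomorphic_intros) (auto simp del: of_nat_Suc)
    qed auto
    fix x assume x: "x \<in> S"
    define d where "d = Re x / 2"
    define C where "C = (1 + norm x + d) * (norm x + d)"
    have d: "d > 0" using x by (simp add: d_def S_def)
    have C: "C \<ge> 0" using d by (simp add: C_def)
    show "\<exists>d h. 0 < d \<and> summable h \<and> range h \<subseteq> \<real>\<^sub>\<ge>\<^sub>0 \<and> 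
       (\<forall>\<^sub>F n in sequentially. \<forall>y\<in>ball x d \<inter> S. cmod (zeta_reg_term n y) \<le> cmod (h n))"
    proof (intro exI[of _ d] exI[of _ "\<lambda>n. of_real (C * real (Suc n) powr (-(1+d)))"] conjI always_eventually allI ballI)
      show "summable (\<lambda>n. of_real (C * real (Suc n) powr (-(1+d))) :: complex)"
        unfolding summable_of_real_iff using d by (intro summable_mult summable_Suc_powr) auto
      fix n y assume y: "y \<in> ball x d \<inter> S"
      then have ny: "norm (x - y) < d" by (simp add: dist_norm)
      then have "Re x - Re y < d" using abs_Re_le_cmod[of "x - y"] by simp
      then have Rey: "Re y \<ge> d" by (simp add: d_def field_simps)
      have nyy: "norm y \<le> norm x + d" using ny norm_triangle_ineq2[of y x] by (simp add: norm_minus_commute)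
      have "norm (zeta_reg_term n y) \<le> norm (1 - y) * norm y * real (Suc n) powr (-1 - Re y)"
        using y by (intro norm_zeta_reg_term_le) (auto simp: S_def)
      also have "\<dots> \<le> C * real (Suc n) powr (-(1+d))"
        unfolding C_def using Rey nyy d norm_triangle_ineq4[of 1 y]
        by (intro mult_mono powr_mono) auto
      also have "\<dots> = norm (of_real (C * real (Suc n) powr (-(1+d))) :: complex)"
        using C by (simp only: norm_of_real abs_mult abs_of_nonneg[OF C] abs_of_nonneg powr_ge_zero)
      finally show "norm (zeta_reg_term n y) \<le> norm (of_real (C * real (Suc n) powr (-(1+d))) :: complex)" .
    qed (use d C in \<open>auto simp del: of_real_mult\<close>)
  qed
  then obtain g g' where g: "\<And>x. x \<in> S \<Longrightarrow> (\<lambda>n. zeta_reg_term n x) sums g x"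
    "\<And>x. x \<in> S \<Longrightarrow> (g has_field_derivative g' x) (at x)" by blast
  have "g holomorphic_on S" using g(2) opS holomorphic_on_open by blast
  then have "(\<lambda>x. 1 + g x) holomorphic_on S" by (intro holomorphic_intros)
  then show ?thesis unfolding S_def[symmetric]
    by (rule holomorphic_transform) (use g(1) in \<open>simp add: zeta_reg_def sums_iff\<close>)
qed

lemma zeta_reg_eq:
  assumes "Re s > 1"
  shows "zeta_reg s = (s - 1) * zeta1 s"
proof -
  have lim: "(\<lambda>n. of_nat (Suc n) powr (1 - s) :: complex) \<longlonglongrightarrow> 0"
  proof (rule tendsto_norm_zero_cancel)
    have "(\<lambda>n. real (Suc n) powr (1 - Re s)) \<longlonglongrightarrow> 0"
      using assms by (intro tendsto_neg_powr filterlim_compose[OF filterlim_real_sequentially filterlim_Suc]) auto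
    then show "(\<lambda>n. norm (of_nat (Suc n) powr (1 - s) :: complex)) \<longlonglongrightarrow> 0"
      unfolding norm_nat_powr by simp
  qed
  have "(\<lambda>n. (of_nat (Suc (Suc n)) powr (1 - s) - of_nat (Suc n) powr (1 - s)) + (s - 1) * (1 * of_nat (Suc n) powr (-s)))
      sums ((0 - of_nat (Suc 0) powr (1-s)) + (s - 1) * zeta1 s)"
    by (intro sums_add sums_mult dirichlet_sums[OF coeff_bounds(1)] assms telescope_sums lim)
  then have "(\<lambda>n. zeta_reg_term n s) sums (-1 + (s - 1) * zeta1 s)"
    by (simp add: zeta_reg_term_def)
  then show ?thesis by (simp add: zeta_reg_def sums_iff)
qed

lemma zeta_reg_1: "zeta_reg 1 = 1"
  by (simp add: zeta_reg_def zeta_reg_term_def del: of_nat_Suc)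

text \<open>The Dirichlet convolution of the Mangoldt function with 1 is the logarithm. The double
  series over pairs \<open>(d, e)\<close> converges absolutely and may be regrouped by the product
  \<open>n = d * e\<close>.\<close>

lemma zeta1_mangoldt_mult:
  assumes "Re s > 1"
  shows "zeta1_mangoldt s * zeta1 s = zeta1_ln s"
proof -
  define f where "f = (\<lambda>n::nat. of_nat n powr (-s) :: complex)"
  define A where "A = {n::nat. n > 0}"
  have hs: "((\<lambda>n. a n * f n) has_sum dirichlet_coeff_series (\<lambda>n. a (Suc n)) s) A"
     and abs: "(\<lambda>n. norm (a n * f n)) summable_on A"
    if "\<And>n. norm (a (Suc n)) \<le> 1 * (1 + ln (real (Suc n)))" for a :: "nat \<Rightarrow> complex"
  proof -
    have A: "A = Suc ` UNIV" unfolding A_def using gr0_conv_Suc by auto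
    show "((\<lambda>n. a n * f n) has_sum dirichlet_coeff_series (\<lambda>n. a (Suc n)) s) A"
      unfolding A
      by (subst has_sum_reindex) (auto simp: o_def f_def simp del: of_nat_Suc intro!: norm_summable_imp_has_sum dirichlet_summable[OF that assms] dirichlet_sums[OF that assms])
    show "(\<lambda>n. norm (a n * f n)) summable_on A"
      unfolding A
      by (subst summable_on_reindex) (auto simp: o_def f_def simp del: of_nat_Suc intro!: norm_summable_imp_summable_on dirichlet_summable[OF that assms])
  qed
  define m where "m = (\<lambda>n. mangoldt n :: complex)"
  have hm: "((\<lambda>n. m n * f n) has_sum zeta1_mangoldt s) A" "(\<lambda>n. norm (m n * f n)) summable_on A"
    using hs[of m] abs[of m] coeff_bounds(3) by (simp_all add: m_def)
  have h1: "((\<lambda>n. f n) has_sum zeta1 s) A" "(\<lambda>n. norm (f n)) summable_on A"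
    using hs[of "\<lambda>_. 1"] abs[of "\<lambda>_. 1"] coeff_bounds(1) by simp_all
  have hl: "((\<lambda>n. of_real (ln (real n)) * f n) has_sum zeta1_ln s) A"
    using hs[of "\<lambda>n. of_real (ln (real n))"] coeff_bounds(2) by simp
  have "((\<lambda>(d, e). (m d * f d) * f e) has_sum (zeta1_mangoldt s * zeta1 s)) (A \<times> A)"
  proof (rule has_sum_SigmaI)
    show "((\<lambda>e. case (d, e) of (d, e) \<Rightarrow> m d * f d * f e) has_sum m d * f d * zeta1 s) A" for d
      using has_sum_cmult_right[OF h1(1)] by simp
    show "((\<lambda>d. m d * f d * zeta1 s) has_sum zeta1_mangoldt s * zeta1 s) A"
      using has_sum_cmult_left[OF hm(1)] by simp
    show "(\<lambda>(d, e). m d * f d * f e) summable_on A \<times> A"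
    proof (rule abs_summable_summable, rule summable_on_SigmaI)
      show "((\<lambda>e. norm (case (d, e) of (d, e) \<Rightarrow> m d * f d * f e)) has_sum norm (m d * f d) * infsum (\<lambda>e. norm (f e)) A) A" for d
        using has_sum_cmult_right[OF has_sum_infsum[OF h1(2)]] by (simp add: norm_mult)
      show "(\<lambda>d. norm (m d * f d) * infsum (\<lambda>e. norm (f e)) A) summable_on A"
        using summable_on_cmult_left[OF hm(2)] by simp
    qed auto
  qed
  also have "?this \<longleftrightarrow> ((\<lambda>(n, d). m d * f n) has_sum (zeta1_mangoldt s * zeta1 s)) (SIGMA n:A. {d. d dvd n})"
    by (rule has_sum_reindex_bij_witness[of _ "\<lambda>(n, d). (d, n div d)" "\<lambda>(d, e). (d * e, d)"])
       (auto simp: A_def f_def powr_times_real)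
  finally have "((\<lambda>n. \<Sum>d | d dvd n. m d * f n) has_sum (zeta1_mangoldt s * zeta1 s)) A"
    by (rule has_sum_SigmaD) (auto simp: A_def intro!: has_sum_finite)
  also have "?this \<longleftrightarrow> ((\<lambda>n. of_real (ln (real n)) * f n) has_sum (zeta1_mangoldt s * zeta1 s)) A"
    by (intro has_sum_cong) (auto simp: A_def m_def mangoldt_sum simp flip: sum_distrib_right)
  finally show ?thesis using hl has_sum_unique by blast
qed

text \<open>The limit is the order of the zero of \<open>f\<close> at \<open>z0\<close>.\<close>

lemma logderiv_radial_limit:
  fixes f :: "complex \<Rightarrow> complex"
  assumes hol: "f holomorphic_on S" and S: "open S" "connected S" "z0 \<in> S"
    and nz: "w0 \<in> S" "f w0 \<noteq> 0"
  shows "\<exists>m::nat. (m = 0 \<longleftrightarrow> f z0 \<noteq> 0) \<and> (\<forall>\<^sub>F x in at_right 0. f (z0 + of_real x) \<noteq> 0) \<and>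
     ((\<lambda>x. of_real x * (deriv f (z0 + of_real x) / f (z0 + of_real x))) \<longlongrightarrow> of_nat m) (at_right (0::real))"
proof -
  have lim0: "((\<lambda>x. z0 + of_real x) \<longlongrightarrow> z0) (at_right (0::real))"
    by (auto intro!: tendsto_eq_intros)
  have comp: "((\<lambda>x. h (z0 + of_real x)) \<longlongrightarrow> h z0) (at_right (0::real))" if "h holomorphic_on T" "open T" "z0 \<in> T" for h :: "complex \<Rightarrow> complex" and T
    using isCont_tendsto_compose[OF _ lim0, of h] holomorphic_on_imp_continuous_on[OF that(1)] that(2,3)
    by (simp add: continuous_on_eq_continuous_at)
  show ?thesis
  proof (cases "f z0 = 0")
    case False
    have cf: "((\<lambda>x. f (z0 + of_real x)) \<longlongrightarrow> f z0) (at_right (0::real))"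
      by (rule comp[OF hol S(1) S(3)])
    have cd: "((\<lambda>x. deriv f (z0 + of_real x)) \<longlongrightarrow> deriv f z0) (at_right (0::real))"
      by (rule comp[OF holomorphic_deriv[OF hol S(1)] S(1) S(3)])
    have "((\<lambda>x. of_real x * (deriv f (z0 + of_real x) / f (z0 + of_real x))) \<longlongrightarrow> of_real 0 * (deriv f z0 / f z0)) (at_right (0::real))"
      using False by (intro tendsto_intros cf cd)
    moreover have "\<forall>\<^sub>F x in at_right (0::real). f (z0 + of_real x) \<noteq> 0"
      using False cf tendsto_imp_eventually_ne by blast
    ultimately show ?thesis using False by (intro exI[of _ 0]) auto
  next
    case True
    have "\<not> f constant_on S" using True nz S(3) unfolding constant_on_def by metis
    then obtain g r n where n: "0 < n" "0 < r" "ball z0 r \<subseteq> S" "g holomorphic_on ball z0 r"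
      and fg: "\<And>w. w \<in> ball z0 r \<Longrightarrow> f w = (w - z0)^n * g w" and g: "\<And>w. w \<in> ball z0 r \<Longrightarrow> g w \<noteq> 0"
      using holomorphic_factor_zero_nonconstant[OF hol S(1,2,3) True] by metis
    have cg: "((\<lambda>x. g (z0 + of_real x)) \<longlongrightarrow> g z0) (at_right (0::real))"
      by (rule comp[OF n(4)]) (use n in auto)
    have cd: "((\<lambda>x. deriv g (z0 + of_real x)) \<longlongrightarrow> deriv g z0) (at_right (0::real))"
      by (rule comp[OF holomorphic_deriv[OF n(4)]]) (use n in auto)
    \<comment> \<open>For \<open>f w = (w - z0) ^ n * g w\<close> the logarithmic derivative is
      \<open>n / (w - z0) + g' / g\<close>; multiplied by \<open>x = w - z0\<close> it tends to
      \<open>n\<close>.\<close>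
    have "((\<lambda>x. of_nat n + of_real x * (deriv g (z0 + of_real x) / g (z0 + of_real x))) \<longlongrightarrow> of_nat n + of_real 0 * (deriv g z0 / g z0)) (at_right (0::real))"
      using g n(2) by (intro tendsto_intros cg cd) auto
    then have lim: "((\<lambda>x. of_nat n + of_real x * (deriv g (z0 + of_real x) / g (z0 + of_real x))) \<longlongrightarrow> of_nat n) (at_right (0::real))"
      by simp
    have ev: "\<forall>\<^sub>F x in at_right (0::real). x > 0 \<and> x < r"
      using eventually_at_right[of 0 r] n(2) eventually_at_right_less[of 0] eventually_at_right_real[OF n(2)]
      by (auto elim!: eventually_mono)
    have 1: "\<forall>\<^sub>F x in at_right (0::real). f (z0 + of_real x) \<noteq> 0"
      using ev by eventually_elim (use fg g in \<open>auto simp: dist_norm\<close>)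
    have 2: "\<forall>\<^sub>F x in at_right (0::real). of_nat n + of_real x * (deriv g (z0 + of_real x) / g (z0 + of_real x)) = 
        of_real x * (deriv f (z0 + of_real x) / f (z0 + of_real x))"
      using ev
    proof eventually_elim
      case (elim x)
      define w where "w = z0 + of_real x"
      have w: "w \<in> ball z0 r" "w - z0 = of_real x" using elim by (auto simp: w_def dist_norm)
      have "(g has_field_derivative deriv g w) (at w)"
        using holomorphic_derivI[OF n(4) open_ball w(1)] .
      then have "((\<lambda>w. (w - z0)^n * g w) has_field_derivative of_nat n * (w - z0)^(n-1) * g w + (w - z0)^n * deriv g w) (at w)"
        by (auto intro!: derivative_eq_intros)
      then have "(f has_field_derivative of_nat n * (w - z0)^(n-1) * g w + (w - z0)^n * deriv g w) (at w)"
        by (rule has_field_derivative_transform_within_open[OF _ open_ball w(1)]) (simp add: fg)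
      then have "deriv f w = of_nat n * (w - z0)^(n-1) * g w + (w - z0)^n * deriv g w"
        by (rule DERIV_imp_deriv)
      moreover have "(w - z0)^n = (w - z0)^(n-1) * (w - z0)" using n(1) by (metis Suc_pred' power_Suc2)
      moreover have "g w \<noteq> 0" "w - z0 \<noteq> 0" using g w elim by auto
      ultimately have "of_nat n + of_real x * (deriv g w / g w) = of_real x * (deriv f w / f w)"
        using fg[OF w(1)] by (simp add: w(2) field_simps)
      then show ?case by (simp add: w_def)
    qed
    have "((\<lambda>x. of_real x * (deriv f (z0 + of_real x) / f (z0 + of_real x))) \<longlongrightarrow> of_nat n) (at_right (0::real))"
      using Lim_transform_eventually[OF lim 2] .
    then show ?thesis using 1 True n(1) by (intro exI[of _ n]) auto
  qed
qed

section \<open>Logarithmic derivative and non-vanishing\<close>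

lemma deriv_zeta_reg:
  assumes "Re s > 1"
  shows "deriv zeta_reg s = zeta1 s * (1 - (s - 1) * zeta1_mangoldt s)"
proof -
  have "((\<lambda>s. (s - 1) * zeta1 s) has_field_derivative (zeta1 s + (s - 1) * (- zeta1_ln s))) (at s)"
    by (rule derivative_eq_intros zeta1_has_derivative assms refl | simp)+
  then have "(zeta_reg has_field_derivative (zeta1 s + (s - 1) * (- zeta1_ln s))) (at s)"
    by (rule has_field_derivative_transform_within_open[OF _ open_halfspace_Re_gt[of 1]]) (use assms in \<open>auto simp: zeta_reg_eq\<close>)
  then show ?thesis
    unfolding zeta1_mangoldt_mult[OF assms, symmetric] by (simp add: DERIV_imp_deriv algebra_simps)
qed

lemma zeta_reg_logderiv:
  assumes "Re s > 1" "zeta_reg s \<noteq> 0"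
  shows "zeta1_mangoldt s = 1 / (s - 1) - deriv zeta_reg s / zeta_reg s"
proof -
  have nz: "s \<noteq> 1" "zeta1 s \<noteq> 0" using assms by (auto simp: zeta_reg_eq)
  then have "deriv zeta_reg s / zeta_reg s = (1 - (s - 1) * zeta1_mangoldt s) / (s - 1)"
    using assms by (simp add: deriv_zeta_reg zeta_reg_eq)
  also have "\<dots> = 1 / (s - 1) - zeta1_mangoldt s"
    using nz by (simp add: diff_divide_distrib)
  finally show ?thesis by simp
qed

text \<open>The limit is the residue of minus the logarithmic derivative of zeta at
  \<open>z0\<close>: the pole at 1 contributes 1 and a zero of \<open>zeta_reg\<close> of order
  \<open>m\<close> contributes \<open>- m\<close>.\<close>

lemma zeta1_mangoldt_radial_limit:
  assumes "Re z0 \<ge> 1"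
  shows "\<exists>m::nat. (m = 0 \<longleftrightarrow> zeta_reg z0 \<noteq> 0) \<and> 
    ((\<lambda>x. of_real x * zeta1_mangoldt (z0 + of_real x)) \<longlongrightarrow> (if z0 = 1 then 1 else 0) - of_nat m) (at_right (0::real))"
proof -
  have "convex {s::complex. Re s > 0}" by (rule convex_halfspace_Re_gt)
  then have conn: "connected {s::complex. Re s > 0}" by (rule convex_connected)
  obtain m :: nat where m: "m = 0 \<longleftrightarrow> zeta_reg z0 \<noteq> 0" 
    and ev: "\<forall>\<^sub>F x in at_right 0. zeta_reg (z0 + of_real x) \<noteq> 0"
    and lim: "((\<lambda>x. of_real x * (deriv zeta_reg (z0 + of_real x) / zeta_reg (z0 + of_real x))) \<longlongrightarrow> of_nat m) (at_right (0::real))"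
    using logderiv_radial_limit[OF zeta_reg_holomorphic open_halfspace_Re_gt conn, of z0 1] assms zeta_reg_1 by auto
  have lim1: "((\<lambda>x. of_real x / (z0 + of_real x - 1)) \<longlongrightarrow> (if z0 = 1 then 1 else 0)) (at_right (0::real))"
  proof (cases "z0 = 1")
    case True
    have "\<forall>\<^sub>F x in at_right (0::real). 1 = of_real x / (z0 + of_real x - 1)"
      using eventually_at_right_less[of 0] by eventually_elim (simp add: True)
    then show ?thesis using True tendsto_eventually[of "\<lambda>x. of_real x / (z0 + of_real x - 1)" 1 "at_right 0"]
      by (auto elim: eventually_mono)
  next
    case False
    then show ?thesis by (auto intro!: tendsto_eq_intros)
  qed
  have "\<forall>\<^sub>F x in at_right (0::real). of_real x / (z0 + of_real x - 1) - of_real x * (deriv zeta_reg (z0 + of_real x) / zeta_reg (z0 + of_real x))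
     = of_real x * zeta1_mangoldt (z0 + of_real x)"
    using ev eventually_at_right_less[of 0]
    by eventually_elim (use assms in \<open>simp add: zeta_reg_logderiv algebra_simps\<close>)
  note lim2 = Lim_transform_eventually[OF tendsto_diff[OF lim1 lim] this]
  show ?thesis by (intro exI[of _ m] conjI m lim2)
qed

text \<open>Termwise from \<open>3 + 4 * cos u + cos (2 * u) = 2 * (1 + cos u)\<^sup>2\<close>, as
  the Mangoldt function is nonnegative.\<close>

lemma mangoldt_341:
  assumes "s > 1"
  shows "3 * Re (zeta1_mangoldt (of_real s)) + 4 * Re (zeta1_mangoldt (Complex s t)) + Re (zeta1_mangoldt (Complex s (2*t))) \<ge> 0"
proof -
  have *: "(\<lambda>n. mangoldt (Suc n) * (real (Suc n) powr (-s) * cos (u * ln (real (Suc n))))) sums Re (zeta1_mangoldt (Complex s u))" for u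
  proof -
    have "(\<lambda>n. Re (mangoldt (Suc n) * of_nat (Suc n) powr (- Complex s u))) sums Re (zeta1_mangoldt (Complex s u))"
      by (intro sums_Re dirichlet_sums[OF coeff_bounds(3)]) (use assms in auto)
    moreover have "Re (mangoldt (Suc n) * of_nat (Suc n) powr (- Complex s u)) = 
        mangoldt (Suc n) * (real (Suc n) powr (-s) * cos (u * ln (real (Suc n))))" for n
    proof -
      have "of_nat (Suc n) powr (- Complex s u) = exp (- Complex s u * of_real (ln (real (Suc n))))"
        using Ln_of_nat[of "Suc n"] by (simp add: powr_def del: of_nat_Suc)
      then show ?thesis
        by (simp add: Re_exp powr_def del: of_nat_Suc)
    qed
    ultimately show ?thesis by (simp only:)
  qed
  have "(\<lambda>n. mangoldt (Suc n) * real (Suc n) powr (-s) * (3 + 4 * cos (t * ln (real (Suc n))) + cos (2 * t * ln (real (Suc n)))))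
     sums (3 * Re (zeta1_mangoldt (Complex s 0)) + 4 * Re (zeta1_mangoldt (Complex s t)) + Re (zeta1_mangoldt (Complex s (2*t))))"
    using sums_add[OF sums_add[OF sums_mult[OF *[of 0], of 3] sums_mult[OF *[of t], of 4]] *[of "2*t"]]
    by (simp add: algebra_simps)
  moreover have "mangoldt (Suc n) * real (Suc n) powr (-s) * (3 + 4 * cos (t * ln (real (Suc n))) + cos (2 * t * ln (real (Suc n)))) \<ge> 0" for n
  proof -
    have "3 + 4 * cos (t * ln (real (Suc n))) + cos (2 * t * ln (real (Suc n))) = 2 * (1 + cos (t * ln (real (Suc n))))\<^sup>2"
      using cos_double_cos[of "t * ln (real (Suc n))"] by (simp add: power2_eq_square algebra_simps)
    then show ?thesis by (simp add: mangoldt_nonneg)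
  qed
  ultimately have "3 * Re (zeta1_mangoldt (Complex s 0)) + 4 * Re (zeta1_mangoldt (Complex s t)) + Re (zeta1_mangoldt (Complex s (2*t))) \<ge> 0"
    by (metis (no_types, lifting) sums_le sums_zero)
  moreover have "Complex s 0 = of_real s" by (simp add: complex_eq_iff)
  ultimately show ?thesis by simp
qed

text \<open>Multiplying the 3-4-1 inequality by \<open>x\<close> and letting \<open>x\<close> tend
  to 0 from the right gives \<open>3 * (1 - m0) - 4 * m1 - m2 >= 0\<close>, which a zero with
  \<open>m1 >= 1\<close> contradicts. For \<open>s > 1\<close> the 1 from the pole is missing, so
  the same argument covers the whole closed half-plane.\<close>

lemma zeta_reg_nonzero:
  assumes "Re z0 \<ge> 1"
  shows "zeta_reg z0 \<noteq> 0"
proof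
  assume zero: "zeta_reg z0 = 0"
  then have "z0 \<noteq> 1" using zeta_reg_1 by auto
  define s t where "s = Re z0" and "t = Im z0"
  have z0: "z0 = Complex s t" by (simp add: s_def t_def)
  have s: "s \<ge> 1" using assms by (simp add: s_def)
  have ne: "Complex s t \<noteq> 1" "Complex s (2*t) \<noteq> 1" using \<open>z0 \<noteq> 1\<close> by (auto simp: z0 complex_eq_iff)
  obtain m0 :: nat where m0: "((\<lambda>x. of_real x * zeta1_mangoldt (of_real s + of_real x)) \<longlongrightarrow> (if s = 1 then 1 else 0) - of_nat m0) (at_right (0::real))"
    using zeta1_mangoldt_radial_limit[of "of_real s"] s by auto
  obtain m1 :: nat where m1: "m1 > 0" "((\<lambda>x. of_real x * zeta1_mangoldt (Complex s t + of_real x)) \<longlongrightarrow> - of_nat m1) (at_right (0::real))"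
    using zeta1_mangoldt_radial_limit[of "Complex s t"] s ne zero z0 by auto
  obtain m2 :: nat where m2: "((\<lambda>x. of_real x * zeta1_mangoldt (Complex s (2*t) + of_real x)) \<longlongrightarrow> - of_nat m2) (at_right (0::real))"
    using zeta1_mangoldt_radial_limit[of "Complex s (2*t)"] s ne by auto
  have lim: "((\<lambda>x. 3 * Re (of_real x * zeta1_mangoldt (of_real s + of_real x)) + 4 * Re (of_real x * zeta1_mangoldt (Complex s t + of_real x)) +
      Re (of_real x * zeta1_mangoldt (Complex s (2*t) + of_real x))) \<longlongrightarrow> 
      3 * Re ((if s = 1 then 1 else 0) - of_nat m0) + 4 * Re (- of_nat m1) + Re (- of_nat m2)) (at_right (0::real))"
    by (intro tendsto_intros m0 m1 m2)
  have "3 * Re ((if s = 1 then 1 else 0) - of_nat m0) + 4 * Re (- of_nat m1) + Re (- of_nat m2) \<ge> 0"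
  proof (rule tendsto_lowerbound[OF lim])
    show "\<forall>\<^sub>F x in at_right (0::real). 0 \<le> 3 * Re (of_real x * zeta1_mangoldt (of_real s + of_real x)) + 4 * Re (of_real x * zeta1_mangoldt (Complex s t + of_real x)) +
      Re (of_real x * zeta1_mangoldt (Complex s (2*t) + of_real x))"
      using eventually_at_right_less[of 0]
    proof eventually_elim
      case (elim x)
      have e: "Complex s u + of_real x = Complex (s + x) u" for u by (simp add: complex_eq_iff)
      have "x * (3 * Re (zeta1_mangoldt (of_real (s + x))) + 4 * Re (zeta1_mangoldt (Complex (s + x) t)) + Re (zeta1_mangoldt (Complex (s + x) (2*t)))) \<ge> 0"
        using elim s by (intro mult_nonneg_nonneg mangoldt_341) auto
      moreover have e': "of_real s + of_real x = (of_real (s + x) :: complex)" by simp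
      ultimately show ?case unfolding e e' by (simp add: distrib_left mult.left_commute del: of_real_add)
    qed
  qed auto
  then show False using m1(1) by (auto split: if_splits)
qed

section \<open>Primes in short intervals\<close>

text \<open>Both the Mangoldt series and zeta have a simple pole with residue 1 at
  \<open>s = 1\<close>. In their difference the two poles cancel; what remains is written through
  \<open>zeta_reg\<close>, and the \<open>if\<close> fills the removable singularity of the
  difference quotient.\<close>

definition zeta_diff :: "complex \<Rightarrow> complex" where
  "zeta_diff s = - (deriv zeta_reg s / zeta_reg s) - (if s = 1 then deriv zeta_reg 1 else (zeta_reg s - zeta_reg 1) / (s - 1))"

lemma zeta_diff_eq: "Re s > 1 \<Longrightarrow> zeta_diff s = zeta1_mangoldt s - zeta1 s"
proof -
  assume s: "Re s > 1"
  then have "s \<noteq> 1" by auto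
  moreover have "(zeta_reg s - 1) / (s - 1) = zeta1 s - 1 / (s - 1)"
    using \<open>s \<noteq> 1\<close> by (simp add: zeta_reg_eq[OF s] diff_divide_distrib)
  ultimately show ?thesis
    using zeta_reg_logderiv[OF s zeta_reg_nonzero] s by (simp add: zeta_diff_def zeta_reg_1)
qed

lemma zeta_diff_holomorphic:
  obtains U where "open U" "{s. Re s \<ge> 1} \<subseteq> U" "zeta_diff holomorphic_on U"
proof
  define S where "S = {s::complex. Re s > 0}"
  define U where "U = {s\<in>S. zeta_reg s \<noteq> 0}"
  have S: "open S" unfolding S_def by (rule open_halfspace_Re_gt)
  have hol: "zeta_reg holomorphic_on S" unfolding S_def by (rule zeta_reg_holomorphic)
  have "U = S \<inter> zeta_reg -` (- {0})" by (auto simp: U_def)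
  then show oU: "open U"
    using continuous_open_preimage[OF holomorphic_on_imp_continuous_on[OF hol] S, of "- {0}"] by auto
  show "{s. Re s \<ge> 1} \<subseteq> U" using zeta_reg_nonzero by (auto simp: U_def S_def)
  have US: "U \<subseteq> S" by (auto simp: U_def)
  have 1: "(\<lambda>s. if s = 1 then deriv zeta_reg 1 else (zeta_reg s - zeta_reg 1) / (s - 1)) holomorphic_on U"
    by (rule holomorphic_on_subset[OF pole_lemma_open[OF hol S] US])
  show "zeta_diff holomorphic_on U"
    unfolding zeta_diff_def [abs_def]
    by (intro holomorphic_intros 1 holomorphic_on_subset[OF hol US] holomorphic_on_subset[OF holomorphic_deriv[OF hol S] US])
       (auto simp: U_def)
qed

text \<open>One integration by parts gains the factor \<open>1 / y\<close>; the weight vanishes at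
  \<open>t = l\<close>, so only the boundary term at 0 survives. The bound is uniform in
  \<open>\<sigma>\<close> down to 1 because \<open>f\<close> and its derivative are bounded on a
  compact rectangle that includes the edge \<open>Re s = 1\<close>.\<close>

lemma oscillatory_integral_bound:
  assumes "open U" "{s. Re s \<ge> 1} \<subseteq> U" "f holomorphic_on U" "l > 0"
  obtains B where "B > 0" "\<And>\<sigma> y. 1 \<le> \<sigma> \<Longrightarrow> \<sigma> \<le> 2 \<Longrightarrow> y > 0 \<Longrightarrow>
     norm (integral {0..l} (\<lambda>t. of_real (1 - t / l) * f (Complex \<sigma> t) * exp (\<i> * of_real (t * y)))) \<le> B / y"
proof -
  define K where "K = cbox (Complex 1 0) (Complex 2 l)"
  have KU: "K \<subseteq> U" using assms(2) by (auto simp: K_def in_cbox_complex_iff)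
  have holK: "f holomorphic_on K" "deriv f holomorphic_on K"
    using holomorphic_on_subset[OF assms(3) KU] holomorphic_on_subset[OF holomorphic_deriv[OF assms(3,1)] KU] .
  have "bounded (f ` K)" "bounded (deriv f ` K)"
    using holK by (auto intro!: compact_imp_bounded compact_continuous_image holomorphic_on_imp_continuous_on simp: K_def)
  then obtain B1 B2 where B1: "B1 > 0" "\<And>s. s \<in> K \<Longrightarrow> norm (f s) \<le> B1" and B2: "B2 > 0" "\<And>s. s \<in> K \<Longrightarrow> norm (deriv f s) \<le> B2"
    by (auto simp: bounded_pos)
  have inK: "Complex \<sigma> t \<in> K" if "1 \<le> \<sigma>" "\<sigma> \<le> 2" "t \<in> {0..l}" for \<sigma> t
    using that by (auto simp: K_def in_cbox_complex_iff)
  show ?thesis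
  proof (rule that[of "B1 + (B1 / l + B2) * l"])
    show "B1 + (B1 / l + B2) * l > 0" using B1(1) B2(1) assms(4) by (intro add_pos_nonneg) auto
    fix \<sigma> y :: real assume s: "1 \<le> \<sigma>" "\<sigma> \<le> 2" and y: "y > 0"
    \<comment> \<open>The integrand is taken as a function of a complex variable, so that the
      product rule for complex derivatives yields the primitive
      \<open>W z * E z / (\<i> * of_real y)\<close>.\<close>
    define W where "W = (\<lambda>z. (1 - z / of_real l) * f (of_real \<sigma> + \<i> * z))"
    define W' where "W' = (\<lambda>z. (1 - z / of_real l) * (\<i> * deriv f (of_real \<sigma> + \<i> * z)) - f (of_real \<sigma> + \<i> * z) / of_real l)"
    define E where "E = (\<lambda>z. exp (\<i> * (z * of_real y)))"
    have cx: "of_real \<sigma> + \<i> * of_real t = Complex \<sigma> t" for t by (simp add: complex_eq_iff)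
    have df: "(f has_field_derivative deriv f (Complex \<sigma> t)) (at (Complex \<sigma> t))" if "t \<in> {0..l}" for t
      using holomorphic_derivI[OF assms(3,1)] KU inK[OF s that] by auto
    have dW: "(W has_field_derivative W' (of_real t)) (at (of_real t))" if "t \<in> {0..l}" for t
    proof -
      have "((\<lambda>z. f (of_real \<sigma> + \<i> * z)) has_field_derivative deriv f (of_real \<sigma> + \<i> * of_real t) * \<i>) (at (of_real t))"
        by (rule DERIV_chain2[where f = f and g = "\<lambda>z. of_real \<sigma> + \<i> * z"])
           (use df[OF that] in \<open>auto simp: cx intro!: derivative_eq_intros\<close>)
      moreover have "((\<lambda>z. 1 - z / of_real l) has_field_derivative - 1 / of_real l) (at (of_real t :: complex))"
        using assms(4) by (auto intro!: derivative_eq_intros)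
      ultimately show ?thesis unfolding W_def W'_def
        using DERIV_mult by (force simp: mult.commute)
    qed
    have dWE: "((\<lambda>z. W z * E z / (\<i> * of_real y)) has_field_derivative W (of_real t) * E (of_real t) + W' (of_real t) * E (of_real t) / (\<i> * of_real y)) (at (of_real t))"
      if "t \<in> {0..l}" for t
    proof -
      have "(E has_field_derivative E (of_real t) * (\<i> * of_real y)) (at (of_real t))"
        unfolding E_def by (auto intro!: derivative_eq_intros)
      from DERIV_cdivide[OF DERIV_mult[OF dW[OF that] this], of "\<i> * of_real y"] show ?thesis
        using y by (simp add: add_divide_distrib mult.assoc add.commute mult.commute[of "W (of_real t)"])
    qed
    have int1: "((\<lambda>t. W (of_real t) * E (of_real t) + W' (of_real t) * E (of_real t) / (\<i> * of_real y)) has_integral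
       (W (of_real l) * E (of_real l) / (\<i> * of_real y) - W (of_real 0) * E (of_real 0) / (\<i> * of_real y))) {0..l}"
      using assms(4) by (intro fundamental_theorem_of_calculus has_vector_derivative_real_field dWE) auto
    have contf: "continuous_on {0..l} (\<lambda>t. f (of_real \<sigma> + \<i> * of_real t))" "continuous_on {0..l} (\<lambda>t. deriv f (of_real \<sigma> + \<i> * of_real t))"
      by (rule continuous_on_compose2[OF holomorphic_on_imp_continuous_on[OF holK(1)]]
            continuous_on_compose2[OF holomorphic_on_imp_continuous_on[OF holK(2)]];
          use inK[OF s] in \<open>auto simp: cx[symmetric] intro!: continuous_intros\<close>)+
    have int2: "(\<lambda>t. W' (of_real t) * E (of_real t) / (\<i> * of_real y)) integrable_on {0..l}"
      unfolding W'_def E_def using assms(4) y by (intro integrable_continuous_real continuous_intros contf) auto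
    have W: "W (of_real l) = 0" using assms(4) by (simp add: W_def)
    have "((\<lambda>t. W (of_real t) * E (of_real t)) has_integral 
       (0 - W 0 * E 0 / (\<i> * of_real y) - integral {0..l} (\<lambda>t. W' (of_real t) * E (of_real t) / (\<i> * of_real y)))) {0..l}"
      using has_integral_diff[OF int1 integrable_integral[OF int2]] by (simp add: W)
    then have eq: "integral {0..l} (\<lambda>t. W (of_real t) * E (of_real t)) = 
       - W 0 * E 0 / (\<i> * of_real y) - integral {0..l} (\<lambda>t. W' (of_real t) * E (of_real t) / (\<i> * of_real y))"
      by (simp add: integral_unique)
    have nE: "norm (E (of_real t)) = 1" for t
      unfolding E_def by (simp flip: of_real_mult)
    have "norm (integral {0..l} (\<lambda>t. W' (of_real t) * E (of_real t) / (\<i> * of_real y))) \<le> (B1 / l + B2) / y * (l - 0)"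
    proof (rule integral_bound)
      show "continuous_on {0..l} (\<lambda>t. W' (of_real t) * E (of_real t) / (\<i> * of_real y))"
        unfolding W'_def E_def using assms(4) y by (intro continuous_intros contf) auto
      fix t assume t: "t \<in> {0..l}"
      have a: "norm (1 - of_real t / of_real l :: complex) \<le> 1"
      proof -
        have "norm (of_real (1 - t / l) :: complex) \<le> 1" unfolding norm_of_real using t assms(4) by (auto simp: field_simps)
        then show ?thesis by simp
      qed
      have "norm (W' (of_real t)) \<le> norm ((1 - of_real t / of_real l) * (\<i> * deriv f (of_real \<sigma> + \<i> * of_real t))) + norm (f (of_real \<sigma> + \<i> * of_real t) / of_real l)"
        unfolding W'_def by (rule norm_triangle_ineq4)
      also have "\<dots> \<le> 1 * B2 + B1 / l"
        using a B1(2)[OF inK[OF s t]] B2(2)[OF inK[OF s t]] assms(4) unfolding cx norm_mult norm_divide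
        by (intro add_mono mult_mono) (auto intro: divide_right_mono)
      finally show "norm (W' (of_real t) * E (of_real t) / (\<i> * of_real y)) \<le> (B1 / l + B2) / y"
        using y by (simp add: norm_mult norm_divide nE divide_right_mono add.commute)
    qed (use assms(4) in auto)
    moreover have "norm (- W 0 * E 0 / (\<i> * of_real y)) \<le> B1 / y"
      using nE[of 0] B1(2)[OF inK[OF s, of 0]] assms(4) y cx[of 0]
      by (simp add: norm_mult norm_divide W_def divide_right_mono)
    ultimately have "norm (integral {0..l} (\<lambda>t. W (of_real t) * E (of_real t))) \<le> B1 / y + (B1 / l + B2) / y * l"
      unfolding eq using norm_triangle_ineq4 by (smt (verit))
    also have "\<dots> = (B1 + (B1 / l + B2) * l) / y" using assms(4) y by (simp add: field_simps)
    also have "(\<lambda>t. W (of_real t) * E (of_real t)) = (\<lambda>t. of_real (1 - t / l) * f (Complex \<sigma> t) * exp (\<i> * of_real (t * y)))"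
      by (simp add: W_def E_def cx fun_eq_iff)
    finally show "norm (integral {0..l} (\<lambda>t. of_real (1 - t / l) * f (Complex \<sigma> t) * exp (\<i> * of_real (t * y)))) \<le> (B1 + (B1 / l + B2) * l) / y" .
  qed
qed

section \<open>The Fejer kernel, as cosine transform of the triangular weight\<close>

definition fejer :: "real \<Rightarrow> real \<Rightarrow> real" where
  "fejer l v = integral {0..l} (\<lambda>t. (1 - t / l) * cos (t * v))"

lemma fejer_has_integral:
  "l > 0 \<Longrightarrow> ((\<lambda>t. (1 - t / l) * cos (t * v)) has_integral fejer l v) {0..l}"
  unfolding fejer_def
  by (intro integrable_integral integrable_continuous_real continuous_intros) auto

lemma fejer_eq:
  assumes "l > 0" "v \<noteq> 0"
  shows "fejer l v = (1 - cos (l * v)) / (l * v\<^sup>2)"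
proof -
  have "((\<lambda>t. (1 - t / l) * cos (t * v)) has_integral 
    ((1 - l / l) * sin (l * v) / v - cos (l * v) / (l * v\<^sup>2) - ((1 - 0 / l) * sin (0 * v) / v - cos (0 * v) / (l * v\<^sup>2)))) {0..l}"
  proof (rule fundamental_theorem_of_calculus)
    fix t assume "t \<in> {0..l}"
    have "((\<lambda>t. (1 - t / l) * sin (t * v) / v - cos (t * v) / (l * v\<^sup>2)) has_real_derivative (1 - t / l) * cos (t * v)) (at t within {0..l})"
      using assms by (auto intro!: derivative_eq_intros simp: field_simps power2_eq_square)
    then show "((\<lambda>t. (1 - t / l) * sin (t * v) / v - cos (t * v) / (l * v\<^sup>2)) has_vector_derivative (1 - t / l) * cos (t * v)) (at t within {0..l})"
      by (simp add: has_real_derivative_iff_has_vector_derivative)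
  qed (use assms in auto)
  then show ?thesis unfolding fejer_def using assms
    by (simp add: integral_unique diff_divide_distrib)
qed

lemma integral_fejer_weight: "l > 0 \<Longrightarrow> ((\<lambda>t. 1 - t / l) has_integral l / 2) {0..l::real}"
proof -
  assume l: "l > 0"
  have "((\<lambda>t. 1 - t / l) has_integral ((l - l\<^sup>2 / (2 * l)) - (0 - 0\<^sup>2 / (2 * l)))) {0..l}"
  proof (rule fundamental_theorem_of_calculus)
    fix t assume "t \<in> {0..l}"
    have "((\<lambda>t. t - t\<^sup>2 / (2 * l)) has_real_derivative 1 - t / l) (at t within {0..l})"
      using l by (auto intro!: derivative_eq_intros simp: field_simps)
    then show "((\<lambda>t. t - t\<^sup>2 / (2 * l)) has_vector_derivative 1 - t / l) (at t within {0..l})"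
      by (simp add: has_real_derivative_iff_has_vector_derivative)
  qed (use l in auto)
  then show ?thesis using l by (simp add: power2_eq_square)
qed

lemma fejer_le: "l > 0 \<Longrightarrow> fejer l v \<le> l / 2"
  by (rule has_integral_le[OF fejer_has_integral integral_fejer_weight]) (auto intro!: mult_left_le)

lemma fejer_ge:
  assumes "l > 0" "\<bar>v\<bar> \<le> 1 / l"
  shows "fejer l v \<ge> l / 4"
proof -
  have "((\<lambda>t. (1 - t / l) * (1/2)) has_integral (l / 2 * (1/2))) {0..l}"
    using integral_fejer_weight[OF assms(1)] by (rule has_integral_mult_left)
  moreover have "((\<lambda>t. (1 - t / l) * cos (t * v)) has_integral fejer l v) {0..l}"
    by (rule fejer_has_integral[OF assms(1)])
  ultimately have "l / 2 * (1/2) \<le> fejer l v"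
  proof (rule has_integral_le)
    fix t assume t: "t \<in> {0..l}"
    have "\<bar>t * v\<bar> \<le> l * (1 / l)" unfolding abs_mult using t assms by (intro mult_mono) auto
    then have "\<bar>t * v\<bar> \<le> 1" using assms by simp
    then have "\<bar>sin (t * v / 2)\<bar> \<le> 1 / 2" using abs_sin_x_le_abs_x[of "t * v / 2"] by linarith
    then have "(sin (t * v / 2))\<^sup>2 \<le> (1 / 2)\<^sup>2" by (metis abs_le_square_iff abs_of_nonneg zero_le_divide_1_iff zero_le_numeral)
    then have "1/2 \<le> cos (t * v)" using cos_double_sin[of "t * v / 2"] by (simp add: power2_eq_square)
    then show "(1 - t / l) * (1 / 2) \<le> (1 - t / l) * cos (t * v)"
      using t assms by (intro mult_left_mono) (auto simp: field_simps)
  qed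
  then show ?thesis by simp
qed

lemma fejer_nonneg: "l > 0 \<Longrightarrow> fejer l v \<ge> 0"
  using fejer_eq[of l v] fejer_ge[of l 0] by (cases "v = 0") auto

lemma fejer_decay: "l > 0 \<Longrightarrow> v \<noteq> 0 \<Longrightarrow> fejer l v \<le> 2 / (l * v\<^sup>2)"
  using cos_ge_minus_one[of "l * v"] by (simp add: fejer_eq divide_right_mono)


text \<open>The sum is the real part of the weighted integral of a partial sum of
  \<open>zeta_diff\<close> on the line \<open>Re s = 1 + x\<close>. The partial sums converge
  uniformly in \<open>t\<close>, since their tails are dominated by absolute values, so the
  oscillatory bound carries over. It matters that \<open>B\<close> is independent of
  \<open>x\<close>: later \<open>x\<close> tends to 0 as \<open>y\<close> grows.\<close>

lemma fejer_weighted_mangoldt_sum_bound: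
  assumes l: "l > 0"
  obtains B where "B > 0" "\<And>x y \<eta>. 0 < x \<Longrightarrow> x \<le> 1 \<Longrightarrow> y > 0 \<Longrightarrow> \<eta> > 0 \<Longrightarrow> 
    \<forall>\<^sub>F N in sequentially. \<bar>\<Sum>n<N. (mangoldt (Suc n) - 1) * real (Suc n) powr (-1 - x) * fejer l (y - ln (real (Suc n)))\<bar> \<le> B / y + \<eta>"
proof -
  obtain U where U: "open U" "{s. Re s \<ge> 1} \<subseteq> U" "zeta_diff holomorphic_on U"
    using zeta_diff_holomorphic .
  obtain B where B: "B > 0" and Bb: "\<And>\<sigma> y. 1 \<le> \<sigma> \<Longrightarrow> \<sigma> \<le> 2 \<Longrightarrow> y > 0 \<Longrightarrow>
     norm (integral {0..l} (\<lambda>t. of_real (1 - t / l) * zeta_diff (Complex \<sigma> t) * exp (\<i> * of_real (t * y)))) \<le> B / y"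
    using oscillatory_integral_bound[OF U l] by blast
  show ?thesis
  proof (rule that[OF B])
    fix x y \<eta> :: real assume x: "0 < x" "x \<le> 1" and y: "y > 0" and eta: "\<eta> > 0"
    define a where "a = (\<lambda>n. mangoldt (Suc n) - 1 :: complex)"
    have a_bd: "norm (a n) \<le> 1 * (1 + ln (real (Suc n)))" for n
      unfolding a_def using coeff_bounds(3)[of n] norm_triangle_ineq4[of "mangoldt (Suc n) :: complex" 1] mangoldt_le[of "Suc n"] by (simp del: of_nat_Suc)
    define S where "S = (\<lambda>N s. \<Sum>n<N. a n * of_nat (Suc n) powr (-s))"
    define c where "c = (\<lambda>n. norm (a n * of_nat (Suc n) powr (- of_real (1 + x))))"
    have c_eq: "norm (a n * of_nat (Suc n) powr (- Complex (1 + x) t)) = c n" for n t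
      by (simp only: c_def norm_mult norm_nat_powr uminus_complex.sel complex.sel Re_complex_of_real)
    have sumc: "summable c" unfolding c_def by (rule dirichlet_summable[OF a_bd]) (use x in simp)
    have zd: "(\<lambda>n. a n * of_nat (Suc n) powr (-s)) sums zeta_diff s" if "Re s > 1" for s
      using sums_diff[OF dirichlet_sums[OF coeff_bounds(3) that] dirichlet_sums[OF coeff_bounds(1) that]]
      by (simp add: zeta_diff_eq[OF that] a_def algebra_simps)
    have diff: "norm (zeta_diff (Complex (1 + x) t) - S N (Complex (1 + x) t)) \<le> (\<Sum>n. c (n + N))" for N t
    proof -
      have *: "(\<lambda>n. a n * of_nat (Suc n) powr (- Complex (1 + x) t)) sums zeta_diff (Complex (1 + x) t)"
        by (rule zd) (use x in simp)
      have "(\<lambda>n. a (n + N) * of_nat (Suc (n + N)) powr (- Complex (1 + x) t)) sums (zeta_diff (Complex (1 + x) t) - S N (Complex (1 + x) t))"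
        using sums_split_initial_segment[OF *, of N] by (simp add: S_def)
      then have "zeta_diff (Complex (1 + x) t) - S N (Complex (1 + x) t) = (\<Sum>n. a (n + N) * of_nat (Suc (n + N)) powr (- Complex (1 + x) t))"
        by (simp add: sums_iff)
      also have "norm \<dots> \<le> (\<Sum>n. norm (a (n + N) * of_nat (Suc (n + N)) powr (- Complex (1 + x) t)))"
        by (rule summable_norm) (simp only: c_eq summable_iff_shift sumc)
      finally show ?thesis by (simp only: c_eq)
    qed
    have tail: "(\<lambda>N. (\<Sum>n. c (n + N))) \<longlonglongrightarrow> 0"
      by (rule suminf_exist_split2[OF sumc])
    \<comment> \<open>The error \<open>\<eta> / l\<close> is integrated over an interval of length
      \<open>l\<close>.\<close>
    have ev: "\<forall>\<^sub>F N in sequentially. (\<Sum>n. c (n + N)) < \<eta> / l"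
      using tail eta l by (intro order_tendstoD(2)[OF tail]) auto
    then show "\<forall>\<^sub>F N in sequentially. \<bar>\<Sum>n<N. (mangoldt (Suc n) - 1) * real (Suc n) powr (-1 - x) * fejer l (y - ln (real (Suc n)))\<bar> \<le> B / y + \<eta>"
    proof eventually_elim
      case (elim N)
      define e where "e = (\<lambda>t. exp (\<i> * of_real (t * y)))"
      define z where "z = (\<lambda>t. zeta_diff (Complex (1 + x) t))"
      define T where "T = (\<lambda>t. S N (Complex (1 + x) t))"
      have Cx: "Complex (1 + x) t = of_real (1 + x) + \<i> * of_real t" for t by (simp add: complex_eq_iff)
      have contz: "continuous_on {0..l} z" 
        unfolding z_def Cx
        by (rule continuous_on_compose2[OF holomorphic_on_imp_continuous_on[OF U(3)]])
           (use U(2) x in \<open>auto intro!: continuous_intros\<close>)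
      have contT: "continuous_on {0..l} T"
        unfolding T_def S_def Cx by (intro continuous_intros) (auto simp del: of_nat_Suc)
      have conte: "continuous_on {0..l} e" unfolding e_def by (intro continuous_intros)
      have ne: "norm (e t) = 1" for t unfolding e_def by simp
      have intz: "(\<lambda>t. of_real (1 - t / l) * z t * e t) integrable_on {0..l}"
        using l by (intro integrable_continuous_real continuous_intros contz conte) auto
      have intT: "(\<lambda>t. of_real (1 - t / l) * T t * e t) integrable_on {0..l}"
        using l by (intro integrable_continuous_real continuous_intros contT conte) auto
      have "norm (integral {0..l} (\<lambda>t. of_real (1 - t / l) * (T t - z t) * e t)) \<le> \<eta> / l * (l - 0)"
      proof (rule integral_bound)
        show "continuous_on {0..l} (\<lambda>t. of_real (1 - t / l) * (T t - z t) * e t)"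
          using l by (intro continuous_intros contT contz conte) auto
        fix t assume t: "t \<in> {0..l}"
        have "norm (of_real (1 - t / l) :: complex) \<le> 1" unfolding norm_of_real using t l by (auto simp: field_simps)
        moreover have "norm (T t - z t) \<le> \<eta> / l"
          using diff[of t N] elim unfolding T_def z_def norm_minus_commute[of "S N _"] by linarith
        ultimately have "norm (of_real (1 - t / l) :: complex) * norm (T t - z t) * norm (e t) \<le> 1 * (\<eta> / l) * 1"
          unfolding ne using eta l by (intro mult_mono) auto
        then show "norm (of_real (1 - t / l) * (T t - z t) * e t) \<le> \<eta> / l"
          by (simp add: norm_mult)
      qed (use l in auto)
      moreover have "integral {0..l} (\<lambda>t. of_real (1 - t / l) * (T t - z t) * e t) = 
         integral {0..l} (\<lambda>t. of_real (1 - t / l) * T t * e t) - integral {0..l} (\<lambda>t. of_real (1 - t / l) * z t * e t)"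
        by (subst integral_diff[symmetric, OF intT intz]) (simp only: right_diff_distrib left_diff_distrib)
      moreover have "norm (integral {0..l} (\<lambda>t. of_real (1 - t / l) * z t * e t)) \<le> B / y"
        unfolding z_def e_def by (rule Bb) (use x y in auto)
      ultimately have nT: "norm (integral {0..l} (\<lambda>t. of_real (1 - t / l) * T t * e t)) \<le> B / y + \<eta>"
        using l norm_triangle_sub[of "integral {0..l} (\<lambda>t. of_real (1 - t / l) * T t * e t)" "integral {0..l} (\<lambda>t. of_real (1 - t / l) * z t * e t)"] by simp
      have "Re (of_real (1 - t / l) * T t * e t) = (\<Sum>n<N. (mangoldt (Suc n) - 1) * real (Suc n) powr (-1 - x) * ((1 - t / l) * cos (t * (y - ln (real (Suc n))))))" for t
      proof -
        \<comment> \<open>The phases of the Dirichlet term and of \<open>e t\<close> combine to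
          frequency \<open>y - ln (Suc n)\<close>; integrating over \<open>t\<close> then produces
          the kernel at that point.\<close>
        have pw: "of_nat (Suc n) powr (- Complex (1 + x) t) * e t = of_real (real (Suc n) powr (-1 - x)) * exp (\<i> * of_real (t * (y - ln (real (Suc n)))))" for n
        proof -
          have "of_nat (Suc n) powr (- Complex (1 + x) t) * e t = exp (- Complex (1 + x) t * of_real (ln (real (Suc n))) + \<i> * of_real (t * y))"
          proof -
            have "of_nat (Suc n) powr (- Complex (1 + x) t) = exp (- Complex (1 + x) t * of_real (ln (real (Suc n))))"
              using Ln_of_nat[of "Suc n"] by (simp add: powr_def del: of_nat_Suc)
            then show ?thesis by (simp only: e_def exp_add)
          qed
          also have "- Complex (1 + x) t * of_real (ln (real (Suc n))) + \<i> * of_real (t * y) = 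
             of_real ((-1 - x) * ln (real (Suc n))) + \<i> * of_real (t * (y - ln (real (Suc n))))"
            by (simp add: complex_eq_iff algebra_simps del: of_nat_Suc)
          finally show ?thesis
            by (simp add: exp_add powr_def exp_of_real del: of_nat_Suc of_real_mult)
        qed
        have "of_real (1 - t / l) * T t * e t = (\<Sum>n<N. of_real (1 - t / l) * (a n * (of_nat (Suc n) powr (- Complex (1 + x) t) * e t)))"
          unfolding T_def S_def by (simp only: sum_distrib_left sum_distrib_right mult.assoc)
        also have "\<dots> = (\<Sum>n<N. of_real ((mangoldt (Suc n) - 1) * real (Suc n) powr (-1 - x) * (1 - t / l)) * exp (\<i> * of_real (t * (y - ln (real (Suc n))))))"
          unfolding pw a_def by (intro sum.cong refl) (simp add: mult_ac del: of_nat_Suc)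
        finally have eq: "of_real (1 - t / l) * T t * e t = \<dots>" .
        have "Re (of_real r * exp (\<i> * of_real u)) = r * cos u" for r u by (simp add: Re_exp)
        then show ?thesis unfolding eq Re_sum by (intro sum.cong refl) (simp only: mult.assoc)
      qed
      moreover have "((\<lambda>t. Re (of_real (1 - t / l) * T t * e t)) has_integral Re (integral {0..l} (\<lambda>t. of_real (1 - t / l) * T t * e t))) {0..l}"
        using has_integral_Re[OF integrable_integral[OF intT]] .
      ultimately have "((\<lambda>t. \<Sum>n<N. (mangoldt (Suc n) - 1) * real (Suc n) powr (-1 - x) * ((1 - t / l) * cos (t * (y - ln (real (Suc n))))))
         has_integral Re (integral {0..l} (\<lambda>t. of_real (1 - t / l) * T t * e t))) {0..l}" by (simp only:)
      moreover have "((\<lambda>t. \<Sum>n<N. (mangoldt (Suc n) - 1) * real (Suc n) powr (-1 - x) * ((1 - t / l) * cos (t * (y - ln (real (Suc n))))))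
         has_integral (\<Sum>n<N. (mangoldt (Suc n) - 1) * real (Suc n) powr (-1 - x) * fejer l (y - ln (real (Suc n))))) {0..l}"
        by (intro has_integral_sum has_integral_mult_right fejer_has_integral l) auto
      ultimately have "(\<Sum>n<N. (mangoldt (Suc n) - 1) * real (Suc n) powr (-1 - x) * fejer l (y - ln (real (Suc n)))) = Re (integral {0..l} (\<lambda>t. of_real (1 - t / l) * T t * e t))"
        by (rule has_integral_unique[symmetric])
      then show ?case using nT abs_Re_le_cmod[of "integral {0..l} (\<lambda>t. of_real (1 - t / l) * T t * e t)"] by simp
    qed
  qed
qed

text \<open>Within the window \<open>1 / n\<close> is at most \<open>exp (-u)\<close>, and
  Chebyshev's bound gives total weight at most \<open>3 * exp (u + 1)\<close>; finally
  \<open>3 * exp 1 <= 9\<close>.\<close>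

lemma sum_mangoldt_div_unit_window_le:
  assumes "finite A" "\<And>n. n \<in> A \<Longrightarrow> n \<ge> 1 \<and> u \<le> ln (real n) \<and> ln (real n) \<le> u + 1"
  shows "(\<Sum>n\<in>A. mangoldt n / real n) \<le> 9"
proof -
  define X where "X = nat \<lfloor>exp (u + 1)\<rfloor>"
  have "(\<Sum>n\<in>A. mangoldt n / real n) \<le> (\<Sum>n\<in>A. mangoldt n * exp (-u))"
  proof (intro sum_mono)
    fix n assume "n \<in> A"
    then have n: "n \<ge> 1" "u \<le> ln (real n)" using assms(2) by auto
    then have "exp u \<le> real n" by (simp add: ln_ge_iff)
    then have "1 / real n \<le> 1 / exp u" by (intro divide_left_mono) (use n in auto)
    then show "mangoldt n / real n \<le> mangoldt n * exp (-u)"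
      using mult_left_mono[OF _ mangoldt_nonneg, of "1 / real n" "1 / exp u" n] by (simp add: exp_minus field_simps)
  qed
  also have "\<dots> = exp (-u) * (\<Sum>n\<in>A. mangoldt n)" by (subst mult.commute) (simp only: sum_distrib_right)
  also have "(\<Sum>n\<in>A. mangoldt n) \<le> (\<Sum>n=1..X. mangoldt n :: real)"
  proof (intro sum_mono2)
    show "A \<subseteq> {1..X}"
    proof
      fix n assume "n \<in> A"
      then have n: "n \<ge> 1" "ln (real n) \<le> u + 1" using assms(2) by auto
      then have "real n \<le> exp (u + 1)" using ln_le_cancel_iff[of "real n" "exp (u+1)"] by simp
      then show "n \<in> {1..X}" using n by (simp add: X_def le_nat_floor)
    qed
  qed (auto simp: mangoldt_nonneg)
  also have "\<dots> \<le> 3 * real X" by (rule sum_mangoldt_le)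
  also have "real X \<le> exp (u + 1)" by (simp add: X_def)
  also have "exp (-u) * (3 * exp (u + 1)) = 3 * exp 1" by (simp add: exp_add exp_minus field_simps)
  also have "\<dots> \<le> 9" using exp_le by simp
  finally show ?thesis by (simp add: mult_left_mono)
qed

lemma sum_inverse_squares_le: "finite F \<Longrightarrow> (\<Sum>j\<in>F. 1 / (real j + 1)\<^sup>2) \<le> 2"
proof -
  assume F: "finite F"
  have *: "(\<Sum>j<Suc M. 1 / (real j + 1)\<^sup>2) \<le> 2 - 1 / (real M + 1)" for M
  proof (induction M)
    case (Suc M)
    have "1 / (real M + 2)\<^sup>2 \<le> 1 / ((real M + 1) * (real M + 2))"
      unfolding power2_eq_square by (intro divide_left_mono mult_right_mono) auto
    also have "\<dots> = 1 / (real M + 1) - 1 / (real M + 2)"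
      by (simp add: field_simps)
    finally show ?case using Suc.IH by (simp add: add.commute)
  qed simp
  obtain M where "F \<subseteq> {..<M}" using F finite_nat_iff_bounded by auto
  then have "(\<Sum>j\<in>F. 1 / (real j + 1)\<^sup>2) \<le> (\<Sum>j<Suc M. 1 / (real j + 1)\<^sup>2)" by (intro sum_mono2) auto
  also have "\<dots> \<le> 2" using *[of M] by (smt (verit) divide_nonneg_nonneg of_nat_0_le_iff)
  finally show ?thesis .
qed

text \<open>Shells of unit width around \<open>y\<close> in logarithmic scale: the shell
  \<open>j\<close> consists of two windows of mass at most 9 each. As
  \<open>\<epsilon> <= 1\<close>, its points have distance at least
  \<open>\<epsilon> * (j + 1) / 2\<close> from \<open>y\<close>, also for \<open>j = 0\<close>, so
  the kernel is at most \<open>8 / (l * \<epsilon>\<^sup>2 * (j + 1)\<^sup>2)\<close>. Hence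
  \<open>288 = 18 * 8 * 2\<close>. The factor \<open>1 / l\<close> is what makes the tail
  small.\<close>

lemma fejer_weighted_mangoldt_tail_le:
  assumes A: "finite A" "\<And>n. n \<in> A \<Longrightarrow> n \<ge> 1 \<and> \<bar>ln (real n) - y\<bar> \<ge> \<epsilon>" and e: "0 < \<epsilon>" "\<epsilon> \<le> 1" and l: "l > 0"
  shows "(\<Sum>n\<in>A. mangoldt n / real n * fejer l (y - ln (real n))) \<le> 288 / (l * \<epsilon>\<^sup>2)"
proof -
  define J where "J = (\<lambda>n. nat \<lfloor>\<bar>ln (real n) - y\<bar>\<rfloor>)"
  have Jb: "real (J n) \<le> \<bar>ln (real n) - y\<bar>" "\<bar>ln (real n) - y\<bar> < real (J n) + 1" for n
    unfolding J_def by linarith+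
  define w where "w = (\<lambda>j::nat. 8 / (l * \<epsilon>\<^sup>2) * (1 / (real j + 1)\<^sup>2))"
  have w0: "w j \<ge> 0" for j using l by (simp add: w_def)
  have fw: "fejer l (y - ln (real n)) \<le> w (J n)" if "n \<in> A" for n
  proof -
    define v where "v = \<bar>ln (real n) - y\<bar>"
    have v: "v \<ge> \<epsilon>" "v \<ge> real (J n)" using A(2)[OF that] by (auto simp: v_def J_def)
    have "\<epsilon> * (real (J n) + 1) / 2 \<le> v"
    proof (cases "J n = 0")
      case False
      have "\<epsilon> * (real (J n) + 1) \<le> 1 * (real (J n) + 1)" using e by (intro mult_right_mono) auto
      also have "\<dots> \<le> 2 * real (J n)" using False by simp
      also have "\<dots> \<le> 2 * v" using v(2) by simp
      finally show ?thesis by simp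
    qed (use v e in simp)
    then have sq: "(\<epsilon> * (real (J n) + 1) / 2)\<^sup>2 \<le> v\<^sup>2" using e by (intro power_mono) auto
    have "fejer l (y - ln (real n)) \<le> 2 / (l * (y - ln (real n))\<^sup>2)"
      using v e by (intro fejer_decay l) (auto simp: v_def)
    also have "(y - ln (real n))\<^sup>2 = v\<^sup>2" by (simp add: v_def power2_commute)
    also have "2 / (l * v\<^sup>2) \<le> 2 / (l * (\<epsilon> * (real (J n) + 1) / 2)\<^sup>2)"
      using sq l e by (intro divide_left_mono mult_left_mono) (auto intro!: mult_pos_pos simp: v_def)
    also have "\<dots> = w (J n)" by (simp add: w_def power_mult_distrib power_divide)
    finally show ?thesis .
  qed
  have "(\<Sum>n\<in>A. mangoldt n / real n * fejer l (y - ln (real n))) \<le> (\<Sum>n\<in>A. mangoldt n / real n * w (J n))"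
    by (intro sum_mono mult_left_mono fw) (auto simp: mangoldt_nonneg)
  also have "\<dots> = (\<Sum>j\<in>J ` A. \<Sum>n\<in>{n\<in>A. J n = j}. mangoldt n / real n * w (J n))"
    by (rule sum.image_gen[OF A(1)])
  also have "\<dots> \<le> (\<Sum>j\<in>J ` A. 18 * w j)"
  proof (intro sum_mono)
    fix j
    define A1 where "A1 = {n\<in>A. J n = j \<and> ln (real n) \<ge> y}"
    define A2 where "A2 = {n\<in>A. J n = j \<and> ln (real n) < y}"
    have b1: "n \<ge> 1 \<and> y + real j \<le> ln (real n) \<and> ln (real n) \<le> y + real j + 1" if "n \<in> A1" for n
      using that A(2)[of n] Jb[of n] by (auto simp: A1_def)
    have b2: "n \<ge> 1 \<and> y - real j - 1 \<le> ln (real n) \<and> ln (real n) \<le> y - real j - 1 + 1" if "n \<in> A2" for n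
      using that A(2)[of n] Jb[of n] by (auto simp: A2_def)
    have 1: "(\<Sum>n\<in>A1. mangoldt n / real n) \<le> (9::real)"
      by (rule sum_mangoldt_div_unit_window_le[OF _ b1]) (use A in \<open>auto simp: A1_def\<close>)
    have 2: "(\<Sum>n\<in>A2. mangoldt n / real n) \<le> (9::real)"
      by (rule sum_mangoldt_div_unit_window_le[OF _ b2]) (use A in \<open>auto simp: A2_def\<close>)
    have "{n\<in>A. J n = j} = A1 \<union> A2" by (auto simp: A1_def A2_def)
    then have "(\<Sum>n\<in>{n\<in>A. J n = j}. mangoldt n / real n * w (J n)) = (\<Sum>n\<in>A1 \<union> A2. mangoldt n / real n * w j)"
      by (intro sum.cong) auto
    also have "\<dots> = ((\<Sum>n\<in>A1. mangoldt n / real n) + (\<Sum>n\<in>A2. mangoldt n / real n)) * w j"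
      unfolding distrib_right sum_distrib_right
      by (rule sum.union_disjoint) (use A in \<open>auto simp: A1_def A2_def\<close>)
    also have "\<dots> \<le> 18 * w j" using 1 2 w0 by (intro mult_right_mono) auto
    finally show "(\<Sum>n\<in>{n\<in>A. J n = j}. mangoldt n / real n * w (J n)) \<le> 18 * w j" .
  qed
  also have "\<dots> = 144 / (l * \<epsilon>\<^sup>2) * (\<Sum>j\<in>J ` A. 1 / (real j + 1)\<^sup>2)"
    by (simp add: w_def sum_distrib_left)
  also have "\<dots> \<le> 144 / (l * \<epsilon>\<^sup>2) * 2"
    using A l by (intro mult_left_mono sum_inverse_squares_le) auto
  finally show ?thesis by simp
qed

text \<open>Only integers with logarithm between \<open>y\<close> and \<open>y + 1 / l\<close> are
  used: there are at least \<open>exp y / (2 * l)\<close> of them, each with kernel at least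
  \<open>l / 4\<close>, so \<open>l\<close> cancels and the bound does not depend on it. The
  exponent is chosen so that \<open>(1 + x) * (y + 1) = y + 2\<close>, whence the damping costs only
  a constant factor.\<close>

lemma fejer_weighted_sum_lower_bound:
  assumes l: "l \<ge> 1" and y: "y > 0" "exp y \<ge> 2 * l" and N: "real N \<ge> exp (y + 1)"
  shows "(\<Sum>n<N. real (Suc n) powr (-1 - 1 / (y + 1)) * fejer l (y - ln (real (Suc n)))) \<ge> exp (-2) / 8"
proof -
  define x where "x = 1 / (y + 1)"
  have x: "(1 + x) * (y + 1) = y + 2" using y by (simp add: x_def field_simps)
  define I where "I = {n. exp y \<le> real (Suc n) \<and> real (Suc n) \<le> exp (y + 1 / l)}"
  have le: "exp (y + 1 / l) \<le> exp (y + 1)" using l by simp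
  have IN: "I \<subseteq> {..<N}"
  proof
    fix n assume "n \<in> I"
    then have "real (Suc n) \<le> exp (y + 1 / l)" by (simp add: I_def)
    then have "real (Suc n) \<le> real N" using le N by linarith
    then show "n \<in> {..<N}" by simp
  qed
  have card: "real (card I) \<ge> exp y / (2 * l)"
  proof -
    define a where "a = nat \<lceil>exp y\<rceil>" define b where "b = nat \<lfloor>exp (y + 1 / l)\<rfloor>"
    have ab: "real a < exp y + 1" "real b > exp (y + 1 / l) - 1" "real a \<ge> exp y" "real b \<le> exp (y + 1/l)"
      unfolding a_def b_def using exp_gt_zero[of y] exp_gt_zero[of "y + 1/l"] by linarith+
    have "a \<ge> 1" using ab(3) exp_gt_zero[of y] by (cases a) (auto simp: not_le[symmetric])
    have sub: "(\<lambda>n. n - 1) ` {a..b} \<subseteq> I"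
      using ab \<open>a \<ge> 1\<close> by (auto simp: I_def)
    have "exp y / l \<le> exp y * (exp (1 / l) - 1)"
      using mult_left_mono[OF exp_ge_add_one_self[of "1 / l"], of "exp y"] by (simp add: algebra_simps)
    then have "exp y / l \<le> exp (y + 1 / l) - exp y" by (simp add: exp_add algebra_simps)
    \<comment> \<open>The interval has length at least 2, so rounding its ends to integers loses at
      most half of the count.\<close>
    moreover have "exp y / l \<ge> 2" using y(2) l by (simp add: field_simps)
    moreover have "exp y / (2 * l) = exp y / l / 2" by simp
    ultimately have "exp y / (2 * l) \<le> real b - real a + 1"
      using ab by linarith
    also have "\<dots> \<le> real (card {a..b})" by auto
    also have "card {a..b} = card ((\<lambda>n. n - 1) ` {a..b})"
      using \<open>a \<ge> 1\<close> by (subst card_image) (auto simp: inj_on_def)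
    also have "real \<dots> \<le> real (card I)" using sub finite_subset[OF IN] by (auto intro!: card_mono)
    finally show ?thesis .
  qed
  have "exp (-2) / 8 = exp y / (2 * l) * (exp (- (y + 2)) * (l / 4))"
    using l by (simp flip: exp_add)
  also have "\<dots> \<le> real (card I) * (exp (- (y + 2)) * (l / 4))"
    using card l by (intro mult_right_mono) auto
  also have "\<dots> = (\<Sum>n\<in>I. exp (- (y + 2)) * (l / 4))" by simp
  also have "\<dots> \<le> (\<Sum>n\<in>I. real (Suc n) powr (-1 - x) * fejer l (y - ln (real (Suc n))))"
  proof (intro sum_mono mult_mono)
    fix n assume "n \<in> I"
    then have n: "exp y \<le> real (Suc n)" "real (Suc n) \<le> exp (y + 1 / l)" by (auto simp: I_def)
    have lnn: "y \<le> ln (real (Suc n))" "ln (real (Suc n)) \<le> y + 1 / l"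
      using n ln_ge_iff[of "real (Suc n)" y] ln_le_cancel_iff[of "real (Suc n)" "exp (y + 1/l)"] by simp_all
    then show "l / 4 \<le> fejer l (y - ln (real (Suc n)))"
      using l by (intro fejer_ge) auto
    have "ln (real (Suc n)) \<le> y + 1" using lnn(2) l by (smt (verit) divide_le_eq_1)
    then have "(1 + x) * ln (real (Suc n)) \<le> (1 + x) * (y + 1)"
      using y by (intro mult_left_mono) (auto simp: x_def)
    then have "- (y + 2) \<le> (-1 - x) * ln (real (Suc n))" unfolding x by (simp add: algebra_simps)
    then show "exp (- (y + 2)) \<le> real (Suc n) powr (-1 - x)" by (simp add: powr_def)
  qed (use l in auto)
  also have "\<dots> \<le> (\<Sum>n<N. real (Suc n) powr (-1 - x) * fejer l (y - ln (real (Suc n))))"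
    using IN l by (intro sum_mono2) (auto intro!: fejer_nonneg mult_nonneg_nonneg)
  finally show ?thesis by (simp add: x_def)
qed

text \<open>The integers contribute at least \<open>c0\<close>, whatever \<open>l\<close> is. Taking
  \<open>l\<close> large pushes the Mangoldt weight outside the window below \<open>c0 / 4\<close>,
  and for large \<open>y\<close> the difference between the two sums is at most
  \<open>c0 / 2\<close>. The remaining \<open>c0 / 4\<close> must come from the window, where the
  kernel is at most \<open>l / 2\<close>.\<close>

lemma mangoldt_log_window_lower_bound:
  assumes e: "0 < \<epsilon>" "\<epsilon> \<le> 1"
  shows "\<exists>c>0. \<forall>\<^sub>F y in at_top. c \<le> (\<Sum>n | n \<ge> 1 \<and> \<bar>ln (real n) - y\<bar> < \<epsilon>. mangoldt n / real n)"
proof -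
  define c0 where "c0 = exp (-2) / (8::real)"
  have c0: "c0 > 0" by (simp add: c0_def)
  define l where "l = max 1 (288 * 4 / (\<epsilon>\<^sup>2 * c0))"
  have l: "l \<ge> 1" "l > 0" "l \<ge> 288 * 4 / (\<epsilon>\<^sup>2 * c0)" by (auto simp: l_def)
  have tail: "288 / (l * \<epsilon>\<^sup>2) \<le> c0 / 4"
    using l(2,3) e c0 by (simp add: field_simps)
  obtain B where B: "B > 0" and Bb: "\<And>x y \<eta>. 0 < x \<Longrightarrow> x \<le> 1 \<Longrightarrow> y > 0 \<Longrightarrow> \<eta> > 0 \<Longrightarrow> 
    \<forall>\<^sub>F N in sequentially. \<bar>\<Sum>n<N. (mangoldt (Suc n) - 1) * real (Suc n) powr (-1 - x) * fejer l (y - ln (real (Suc n)))\<bar> \<le> B / y + \<eta>"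
    using fejer_weighted_mangoldt_sum_bound[OF l(2)] by blast
  have "\<forall>\<^sub>F y in at_top. c0 / (2 * l) \<le> (\<Sum>n | n \<ge> 1 \<and> \<bar>ln (real n) - y\<bar> < \<epsilon>. mangoldt n / real n)"
    using eventually_ge_at_top[of "4 * B / c0"] eventually_ge_at_top[of "ln (2 * l)"] eventually_gt_at_top[of 0]
  proof eventually_elim
    case (elim y)
    define x where "x = 1 / (y + 1)"
    have x: "0 < x" "x \<le> 1" using elim by (auto simp: x_def field_simps)
    have By: "B / y \<le> c0 / 4" using elim c0 by (simp add: field_simps)
    have ey: "exp y \<ge> 2 * l" using elim(2) l by (metis exp_le_cancel_iff exp_ln mult_pos_pos zero_less_numeral)
    define W where "W = {n. n \<ge> 1 \<and> \<bar>ln (real n) - y\<bar> < \<epsilon>}"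
    have "\<forall>\<^sub>F N in sequentially. real N \<ge> exp (y + 1)"
      using filterlim_real_sequentially unfolding filterlim_at_top by blast
    from eventually_happens[OF eventually_conj[OF this Bb[OF x elim(3), of "c0 / 4"]]] c0
    obtain N where N: "real N \<ge> exp (y + 1)" 
      and NB: "\<bar>\<Sum>n<N. (mangoldt (Suc n) - 1) * real (Suc n) powr (-1 - x) * fejer l (y - ln (real (Suc n)))\<bar> \<le> B / y + c0 / 4"
      by auto
    have W_sub: "W \<subseteq> {1..N}"
    proof
      fix n assume "n \<in> W"
      then have n: "n \<ge> 1" "ln (real n) < y + 1" using e by (auto simp: W_def)
      then have "real n < exp (y + 1)" using ln_less_cancel_iff[of "real n" "exp (y+1)"] by simp
      then show "n \<in> {1..N}" using n N by simp
    qed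
    define g where "g = (\<lambda>n. mangoldt n * real n powr (-1 - x) * fejer l (y - ln (real n)))"
    have g_le: "g n \<le> mangoldt n / real n * fejer l (y - ln (real n))" if "n \<ge> 1" for n
    proof -
      have "real n powr (-1 - x) \<le> real n powr (-1)" using that x by (intro powr_mono) auto
      also have "\<dots> = 1 / real n" using that by (simp add: powr_minus_divide)
      finally have "mangoldt n * real n powr (-1 - x) \<le> mangoldt n * (1 / real n)" by (intro mult_left_mono mangoldt_nonneg)
      then show ?thesis unfolding g_def using fejer_nonneg[OF l(2)] by (intro mult_right_mono) auto
    qed
    have "c0 \<le> (\<Sum>n<N. real (Suc n) powr (-1 - x) * fejer l (y - ln (real (Suc n))))"
      unfolding c0_def x_def by (rule fejer_weighted_sum_lower_bound[OF l(1) elim(3) ey N])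
    also have "\<dots> = (\<Sum>n<N. g (Suc n)) - (\<Sum>n<N. (mangoldt (Suc n) - 1) * real (Suc n) powr (-1 - x) * fejer l (y - ln (real (Suc n))))"
      unfolding g_def sum_subtractf[symmetric] by (intro sum.cong refl) (simp add: left_diff_distrib del: of_nat_Suc)
    also have "\<dots> \<le> (\<Sum>n<N. g (Suc n)) + c0 / 2" using NB By by linarith
    also have "(\<Sum>n<N. g (Suc n)) = (\<Sum>n=1..N. g n)"
      by (simp add: sum.atLeast1_atMost_eq atLeast0LessThan)
    also have "\<dots> = (\<Sum>n\<in>W. g n) + (\<Sum>n\<in>{1..N} - W. g n)"
      using W_sub by (metis add.commute finite_atLeastAtMost sum.subset_diff)
    also have "(\<Sum>n\<in>{1..N} - W. g n) \<le> (\<Sum>n\<in>{1..N} - W. mangoldt n / real n * fejer l (y - ln (real n)))"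
      by (intro sum_mono g_le) auto
    also have "\<dots> \<le> 288 / (l * \<epsilon>\<^sup>2)"
      by (rule fejer_weighted_mangoldt_tail_le[OF _ _ e l(2)]) (auto simp: W_def)
    also have "\<dots> \<le> c0 / 4" by (rule tail)
    also have "(\<Sum>n\<in>W. g n) \<le> (\<Sum>n\<in>W. mangoldt n / real n * (l / 2))"
    proof (intro sum_mono)
      fix n assume "n \<in> W"
      then have "g n \<le> mangoldt n / real n * fejer l (y - ln (real n))" by (intro g_le) (auto simp: W_def)
      also have "\<dots> \<le> mangoldt n / real n * (l / 2)"
        by (intro mult_left_mono fejer_le l) (auto simp: mangoldt_nonneg)
      finally show "g n \<le> mangoldt n / real n * (l / 2)" .
    qed
    also have "\<dots> = (\<Sum>n\<in>W. mangoldt n / real n) * (l / 2)" by (simp add: sum_distrib_right)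
    finally have "c0 / 4 \<le> (\<Sum>n\<in>W. mangoldt n / real n) * (l / 2)" by simp
    then show ?case using l(2) unfolding W_def by (simp add: field_simps)
  qed
  then show ?thesis using c0 l by (intro exI[of _ "c0 / (2 * l)"]) auto
qed

section \<open>From prime powers to primes\<close>

lemma card_nonprime_primepows_le:
  assumes "X \<ge> 1"
  shows "real (card {n. primepow n \<and> \<not> prime n \<and> real n \<le> X}) \<le> sqrt X * (ln X / ln 2)"
proof -
  define R where "R = nat \<lfloor>sqrt X\<rfloor>" define J where "J = nat \<lfloor>ln X / ln 2\<rfloor>"
  have "{n. primepow n \<and> \<not> prime n \<and> real n \<le> X} \<subseteq> (\<lambda>(p, j). p ^ j) ` ({1..R} \<times> {1..J})"
  proof
    fix n assume "n \<in> {n. primepow n \<and> \<not> prime n \<and> real n \<le> X}"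
    then have n: "primepow n" "\<not> prime n" "real n \<le> X" by auto
    then obtain p j where pj: "prime p" "j > 0" "n = p ^ j" by (auto simp: primepow_def)
    have j2: "j \<ge> 2" using pj n(2) by (cases "j = 1") auto
    have p2: "p \<ge> 2" using pj(1) prime_ge_2_nat by auto
    have "p ^ 2 \<le> p ^ j" using j2 p2 by (intro power_increasing) auto
    then have "(real p)\<^sup>2 \<le> X" using n(3) pj(3) by (metis of_nat_le_iff of_nat_power order_trans)
    then have "real p \<le> sqrt X" by (rule real_le_rsqrt)
    then have "p \<in> {1..R}" using p2 by (auto simp: R_def le_nat_floor)
    moreover have "2 ^ j \<le> p ^ j" using p2 by (intro power_mono) auto
    then have "(2::real) ^ j \<le> X" using n(3) pj(3) by (metis of_nat_le_iff of_nat_numeral of_nat_power order_trans)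
    then have "ln ((2::real) ^ j) \<le> ln X" using assms by (subst ln_le_cancel_iff) auto
    then have "real j * ln 2 \<le> ln X" by (simp add: ln_realpow)
    then have "real j \<le> ln X / ln 2" by (simp add: field_simps)
    then have "j \<in> {1..J}" using j2 by (auto simp: J_def le_nat_floor)
    ultimately show "n \<in> (\<lambda>(p, j). p ^ j) ` ({1..R} \<times> {1..J})" using pj(3) by auto
  qed
  then have "card {n. primepow n \<and> \<not> prime n \<and> real n \<le> X} \<le> card ({1..R} \<times> {1..J})"
    by (meson card_image_le card_mono finite_SigmaI finite_atLeastAtMost finite_imageI order_trans)
  also have "\<dots> = R * J" by simp
  finally have "real (card {n. primepow n \<and> \<not> prime n \<and> real n \<le> X}) \<le> real R * real J"
    by (metis of_nat_le_iff of_nat_mult)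
  also have "\<dots> \<le> sqrt X * (ln X / ln 2)"
    unfolding R_def J_def using assms by (intro mult_mono) auto
  finally show ?thesis .
qed

text \<open>Without a prime the window would carry only proper prime powers. With
  \<open>X = exp (y + 1)\<close> there are at most about \<open>sqrt X * ln X\<close> of these, each
  of weight at most about \<open>ln X / X\<close>, so their total tends to 0 and falls below the
  constant \<open>c\<close>.\<close>

lemma eventually_prime_in_log_window:
  assumes e: "0 < \<epsilon>" "\<epsilon> \<le> 1"
  shows "\<forall>\<^sub>F y in at_top. \<exists>p. prime p \<and> \<bar>ln (real p) - y\<bar> < \<epsilon>"
proof -
  obtain c where c: "c > 0" "\<forall>\<^sub>F y in at_top. c \<le> (\<Sum>n | n \<ge> 1 \<and> \<bar>ln (real n) - y\<bar> < \<epsilon>. mangoldt n / real n)"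
    using mangoldt_log_window_lower_bound[OF e] by blast
  have "((\<lambda>y::real. sqrt (exp (y + 1)) * (ln (exp (y + 1)) / ln 2) * ((y + 1) / exp (y - 1))) \<longlongrightarrow> 0) at_top"
    by real_asymp
  then have "\<forall>\<^sub>F y in at_top. sqrt (exp (y + 1)) * (ln (exp (y + 1)) / ln 2) * ((y + 1) / exp (y - 1)) < (c::real)"
    using c(1) by (rule order_tendstoD)
  with c(2) eventually_gt_at_top[of 0] show ?thesis
  proof eventually_elim
    case (elim y)
    define W where "W = {n. n \<ge> 1 \<and> \<bar>ln (real n) - y\<bar> < \<epsilon>}"
    define Q where "Q = {n. primepow n \<and> \<not> prime n \<and> real n \<le> exp (y + 1)}"
    have Wb: "real n \<le> exp (y + 1)" "real n \<ge> exp (y - 1)" "ln (real n) \<le> y + 1" if "n \<in> W" for n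
    proof -
      have n: "n \<ge> 1" "ln (real n) < y + 1" "ln (real n) > y - 1" using that e by (auto simp: W_def)
      then show "real n \<le> exp (y + 1)" "real n \<ge> exp (y - 1)" "ln (real n) \<le> y + 1"
        using ln_less_cancel_iff[of "real n" "exp (y+1)"] ln_less_cancel_iff[of "exp (y-1)" "real n"] by simp_all
    qed
    have finN: "finite {n. real n \<le> exp (y + 1)}"
      by (rule finite_subset[of _ "{..nat \<lfloor>exp (y + 1)\<rfloor>}"]) (auto simp: le_nat_floor)
    have finW: "finite W" by (rule finite_subset[OF _ finN]) (use Wb in auto)
    have finQ: "finite Q" by (rule finite_subset[OF _ finN]) (auto simp: Q_def)
    show ?case
    proof (rule ccontr)
      assume np: "\<not> ?thesis"
      have "c \<le> (\<Sum>n\<in>W. mangoldt n / real n)" using elim(1) by (simp add: W_def)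
      also have "\<dots> = (\<Sum>n\<in>W \<inter> Q. mangoldt n / real n)"
      proof (intro sum.mono_neutral_right ballI)
        fix n assume n: "n \<in> W - W \<inter> Q"
        then have "\<not> primepow n" using Wb(1)[of n] np by (auto simp: W_def Q_def)
        then show "mangoldt n / real n = 0" by (simp add: mangoldt_def)
      qed (use finW in auto)
      also have "\<dots> \<le> (\<Sum>n\<in>W \<inter> Q. (y + 1) / exp (y - 1))"
      proof (intro sum_mono frac_le)
        fix n assume "n \<in> W \<inter> Q"
        then have "n \<in> W" "n > 0" by (auto simp: W_def)
        then show "mangoldt n \<le> y + 1" "exp (y - 1) \<le> real n"
          using Wb[of n] mangoldt_le[of n] by linarith+
      qed (use elim in auto)
      also have "\<dots> = real (card (W \<inter> Q)) * ((y + 1) / exp (y - 1))" by simp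
      also have "\<dots> \<le> real (card Q) * ((y + 1) / exp (y - 1))"
        using finQ elim by (intro mult_right_mono) (auto intro!: card_mono)
      also have "\<dots> \<le> sqrt (exp (y + 1)) * (ln (exp (y + 1)) / ln 2) * ((y + 1) / exp (y - 1))"
        unfolding Q_def using elim by (intro mult_right_mono card_nonprime_primepows_le) auto
      finally show False using elim by simp
    qed
  qed
qed

lemma eventually_prime_in_short_interval:
  assumes "0 < \<delta>"
  shows "\<forall>\<^sub>F x in at_top. \<exists>p. prime p \<and> (1 - \<delta>) * x < real p \<and> real p < x"
proof -
  define \<epsilon> where "\<epsilon> = min 1 (\<delta> / 2)"
  have e: "0 < \<epsilon>" "\<epsilon> \<le> 1" "2 * \<epsilon> \<le> \<delta>" using assms by (auto simp: \<epsilon>_def)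
  \<comment> \<open>The window is centred \<open>\<epsilon>\<close> below \<open>ln x\<close>, so
    that it ends exactly at \<open>x\<close> and the prime is strictly smaller.\<close>
  have "filterlim (\<lambda>x::real. ln x - \<epsilon>) at_top at_top" by real_asymp
  from eventually_compose_filterlim[OF eventually_prime_in_log_window[OF e(1,2)] this] eventually_gt_at_top[of 0]
  show ?thesis
  proof eventually_elim
    case (elim x)
    then obtain p where p: "prime p" "\<bar>ln (real p) - (ln x - \<epsilon>)\<bar> < \<epsilon>" by blast
    have p0: "real p > 0" using prime_gt_0_nat[OF p(1)] by simp
    have "ln (real p) < ln x" using p(2) by linarith
    then have 1: "real p < x" using p0 elim by simp
    have "ln (x * exp (-2 * \<epsilon>)) < ln (real p)" using p(2) elim by (simp add: ln_mult)
    then have 2: "x * exp (-2 * \<epsilon>) < real p" using p0 elim by (subst (asm) ln_less_cancel_iff) auto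
    have "1 - \<delta> \<le> exp (-2 * \<epsilon>)" using exp_ge_add_one_self[of "-2 * \<epsilon>"] e by linarith
    then have "(1 - \<delta>) * x \<le> x * exp (-2 * \<epsilon>)" using elim by (simp add: mult.commute)
    then show ?case using 1 2 p(1) le_less_trans by blast
  qed
qed

section \<open>The expected loss\<close>

text \<open>Divided by \<open>2 p\<close>, the expected excess over \<open>k\<close> on all diagonals: \<open>h\<close> of the \<open>t\<close> hyperbolas hit a
  given diagonal, and after averaging over the diagonals the number \<open>j\<close> of them that contribute
  the larger number of points is uniform on \<open>{0..h}\<close>.\<close>

definition expected_loss :: "nat \<Rightarrow> nat \<Rightarrow> real" where
  "expected_loss t k = (\<Sum>h\<le>t. real (t choose h) / 2 ^ t / (real h + 1) * (\<Sum>j\<le>h. real (3 * h + j - k) + real (2 * h + j - k)))"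

text \<open>A difference of two triangular numbers. Thanks to truncated subtraction both vanish
  below the threshold, so no case distinction on \<open>k\<close> enters the formula.\<close>

lemma sum_truncated_shift:
  "(\<Sum>j\<le>h. real (a + j - k)) = real (a + h - k) * (real (a + h - k) + 1) / 2 - real (a - k) * (real (a - k) - 1) / 2"
proof (induction h)
  case 0
  then show ?case by (simp add: field_simps)
next
  case (Suc h)
  show ?case
  proof (cases "a + h \<ge> k")
    case True
    then have "real (a + Suc h - k) = real (a + h - k) + 1" by (simp add: of_nat_diff)
    then show ?thesis using Suc.IH by (simp add: field_simps)
  next
    case False
    then show ?thesis using Suc.IH by simp
  qed
qed

text \<open>The ranges \<open>3 * h .. 4 * h\<close> and \<open>2 * h .. 3 * h\<close> meet in
  \<open>3 * h\<close>: together they give one triangular number, plus the doubly counted term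
  \<open>3 * h - k\<close>.\<close>

lemma expected_loss_inner_sum:
  assumes "2 * h \<le> k"
  shows "(\<Sum>j\<le>h. real (3 * h + j - k) + real (2 * h + j - k)) = real (4 * h - k) * (real (4 * h - k) + 1) / 2 + real (3 * h - k)"
  using assms unfolding sum.distrib sum_truncated_shift by (simp add: field_simps)

text \<open>The part of the expected loss without closed form, with \<open>n = t + 1\<close> and \<open>e = k - 2 t\<close>. Only
  \<open>i > 2 n / 3\<close> contribute.\<close>

definition loss_excess :: "nat \<Rightarrow> nat \<Rightarrow> nat" where
  "loss_excess n e = (\<Sum>i\<le>n. (n choose i) * (3 * i - (2 * n + 1 + e)))"

section \<open>Closed form of the expected loss\<close>

lemma sum_binomial_square_deviation:
  "(\<Sum>i\<le>n. real (n choose i) * (2 * real i - real n)\<^sup>2) = real n * 2 ^ n"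
proof -
  have "(\<Sum>i\<le>n. real (n choose i) * (2 * real i - real n)\<^sup>2) / 2 ^ n =
     4 * (\<Sum>i\<le>n. real i * (real i - 1) * Bernstein n i (1/2)) + (4 - 4 * real n) * (\<Sum>i\<le>n. real i * Bernstein n i (1/2)) + (real n)\<^sup>2 * (\<Sum>i\<le>n. Bernstein n i (1/2))"
    unfolding sum_divide_distrib sum_distrib_left sum.distrib[symmetric]
  proof (intro sum.cong refl)
    fix i assume "i \<in> {..n}"
    then have "Bernstein n i (1/2) = real (n choose i) / 2 ^ n"
      by (simp add: Bernstein_def power_one_over flip: power_add)
    then show "real (n choose i) * (2 * real i - real n)\<^sup>2 / 2 ^ n = 4 * (real i * (real i - 1) * Bernstein n i (1 / 2)) +
         (4 - 4 * real n) * (real i * Bernstein n i (1 / 2)) + (real n)\<^sup>2 * Bernstein n i (1 / 2)"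
      by (simp add: power2_eq_square algebra_simps flip: add_divide_distrib diff_divide_distrib)
  qed
  also have "\<dots> = real n"
    unfolding sum_Bernstein sum_k_Bernstein sum_kk_Bernstein by (simp add: power2_eq_square algebra_simps)
  finally show ?thesis by (simp add: field_simps)
qed

text \<open>De Moivre's mean absolute deviation, restricted to the upper half: the term equals
  \<open>n\<close> times the difference of \<open>(n - 1) choose (i - 1)\<close> and
  \<open>(n - 1) choose i\<close>, so the sum telescopes.\<close>

lemma sum_binomial_linear_deviation_tail:
  assumes "n \<ge> 1"
  shows "(\<Sum>i\<in>{n div 2 + 1..n}. real (n choose i) * (2 * real i - real n)) = real n * real ((n - 1) choose (n div 2))"
proof -
  define g where "g = (\<lambda>i. real n * real ((n - 1) choose (i - 1)))"
  have "real (n choose i) * (2 * real i - real n) = g i - g (Suc i)" if i: "i \<in> {n div 2 + 1..n}" for i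
  proof -
    obtain i' n' where i': "i = Suc i'" "n = Suc n'" using i assms by (cases i; cases n) auto
    have 1: "real (Suc i') * real (Suc n' choose Suc i') = real (Suc n') * real (n' choose i')"
      using Suc_times_binomial_eq[of n' i'] by (metis mult.commute of_nat_mult)
    have 2: "real (Suc n' choose Suc i') = real (n' choose i') + real (n' choose Suc i')" by simp
    have "real (n choose i) * (2 * real i - real n) = 2 * (real (Suc i') * real (Suc n' choose Suc i')) - real (Suc n') * real (Suc n' choose Suc i')"
      unfolding i' by (simp only: algebra_simps)
    also have "\<dots> = real (Suc n') * real (n' choose i') - real (Suc n') * real (n' choose Suc i')"
      unfolding 1 unfolding 2 by (simp only: algebra_simps)
    finally show ?thesis by (simp add: g_def i')
  qed
  then have "(\<Sum>i\<in>{n div 2 + 1..n}. real (n choose i) * (2 * real i - real n)) = (\<Sum>i\<in>{n div 2 + 1..n}. g i - g (Suc i))"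
    by (intro sum.cong) auto
  also have "\<dots> = g (n div 2 + 1) - g (Suc n)"
    using assms sum_Suc_diff[of "n div 2 + 1" n "\<lambda>i. - g i"] by simp
  finally show ?thesis using assms by (simp add: g_def)
qed

lemma sum_symmetric_half:
  fixes f :: "nat \<Rightarrow> real"
  assumes "\<And>i. i \<le> n \<Longrightarrow> f (n - i) = f i"
  shows "(\<Sum>i\<le>n. f i) = 2 * (\<Sum>i\<in>{n div 2 + 1..n}. f i) + (if even n then f (n div 2) else 0)"
proof -
  have "(\<Sum>i\<in>{i. 2 * i < n}. f i) = (\<Sum>i\<in>{n div 2 + 1..n}. f i)"
    by (rule sum.reindex_bij_witness[of _ "\<lambda>i. n - i" "\<lambda>i. n - i"]) (auto simp: assms)
  moreover have "{..n} = {i. 2 * i < n} \<union> {n div 2 + 1..n} \<union> (if even n then {n div 2} else {})" by (auto elim!: evenE oddE)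
  moreover have "finite {i. 2 * i < n}" by (rule finite_subset[of _ "{..n}"]) auto
  moreover have "(\<Sum>i\<in>{i. 2 * i < n} \<union> {n div 2 + 1..n}. f i) = (\<Sum>i\<in>{i. 2 * i < n}. f i) + (\<Sum>i\<in>{n div 2 + 1..n}. f i)"
    using calculation(3) by (intro sum.union_disjoint) auto
  moreover have "(\<Sum>i\<in>{i. 2 * i < n} \<union> {n div 2 + 1..n} \<union> {n div 2}. f i) = (\<Sum>i\<in>{i. 2 * i < n} \<union> {n div 2 + 1..n}. f i) + f (n div 2)" if "even n"
    using calculation(3) that by (subst sum.union_disjoint) auto
  ultimately show ?thesis by (cases "even n") simp_all
qed

text \<open>Multiplication by \<open>n = t + 1\<close> absorbs the denominator \<open>h + 1\<close>
  into \<open>n choose (h + 1)\<close>. With \<open>i = h + 1\<close> the triangular number is, for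
  \<open>2 * i > n\<close>, a quadratic polynomial in the deviation \<open>2 * i - n\<close>: its
  even part is summed by symmetry and its linear part by telescoping, while the extra terms
  \<open>3 * h - k\<close> form \<open>loss_excess\<close>.\<close>

lemma expected_loss_closed_form:
  assumes n: "n \<ge> 1" and o: "e \<le> 1"
  shows "expected_loss (n - 1) (2 * (n - 1) + e) * (real n * 2 ^ (n - 1)) =
     (2 * real n + 1 + 2 * real e) * 2 ^ (n - 1) - (1 + 2 * real e) * (if even n then real (n choose (n div 2)) else 0) / 2
       - (3 + 2 * real e) * real n * real ((n - 1) choose (n div 2)) + real (loss_excess n e)"
proof -
  define k where "k = 2 * (n - 1) + e"
  define T where "T = (\<lambda>m. real m * (real m + 1) / 2)"
  obtain t where t: "n = Suc t" using n by (cases n) auto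
  have "expected_loss t k * (real n * 2 ^ t) = (\<Sum>h\<le>t. real (n choose Suc h) * (T (4 * h - k) + real (3 * h - k)))"
    unfolding expected_loss_def sum_distrib_right
  proof (intro sum.cong refl)
    fix h assume h: "h \<in> {..t}"
    have "real (t choose h) * real n = real (n choose Suc h) * (real h + 1)"
      using Suc_times_binomial_eq[of t h] unfolding t by (metis add.commute mult.commute of_nat_Suc of_nat_mult)
    moreover have "real (t choose h) / 2 ^ t / (real h + 1) * (real n * 2 ^ t) = real (t choose h) * real n / (real h + 1)"
      by simp
    ultimately have "real (t choose h) / 2 ^ t / (real h + 1) * (real n * 2 ^ t) = real (n choose Suc h)"
      by simp
    moreover have "(\<Sum>j\<le>h. real (3 * h + j - k) + real (2 * h + j - k)) = T (4 * h - k) + real (3 * h - k)"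
      unfolding T_def by (rule expected_loss_inner_sum) (use h in \<open>simp add: k_def t\<close>)
    moreover have "x * s * y = (x * y) * s" for x y s :: real by simp
    ultimately show "real (t choose h) / 2 ^ t / (real h + 1) * (\<Sum>j\<le>h. real (3 * h + j - k) + real (2 * h + j - k)) * (real n * 2 ^ t) =
      real (n choose Suc h) * (T (4 * h - k) + real (3 * h - k))"
      by (simp only:)
  qed
  also have "\<dots> = (\<Sum>i\<le>n. real (n choose i) * (T (4 * (i - 1) - k) + real (3 * (i - 1) - k)))"
    unfolding t by (subst sum.atMost_Suc_shift) (simp add: T_def)
  also have "\<dots> = (\<Sum>i\<le>n. real (n choose i) * T (4 * (i - 1) - k)) + (\<Sum>i\<le>n. real (n choose i) * real (3 * (i - 1) - k))"
    by (simp only: distrib_left sum.distrib)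
  also have "(\<Sum>i\<le>n. real (n choose i) * real (3 * (i - 1) - k)) = real (loss_excess n e)"
    unfolding loss_excess_def of_nat_sum of_nat_mult
  proof (intro sum.cong refl)
    fix i have "3 * (i - 1) - k = 3 * i - (2 * n + 1 + e)" using n by (cases i) (auto simp: k_def t)
    then show "real (n choose i) * real (3 * (i - 1) - k) = real (n choose i) * real (3 * i - (2 * n + 1 + e))" by simp
  qed
  also have "(\<Sum>i\<le>n. real (n choose i) * T (4 * (i - 1) - k)) = (\<Sum>i\<in>{n div 2 + 1..n}. real (n choose i) * T (4 * (i - 1) - k))"
    by (rule sum.mono_neutral_right) (auto simp: T_def k_def)
  also have "\<dots> = (\<Sum>i\<in>{n div 2 + 1..n}. real (n choose i) * (2 * (2 * real i - real n)\<^sup>2 + (1 + 2 * real e)) - (3 + 2 * real e) * (real (n choose i) * (2 * real i - real n)))"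
  proof (intro sum.cong refl)
    fix i assume i: "i \<in> {n div 2 + 1..n}"
    define s where "s = 2 * real i - real n"
    have i1: "2 * i \<ge> n + 1" using i by auto
    \<comment> \<open>For \<open>s >= 2\<close> the truncated difference is
      \<open>2 * s - 2 - e\<close>, and \<open>e * e = e\<close> makes the constant term linear in
      \<open>e\<close>. At \<open>s = 1\<close> the difference is truncated to 0, and the polynomial
      vanishes there as well.\<close>
    have T: "T (4 * (i - 1) - k) = 2 * s\<^sup>2 - (3 + 2 * real e) * s + (1 + 2 * real e)"
    proof (cases "2 * i = n + 1")
      case True
      then have "4 * (i - 1) - k = 0" "s = 1" unfolding k_def s_def by (auto simp flip: of_nat_mult)
      then show ?thesis by (simp add: T_def)
    next
      case False
      then have Rm: "real (4 * (i - 1) - k) = 2 * s - 2 - real e"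
        using i1 o n unfolding k_def s_def by (subst of_nat_diff) (auto simp: of_nat_diff)
      have "real e = 0 \<or> real e = 1" using o by auto
      then show ?thesis unfolding T_def Rm by (elim disjE) (simp_all add: power2_eq_square field_simps)
    qed
    show "real (n choose i) * T (4 * (i - 1) - k) = real (n choose i) * (2 * (2 * real i - real n)\<^sup>2 + (1 + 2 * real e)) - (3 + 2 * real e) * (real (n choose i) * (2 * real i - real n))"
      unfolding T s_def[symmetric] by (simp add: algebra_simps)
  qed
  also have "\<dots> = (\<Sum>i\<in>{n div 2 + 1..n}. real (n choose i) * (2 * (2 * real i - real n)\<^sup>2 + (1 + 2 * real e))) - (3 + 2 * real e) * (real n * real ((n - 1) choose (n div 2)))"
    unfolding sum_subtractf sum_distrib_left[symmetric] sum_binomial_linear_deviation_tail[OF n] ..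
  also have "(\<Sum>i\<in>{n div 2 + 1..n}. real (n choose i) * (2 * (2 * real i - real n)\<^sup>2 + (1 + 2 * real e))) =
     (2 * real n + 1 + 2 * real e) * 2 ^ (n - 1) - (1 + 2 * real e) * (if even n then real (n choose (n div 2)) else 0) / 2"
  proof -
    define f where "f = (\<lambda>i. real (n choose i) * (2 * (2 * real i - real n)\<^sup>2 + (1 + 2 * real e)))"
    have h1: "(\<Sum>i\<le>n. f i) = 2 * (\<Sum>i\<in>{n div 2 + 1..n}. f i) + (if even n then f (n div 2) else 0)"
    proof (rule sum_symmetric_half)
      fix i assume "i \<le> n"
      then have "n choose (n - i) = n choose i" "(2 * real (n - i) - real n)\<^sup>2 = (2 * real i - real n)\<^sup>2"
        by (auto simp: binomial_symmetric[symmetric] of_nat_diff power2_eq_square algebra_simps)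
      then show "f (n - i) = f i" by (simp add: f_def)
    qed
    have h2: "(\<Sum>i\<le>n. f i) = 2 * (real n * 2 ^ n) + (1 + 2 * real e) * 2 ^ n"
    proof -
      have "(\<Sum>i\<le>n. f i) = 2 * (\<Sum>i\<le>n. real (n choose i) * (2 * real i - real n)\<^sup>2) + (1 + 2 * real e) * real (\<Sum>i\<le>n. n choose i)"
        unfolding f_def sum_distrib_left of_nat_sum sum.distrib[symmetric] by (intro sum.cong refl) (simp add: algebra_simps)
      then show ?thesis unfolding sum_binomial_square_deviation choose_row_sum by simp
    qed
    define cen where "cen = (if even n then real (n choose (n div 2)) else 0)"
    define P where "P = (2::real) ^ (n - 1)"
    have h3: "(if even n then f (n div 2) else 0) = (1 + 2 * real e) * cen"
      by (auto simp: f_def cen_def elim!: evenE)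
    have h4: "(2::real) ^ n = 2 * P" using n by (simp add: t P_def)
    have "2 * (\<Sum>i\<in>{n div 2 + 1..n}. f i) + (1 + 2 * real e) * cen = 2 * (real n * (2 * P)) + (1 + 2 * real e) * (2 * P)"
      using h1 h2 unfolding h3 h4 by linarith
    then have "(\<Sum>i\<in>{n div 2 + 1..n}. f i) = (2 * real n + 1 + 2 * real e) * P - (1 + 2 * real e) * cen / 2"
      by (simp add: field_simps)
    then show ?thesis unfolding f_def cen_def P_def .
  qed
  finally show ?thesis by (simp add: k_def t algebra_simps)
qed

text \<open>Chernoff's bound; \<open>63 / 50\<close> approximates the optimal base, the cube root of 2.\<close>

lemma loss_excess_le:
  "real (loss_excess n e) \<le> (159 / 100) * (50 / 63) * ((1 + (63 / 50) ^ 3) * (50 / 63)\<^sup>2) ^ n"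
proof -
  \<comment> \<open>The ratio \<open>s / (63 / 50) ^ s\<close> is largest at \<open>s = 4\<close>,
    where it is about 1.587; from there on \<open>(s + 1) / s <= 5 / 4 < 63 / 50\<close>.\<close>
  have lin: "real s \<le> (159 / 100) * (63 / 50) ^ s" for s :: nat
  proof -
    have big: "real (4 + r) \<le> (159 / 100) * (63 / 50) ^ (4 + r)" for r
    proof (induction r)
      case (Suc r)
      have "real (4 + Suc r) \<le> (63 / 50) * real (4 + r)" by simp
      also have "\<dots> \<le> (63 / 50) * ((159 / 100) * (63 / 50) ^ (4 + r))" using Suc by (intro mult_left_mono) auto
      finally show ?case by (simp only: add_Suc_right power_Suc mult.left_commute)
    qed (simp add: power_numeral_reduce)
    consider "s = 0" | "s = 1" | "s = 2" | "s = 3" | "s = 4 + (s - 4)" by linarith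
    then show ?thesis
    proof cases
      case 5 then show ?thesis using big[of "s - 4"] by metis
    qed (simp_all add: power_numeral_reduce)
  qed
  have "real (loss_excess n e) \<le> (\<Sum>i\<le>n. real (n choose i) * ((159 / 100) * ((63 / 50) ^ (3 * i) * (50 / 63) ^ (2 * n + 1))))"
    unfolding loss_excess_def of_nat_sum of_nat_mult
  proof (intro sum_mono mult_left_mono)
    fix i
    define s where "s = 3 * i - (2 * n + 1 + e)"
    show "real (3 * i - (2 * n + 1 + e)) \<le> (159 / 100) * ((63 / 50) ^ (3 * i) * (50 / 63) ^ (2 * n + 1))"
    proof (cases "s = 0")
      case False
      then have "3 * i = s + e + (2 * n + 1)" by (simp add: s_def)
      then have "(63 / 50) ^ (3 * i) * (50 / 63) ^ (2 * n + 1) = (63 / 50 :: real) ^ (s + e) * ((63 / 50) ^ (2 * n + 1) * (50 / 63) ^ (2 * n + 1))"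
        by (simp only: power_add mult.assoc)
      also have "\<dots> = (63 / 50) ^ (s + e)" by (simp only: power_mult_distrib[symmetric]) simp
      also have "\<dots> \<ge> (63 / 50) ^ s" by (intro power_increasing) auto
      finally have "(63 / 50 :: real) ^ s \<le> (63 / 50) ^ (3 * i) * (50 / 63) ^ (2 * n + 1)" .
      then show ?thesis using lin[of s] unfolding s_def by linarith
    qed (simp add: s_def)
  qed auto
  also have "\<dots> = (159 / 100) * (50 / 63) ^ (2 * n + 1) * (\<Sum>i\<le>n. real (n choose i) * ((63 / 50) ^ 3) ^ i * 1 ^ (n - i))"
    unfolding sum_distrib_left by (intro sum.cong refl) (simp only: power_mult power_one, simp)
  also have "(\<Sum>i\<le>n. real (n choose i) * ((63 / 50) ^ 3) ^ i * 1 ^ (n - i)) = ((63 / 50) ^ 3 + 1) ^ n"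
    by (simp only: binomial_ring)
  also have "(159 / 100) * (50 / 63) ^ (2 * n + 1) * ((63 / 50) ^ 3 + 1) ^ n = (159 / 100) * (50 / 63) * ((1 + (63 / 50) ^ 3) * (50 / 63)\<^sup>2 :: real) ^ n"
  proof -
    have "(50 / 63 :: real) ^ (2 * n + 1) = ((50 / 63)\<^sup>2) ^ n * (50 / 63)"
      by (simp only: power_add power_mult power_one_right)
    then show ?thesis by (simp only: power_mult_distrib add.commute mult_ac)
  qed
  finally show ?thesis .
qed

text \<open>For \<open>n \<le> 57\<close> the exponential bound is too weak, and the inequality is evaluated on the rows of
  Pascal's triangle; with \<open>3.14 \<le> pi\<close> it becomes one between integers.\<close>

definition pascal_step :: "int list \<Rightarrow> int list" where
  "pascal_step r = map2 (+) (0 # r) (r @ [0])"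

primrec weighted_excess :: "int \<Rightarrow> int list \<Rightarrow> int" where
  "weighted_excess s [] = 0"
| "weighted_excess s (c # r) = (if 0 < s then c * s else 0) + weighted_excess (s + 3) r"

text \<open>With \<open>q\<close> and \<open>r\<close> the rows \<open>n - 1\<close> and
  \<open>n\<close>, \<open>g\<close> is the integer \<open>loss_gain n e\<close>. The test is
  \<open>2 * (3 + 2 * e) / sqrt (A / 100) < g / (n * 2 ^ n)\<close>, squared and cleared of
  denominators; positivity of \<open>g\<close> is tested so that the square can be undone.\<close>

definition gain_check :: "int \<Rightarrow> int list \<Rightarrow> int list \<Rightarrow> int \<Rightarrow> int \<Rightarrow> bool" where
  "gain_check n q r e A \<longleftrightarrow> 
    (let g = (1 + 2 * e) * (if even n then r ! nat (n div 2) else 0) + 2 * (3 + 2 * e) * n * q ! nat (n div 2) 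
           - 2 * weighted_excess (- 2 * n - 1 - e) r
     in 0 < g \<and> (2 * (3 + 2 * e) * n * 2 ^ nat n)\<^sup>2 * 100 < g\<^sup>2 * A)"

primrec gain_checks :: "nat \<Rightarrow> int \<Rightarrow> int list \<Rightarrow> bool" where
  "gain_checks 0 n q \<longleftrightarrow> True"
| "gain_checks (Suc f) n q \<longleftrightarrow> (let r = pascal_step q in
    gain_check n q r 0 (628 * (n - 1) + 1400) \<and> gain_check n q r 1 (314 * (2 * n - 1) + 700) \<and> gain_checks f (n + 1) r)"

text \<open>The list is row 1, the row before \<open>n = 2\<close>, so 56 steps cover
  \<open>n\<close> from 2 to 57.\<close>

lemma gain_checks_56: "gain_checks 56 2 [1, 1]"
  by code_simp


definition pascal_row :: "nat \<Rightarrow> int list" where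
  "pascal_row n = map (\<lambda>i. int (n choose i)) [0..<Suc n]"

lemma pascal_step_row: "pascal_step (pascal_row n) = pascal_row (Suc n)"
proof (rule nth_equalityI)
  show "length (pascal_step (pascal_row n)) = length (pascal_row (Suc n))"
    by (simp add: pascal_step_def pascal_row_def)
  fix i assume "i < length (pascal_step (pascal_row n))"
  then have i: "i \<le> Suc n" by (simp add: pascal_step_def pascal_row_def)
  have nth: "pascal_row n ! j = int (n choose j)" if "j \<le> n" for j
    using that unfolding pascal_row_def by (subst nth_map) (auto simp del: upt_Suc)
  have len: "length (pascal_row n) = Suc n" by (simp add: pascal_row_def)
  have "(pascal_row n @ [0]) ! i = int (n choose i)"
    using i nth[of i] len by (cases "i = Suc n") (auto simp: nth_append)
  moreover have "(0 # pascal_row n) ! i = (if i = 0 then 0 else int (n choose (i - 1)))"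
    using i nth[of "i - 1"] by (cases i) auto
  ultimately have "pascal_step (pascal_row n) ! i = int (Suc n choose i)"
    using i len by (cases i) (simp_all add: pascal_step_def)
  then show "pascal_step (pascal_row n) ! i = pascal_row (Suc n) ! i"
    using i unfolding pascal_row_def by (subst nth_map) (auto simp del: upt_Suc)
qed

lemma weighted_excess_eq: "weighted_excess s xs = (\<Sum>i<length xs. xs ! i * max 0 (s + 3 * int i))"
proof (induction xs arbitrary: s)
  case (Cons c r)
  have "(\<Sum>i<length (c # r). (c # r) ! i * max 0 (s + 3 * int i)) = c * max 0 s + (\<Sum>i<length r. r ! i * max 0 (s + 3 + 3 * int i))"
    by (simp only: list.size sum.lessThan_Suc_shift nth_Cons_0 nth_Cons_Suc add_0_right Nat.add_Suc_right One_nat_def)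
       (simp add: algebra_simps)
  then show ?case using Cons[of "s + 3"] by simp
qed simp

lemma weighted_excess_row:
  "weighted_excess (- 2 * int n - 1 - int e) (pascal_row n) = int (loss_excess n e)"
proof -
  have "weighted_excess (- 2 * int n - 1 - int e) (pascal_row n) = (\<Sum>i<Suc n. int (n choose i) * max 0 (- 2 * int n - 1 - int e + 3 * int i))"
    unfolding weighted_excess_eq by (intro sum.cong) (auto simp: pascal_row_def simp del: upt_Suc)
  also have "\<dots> = int (loss_excess n e)"
    unfolding loss_excess_def of_nat_sum of_nat_mult lessThan_Suc_atMost
    by (intro sum.cong refl) (auto simp: max_def)
  finally show ?thesis .
qed

text \<open>What the expected loss saves against \<open>2 + (1 + 2 * e) / n\<close>, scaled by
  \<open>n * 2 ^ n\<close>. This scaling makes it an integer, as the evaluation on Pascal's triangle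
  needs.\<close>

definition loss_gain :: "nat \<Rightarrow> nat \<Rightarrow> real" where
  "loss_gain n e = (1 + 2 * real e) * (if even n then real (n choose (n div 2)) else 0) 
     + 2 * (3 + 2 * real e) * real n * real ((n - 1) choose (n div 2)) - 2 * real (loss_excess n e)"

lemma gain_check_sound:
  assumes "gain_check (int n) (pascal_row (n - 1)) (pascal_row n) (int e) A" "n \<ge> 2"
  shows "0 < loss_gain n e \<and> (2 * (3 + 2 * real e) * real n * 2 ^ n)\<^sup>2 * 100 < (loss_gain n e)\<^sup>2 * real_of_int A"
proof -
  have nth: "pascal_row m ! j = int (m choose j)" if "j \<le> m" for j m
    using that unfolding pascal_row_def by (subst nth_map) (auto simp del: upt_Suc)
  define g where "g = (1 + 2 * int e) * (if even n then int (n choose (n div 2)) else 0) 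
     + 2 * (3 + 2 * int e) * int n * int ((n - 1) choose (n div 2)) - 2 * int (loss_excess n e)"
  have nd: "nat (int n div 2) = n div 2" by (simp add: nat_div_distrib)
  have "0 < g \<and> (2 * (3 + 2 * int e) * int n * 2 ^ n)\<^sup>2 * 100 < g\<^sup>2 * A"
    using assms unfolding gain_check_def weighted_excess_row nd
    by (cases "even n") (simp_all add: nth g_def Let_def)
  moreover have "real_of_int g = loss_gain n e" by (simp add: g_def loss_gain_def)
  moreover have "real_of_int ((2 * (3 + 2 * int e) * int n * 2 ^ n)\<^sup>2 * 100) = (2 * (3 + 2 * real e) * real n * 2 ^ n)\<^sup>2 * 100" by simp
  moreover have "real_of_int (g\<^sup>2 * A) = (real_of_int g)\<^sup>2 * real_of_int A" by simp
  ultimately show ?thesis by (metis of_int_0_less_iff of_int_less_iff)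
qed

lemma gain_checks_sound:
  assumes "gain_checks f (int n) (pascal_row (n - 1))" "n \<ge> 2" "n \<le> m" "m < n + f"
  shows "gain_check (int m) (pascal_row (m - 1)) (pascal_row m) 0 (628 * (int m - 1) + 1400) \<and> 
         gain_check (int m) (pascal_row (m - 1)) (pascal_row m) 1 (314 * (2 * int m - 1) + 700)"
  using assms
proof (induction f arbitrary: n)
  case (Suc f)
  have step: "pascal_step (pascal_row (n - 1)) = pascal_row n"
    using Suc.prems(2) pascal_step_row[of "n - 1"] by simp
  show ?case
  proof (cases "m = n")
    case True
    then show ?thesis using Suc.prems(1) step by (simp add: Let_def)
  next
    case False
    have "gain_checks f (int (Suc n)) (pascal_row (Suc n - 1))"
      using Suc.prems(1) step by (simp add: Let_def add.commute)
    then show ?thesis using Suc.IH[of "Suc n"] Suc.prems False by simp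
  qed
qed simp

section \<open>Central binomial coefficients and Wallis' product\<close>

definition central_prob :: "nat \<Rightarrow> real" where
  "central_prob m = real (2 * m choose m) / 4 ^ m"

lemma central_prob_pos: "central_prob m > 0"
  by (simp add: central_prob_def)

lemma central_prob_Suc: "central_prob (Suc m) = central_prob m * (2 * real m + 1) / (2 * real m + 2)"
proof -
  have "real (Suc m) * real (2 * Suc m choose Suc m) = 2 * (2 * real m + 1) * real (2 * m choose m)"
  proof -
    have 1: "Suc (2 * m) * (2 * m choose m) = (Suc (2 * m) choose Suc m) * Suc m" by (rule Suc_times_binomial_eq)
    have 2: "Suc (Suc (2 * m)) * (Suc (2 * m) choose m) = (Suc (Suc (2 * m)) choose Suc m) * Suc m" by (rule Suc_times_binomial_eq)
    have 3: "(Suc (2 * m) choose m) = (Suc (2 * m) choose Suc m)" using binomial_symmetric[of m "Suc (2 * m)"] by simp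
    have "Suc m * (Suc (Suc (2 * m)) choose Suc m) = 2 * ((Suc (2 * m) choose Suc m) * Suc m)"
      using 2 unfolding 3 by (simp add: algebra_simps)
    also have "\<dots> = 2 * (Suc (2 * m) * (2 * m choose m))" using 1 by simp
    finally have "real (Suc m * (Suc (Suc (2 * m)) choose Suc m)) = real (2 * (Suc (2 * m) * (2 * m choose m)))" by (rule arg_cong)
    then show ?thesis by (simp add: algebra_simps)
  qed
  then have "real (2 * Suc m choose Suc m) = 2 * (2 * real m + 1) * real (2 * m choose m) / real (Suc m)"
    by (simp only: nonzero_eq_divide_eq of_nat_eq_0_iff nat.distinct mult.commute simp_thms)
  then show ?thesis unfolding central_prob_def by (simp only: power_Suc, simp add: divide_simps, simp add: algebra_simps)
qed

text \<open>Through this identity Wallis' limit \<open>pi / 2\<close> says that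
  \<open>(2 * n + 1) * (central_prob n)\<^sup>2\<close> tends to \<open>2 / pi\<close>.\<close>

lemma wallis_prod_eq: "(\<Prod>k=1..n. (4 * real k ^ 2) / (4 * real k ^ 2 - 1)) = 1 / ((2 * real n + 1) * (central_prob n)\<^sup>2)"
proof (induction n)
  case (Suc n)
  have "4 * (real n + 1)\<^sup>2 - 1 = (2 * real n + 1) * (2 * real n + 3)" by (simp add: power2_eq_square algebra_simps)
  moreover have "central_prob n \<noteq> 0" using central_prob_pos[of n] by simp
  ultimately show ?case
    using Suc by (simp add: central_prob_Suc add.commute power_divide power_mult_distrib)
       (simp add: divide_simps power2_eq_square, simp add: algebra_simps)
qed (simp add: central_prob_def)

text \<open>The right-hand side decreases in \<open>m\<close> to the limit \<open>1 / pi\<close>.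
  With shift \<open>a\<close> in place of \<open>3 / 10\<close> the decrease amounts to
  \<open>(4 * a - 1) * m + 3 * a - 1 >= 0\<close>, which forces \<open>a > 1 / 4\<close>; with
  \<open>3 / 10\<close> it holds for all \<open>m >= 1\<close>.\<close>

lemma central_prob_lower_bound:
  assumes "m \<ge> 1"
  shows "1 / pi \<le> (real m + 3 / 10) * (central_prob m)\<^sup>2"
proof -
  define d where "d = (\<lambda>m. (real (Suc m) + 3 / 10) * (central_prob (Suc m))\<^sup>2)"
  have "decseq d"
  proof (rule decseq_SucI)
    fix m
    define x where "x = real (Suc m)"
    have x: "x \<ge> 1" by (simp add: x_def)
    have "(x + 13 / 10) * (2 * x + 1)\<^sup>2 \<le> (x + 3 / 10) * (2 * x + 2)\<^sup>2"
      using x by (simp add: power2_eq_square algebra_simps)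
    then have "(x + 13 / 10) * (2 * x + 1)\<^sup>2 / (2 * x + 2)\<^sup>2 \<le> x + 3 / 10"
      using x by (subst pos_divide_le_eq) auto
    then have "(x + 13 / 10) * (2 * x + 1)\<^sup>2 / (2 * x + 2)\<^sup>2 * (central_prob (Suc m))\<^sup>2 \<le> (x + 3 / 10) * (central_prob (Suc m))\<^sup>2"
      by (intro mult_right_mono) auto
    moreover have "d (Suc m) = (x + 13 / 10) * (2 * x + 1)\<^sup>2 / (2 * x + 2)\<^sup>2 * (central_prob (Suc m))\<^sup>2"
      unfolding d_def central_prob_Suc[of "Suc m"] x_def by (simp add: power_divide power_mult_distrib)
    ultimately show "d (Suc m) \<le> d m" by (simp add: d_def x_def)
  qed
  moreover have "d \<longlonglongrightarrow> 1 / pi"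
  proof -
    have "(\<lambda>n. 1 / ((2 * real n + 1) * (central_prob n)\<^sup>2)) \<longlonglongrightarrow> pi / 2"
      using wallis unfolding wallis_prod_eq .
    then have "(\<lambda>n. inverse (1 / ((2 * real n + 1) * (central_prob n)\<^sup>2))) \<longlonglongrightarrow> inverse (pi / 2)"
      by (intro tendsto_inverse) auto
    then have 1: "(\<lambda>n. (2 * real n + 1) * (central_prob n)\<^sup>2) \<longlonglongrightarrow> 2 / pi" by (simp add: inverse_eq_divide)
    have 2: "(\<lambda>n. (real n + 3 / 10) / (2 * real n + 1)) \<longlonglongrightarrow> 1 / 2" by real_asymp
    have "(\<lambda>n. (real n + 3 / 10) / (2 * real n + 1) * ((2 * real n + 1) * (central_prob n)\<^sup>2)) \<longlonglongrightarrow> 1 / 2 * (2 / pi)"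
      by (rule tendsto_mult[OF 2 1])
    moreover have "(real n + 3 / 10) / (2 * real n + 1) * ((2 * real n + 1) * (central_prob n)\<^sup>2) = (real n + 3 / 10) * (central_prob n)\<^sup>2" for n
      by (simp add: add_pos_nonneg divide_simps)
    ultimately have "(\<lambda>n. (real n + 3 / 10) * (central_prob n)\<^sup>2) \<longlonglongrightarrow> 1 / pi" by simp
    then show ?thesis unfolding d_def by (rule LIMSEQ_Suc)
  qed
  ultimately have "1 / pi \<le> d (m - 1)" by (rule decseq_ge)
  then show ?thesis using assms by (simp add: d_def add.commute)
qed

lemma central_prob_ge: "m \<ge> 1 \<Longrightarrow> 2 / sqrt (4 * pi * real m + 6 / 5 * pi) \<le> central_prob m"
proof -
  assume m: "m \<ge> 1"
  define Y where "Y = 4 * pi * real m + 6 / 5 * pi"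
  have Y: "Y > 0" using m by (simp add: Y_def add_pos_pos)
  have "4 / Y \<le> (central_prob m)\<^sup>2"
    using central_prob_lower_bound[OF m] Y by (simp add: Y_def field_simps)
  then have "sqrt (4 / Y) \<le> central_prob m"
    using central_prob_pos[of m] by (intro real_le_lsqrt) (auto simp: less_imp_le)
  then show ?thesis by (simp add: real_sqrt_divide Y_def)
qed


section \<open>Comparison of the gain with the claimed bound\<close>

lemma binomial_pred_half_eq:
  assumes "n \<ge> 1"
  shows "real ((n - 1) choose (n div 2)) = central_prob (n div 2) * 2 ^ (n - 1)"
proof (cases "even n")
  case True
  then obtain m where m: "n = 2 * Suc m" using assms by (metis dvd_def not0_implies_Suc mult_0_right not_one_le_zero)
  have "(2 * Suc m choose Suc m) = (Suc (2 * m) choose m) + (Suc (2 * m) choose Suc m)" by simp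
  also have "(Suc (2 * m) choose m) = (Suc (2 * m) choose Suc m)" using binomial_symmetric[of m "Suc (2 * m)"] by simp
  finally have "real (2 * Suc m choose Suc m) = 2 * real (Suc (2 * m) choose Suc m)" by simp
  moreover have "(4::real) ^ Suc m = 2 * 2 ^ Suc (2 * m)" by (simp add: power_mult)
  ultimately show ?thesis by (simp add: m central_prob_def del: binomial_Suc_Suc)
next
  case False
  then obtain m where "n = 2 * m + 1" by (rule oddE)
  then show ?thesis by (simp add: central_prob_def power_mult)
qed

lemma loss_gain_eq:
  assumes "n \<ge> 1"
  shows "loss_gain n e = ((1 + 2 * real e) * (if even n then central_prob (n div 2) else 0) + (3 + 2 * real e) * real n * central_prob (n div 2)) * 2 ^ n
     - 2 * real (loss_excess n e)"
proof -
  have "(2::real) ^ n = 2 * 2 ^ (n - 1)" using assms by (cases n) auto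
  moreover have "real (n choose (n div 2)) = central_prob (n div 2) * 2 ^ n" if "even n"
    using that by (auto simp: central_prob_def power_mult elim!: evenE)
  ultimately show ?thesis
    unfolding loss_gain_def binomial_pred_half_eq[OF assms] by (simp add: algebra_simps)
qed

lemma expected_loss_eq_gain:
  assumes "n \<ge> 1" "e \<le> 1"
  shows "expected_loss (n - 1) (2 * (n - 1) + e) = 2 + (1 + 2 * real e) / real n - loss_gain n e / (real n * 2 ^ n)"
proof -
  define P where "P = (2::real) ^ (n - 1)"
  have P: "P > 0" "(2::real) ^ n = 2 * P" using assms(1) by (cases n; simp add: P_def)+
  define C where "C = (if even n then real (n choose (n div 2)) else 0)"
  have "expected_loss (n - 1) (2 * (n - 1) + e) * (real n * P) = (2 * real n + 1 + 2 * real e) * P - loss_gain n e / 2"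
    unfolding P_def expected_loss_closed_form[OF assms] loss_gain_def C_def[symmetric] by (simp add: field_simps)
  then have "expected_loss (n - 1) (2 * (n - 1) + e) = ((2 * real n + 1 + 2 * real e) * P - loss_gain n e / 2) / (real n * P)"
    using P assms(1) by (simp add: eq_divide_eq)
  also have "\<dots> = 2 + (1 + 2 * real e) / real n - loss_gain n e / (real n * 2 ^ n)"
    using P assms(1) by (simp add: field_simps)
  finally show ?thesis .
qed

text \<open>In terms of \<open>k = 2 * (n - 1) + e\<close> these are the radicands
  \<open>pi * k + 14\<close> and \<open>pi * k + 7\<close> of the theorem.\<close>

definition loss_radicand :: "nat \<Rightarrow> nat \<Rightarrow> real" where
  "loss_radicand n e = (if e = 0 then 2 * pi * real n - 2 * pi + 14 else 2 * pi * real n - pi + 7)"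

lemma geometric_excess_small:
  assumes "n \<ge> 58"
  shows "(2 * (159 / 100) * (50 / 63) * (((1 + (63 / 50) ^ 3) * (50 / 63)\<^sup>2) / 2) ^ n)\<^sup>2 * (2 * pi * real n + 8) < 4"
proof -
  define q :: real where "q = (((1 + (63 / 50) ^ 3) * (50 / 63)\<^sup>2) / 2)\<^sup>2"
  define c :: real where "c = (2 * (159 / 100) * (50 / 63))\<^sup>2"
  \<comment> \<open>Rational upper bounds for \<open>q\<close>, for \<open>c\<close> and, with
    \<open>629 / 100\<close>, for \<open>2 * pi\<close> turn the claim into a numerical one at
    \<open>n = 58\<close>; from there on the decay of the power outweighs the linear factor.\<close>
  have q: "0 \<le> q" "q \<le> 8930 / 10000" by (simp_all add: q_def power2_eq_square power3_eq_cube)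
  have c: "0 < c" "c \<le> 637 / 100" by (simp_all add: c_def power2_eq_square)
  define h where "h = (\<lambda>n. c * ((8930 / 10000) ^ n * (629 / 100 * real n + 8)))"
  have base: "h 58 < 4"
  proof -
    have "h 58 \<le> (637 / 100) * ((8930 / 10000) ^ 58 * (629 / 100 * real 58 + 8))"
      unfolding h_def using c by (intro mult_right_mono) auto
    also have "\<dots> < 4" by (simp add: power_divide)
    finally show ?thesis .
  qed
  have dec: "h (Suc n) \<le> h n" if "n \<ge> 58" for n
  proof -
    have "real n \<ge> 58" using that by simp
    then have "8930 / 10000 * (629 / 100 * real (Suc n) + 8) \<le> 629 / 100 * real n + 8" by simp
    then have "(8930 / 10000) ^ n * (8930 / 10000 * (629 / 100 * real (Suc n) + 8)) \<le> (8930 / 10000) ^ n * (629 / 100 * real n + 8)"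
      by (intro mult_left_mono) auto
    then show ?thesis unfolding h_def using c(1) by (intro mult_left_mono) (auto simp: mult_ac)
  qed
  have "h n \<le> h 58" using assms
  proof (induction n rule: dec_induct)
    case (step n)
    then show ?case using dec[of n] by linarith
  qed simp
  then have hn: "h n < 4" using base by simp
  have "(2 * (159 / 100) * (50 / 63) * (((1 + (63 / 50) ^ 3) * (50 / 63)\<^sup>2) / 2) ^ n)\<^sup>2 = c * q ^ n"
    unfolding c_def q_def by (simp only: power_mult_distrib power_mult[symmetric] mult.commute[of n 2])
  also have "c * q ^ n * (2 * pi * real n + 8) \<le> c * (8930 / 10000) ^ n * (629 / 100 * real n + 8)"
    using c q pi_approx by (intro mult_mono power_mono add_right_mono mult_right_mono) (auto intro!: mult_nonneg_nonneg)
  also have "\<dots> = h n" by (simp add: h_def)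
  also note hn
  finally show ?thesis .
qed

text \<open>The gain is \<open>(3 + 2 * e) * central_prob (n div 2)\<close>, plus a central term for
  even \<open>n\<close>, minus the exponentially small \<open>w\<close>. For even \<open>n\<close>
  the Wallis bound already beats \<open>2 / sqrt A\<close>, and the central term pays for
  \<open>w\<close>. For odd \<open>n\<close> there is no central term, but
  \<open>n div 2 = (n - 1) / 2\<close> makes the radicand of the Wallis bound smaller than
  \<open>A\<close> by a constant, and this gap pays for \<open>w\<close>.\<close>

lemma loss_gain_large:
  assumes "n \<ge> 58" "e \<le> 1"
  shows "2 * (3 + 2 * real e) / sqrt (loss_radicand n e) < loss_gain n e / (real n * 2 ^ n)"
proof -
  define N where "N = real n"
  have N: "N \<ge> 58" using assms by (simp add: N_def)
  \<comment> \<open>A common upper bound of both radicands, since \<open>14 - 2 * pi\<close> and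
    \<open>7 - pi\<close> are below 8.\<close>
  define Y where "Y = 2 * pi * N + 8"
  define A where "A = loss_radicand n e"
  have piN: "pi * N > 3 * 58" using N pi_approx mult_strict_mono[of 3 pi 58 N] mult_strict_mono'[of 3 pi 57 N] mult_mono[of "3.1" pi 58 N] by simp
  have Y: "Y > 0" using piN by (simp add: Y_def)
  have A_cases: "(real e = 0 \<and> A = 2 * (pi * N) - 2 * pi + 14) \<or> (real e = 1 \<and> A = 2 * (pi * N) - pi + 7)"
    using assms(2) by (auto simp: A_def loss_radicand_def N_def mult.assoc)
  have A: "A > 0" "A \<le> Y" using A_cases piN pi_approx by (auto simp: Y_def)
  define w where "w = 2 * real (loss_excess n e) / (N * 2 ^ n)"
  have wY: "w * N < 2 / sqrt Y"
  proof -
    define z where "z = 2 * (159 / 100) * (50 / 63) * (((1 + (63 / 50) ^ 3) * (50 / 63)\<^sup>2) / 2 :: real) ^ n"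
    have "w * N = 2 * (real (loss_excess n e) / 2 ^ n)" using N by (simp add: w_def)
    also have "\<dots> \<le> 2 * ((159 / 100) * (50 / 63) * ((1 + (63 / 50) ^ 3) * (50 / 63)\<^sup>2) ^ n / 2 ^ n)"
      by (intro mult_left_mono divide_right_mono loss_excess_le) auto
    also have "\<dots> = z" by (simp only: z_def power_divide times_divide_eq_right mult.assoc)
    finally have wz: "w * N \<le> z" .
    have "z\<^sup>2 * Y < 4" using geometric_excess_small[OF assms(1)] by (simp only: z_def Y_def N_def)
    then have "(z * sqrt Y)\<^sup>2 < 2\<^sup>2" using Y by (simp add: power_mult_distrib)
    then have "z * sqrt Y < 2" by (rule power_less_imp_less_base) simp
    then have "z < 2 / sqrt Y" using Y by (simp add: pos_less_divide_eq)
    then show ?thesis using wz by linarith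
  qed
  have wN: "w < (2 / sqrt Y) / N"
    by (subst pos_less_divide_eq) (use wY N in auto)
  have gain: "loss_gain n e / (N * 2 ^ n) = (1 + 2 * real e) * (if even n then central_prob (n div 2) else 0) / N + (3 + 2 * real e) * central_prob (n div 2) - w"
    using N assms(1) by (simp add: loss_gain_eq w_def N_def field_simps)
  define m where "m = n div 2"
  have m: "m \<ge> 1" using assms(1) by (simp add: m_def)
  have cp: "2 / sqrt (4 * pi * real m + 6 / 5 * pi) \<le> central_prob m" by (rule central_prob_ge[OF m])
  have e0: "real e \<ge> 0" by simp
  show ?thesis
  proof (cases "even n")
    case True
    then have mN: "real m = N / 2" by (auto simp: m_def N_def elim!: evenE)
    have b1: "2 * (pi * N) + 6 / 5 * pi \<le> A" using A_cases pi_approx by auto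
    have b2: "2 * (pi * N) + 6 / 5 * pi \<le> Y" using pi_approx by (simp add: Y_def)
    have b0: "2 * (pi * N) + 6 / 5 * pi > 0" using piN pi_approx by simp
    have am: "4 * pi * real m + 6 / 5 * pi = 2 * (pi * N) + 6 / 5 * pi" by (simp add: mN)
    have "2 / sqrt A \<le> 2 / sqrt (2 * (pi * N) + 6 / 5 * pi)"
      using b0 b1 by (intro divide_left_mono real_sqrt_le_mono mult_pos_pos) auto
    then have c1: "2 / sqrt A \<le> central_prob m" using cp unfolding am by (rule order_trans)
    have "2 / sqrt Y \<le> 2 / sqrt (2 * (pi * N) + 6 / 5 * pi)"
      using b0 b2 by (intro divide_left_mono real_sqrt_le_mono mult_pos_pos) auto
    then have c2: "2 / sqrt Y \<le> central_prob m" using cp unfolding am by (rule order_trans)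
    have "w < (2 / sqrt Y) / N" by (rule wN)
    also have "\<dots> \<le> central_prob m / N" using c2 N by (intro divide_right_mono) auto
    also have "\<dots> \<le> (1 + 2 * real e) * central_prob m / N" using central_prob_pos[of m] N by (intro divide_right_mono) (auto simp: distrib_right)
    finally have "w < (1 + 2 * real e) * central_prob m / N" .
    moreover have "(3 + 2 * real e) * (2 / sqrt A) \<le> (3 + 2 * real e) * central_prob m"
      using c1 by (intro mult_left_mono) auto
    ultimately show ?thesis using True unfolding A_def[symmetric] N_def[symmetric] gain m_def[symmetric] by simp
  next
    case False
    then have mN: "real m = (N - 1) / 2" by (auto simp: m_def N_def elim!: oddE)
    define a where "a = 2 * (pi * N) - 4 / 5 * pi"
    have a0: "a > 0" unfolding a_def using piN pi_less_4 by linarith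
    have am: "4 * pi * real m + 6 / 5 * pi = a" by (simp add: mN a_def field_simps)
    define u where "u = (A - a) / a"
    have cd: "(3 + 2 * real e) * (A - a) \<ge> 30" "A - a \<le> 12" "A - a \<ge> 0"
      using A_cases pi_approx by (auto simp: a_def)
    have "a \<ge> 4" unfolding a_def using piN pi_less_4 by linarith
    then have u: "u \<ge> 0" "u \<le> 3" using cd(2,3) a0 by (auto simp: u_def pos_divide_le_eq)
    \<comment> \<open>Concavity of the square root: the chord of \<open>sqrt (1 + u)\<close> over
      the interval from 0 to 3 has slope \<open>1 / 3\<close>.\<close>
    have "(1 + u / 3)\<^sup>2 \<le> 1 + u"
      using mult_left_mono[OF u(2) u(1)] by (simp add: power2_eq_square field_simps)
    then have "1 + u / 3 \<le> sqrt (1 + u)" using u by (intro real_le_rsqrt) auto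
    also have "sqrt (1 + u) = sqrt A / sqrt a" using a0 by (simp add: u_def diff_divide_distrib real_sqrt_divide)
    finally have r1: "(1 + u / 3) / sqrt A \<le> 1 / sqrt a" using A a0 by (simp add: field_simps)
    have Nc: "1 / N \<le> (3 + 2 * real e) * u / 3"
    proof -
      have "pi * N \<le> 4 * N" using pi_less_4 N by (intro mult_right_mono) auto
      then have "a \<le> 10 * N" unfolding a_def using pi_gt_zero N by linarith
      then have "1 / N \<le> 10 / a" using N a0 by (simp add: pos_le_divide_eq divide_simps)
      also have "10 / a = 30 / (3 * a)" by simp
      also have "\<dots> \<le> (3 + 2 * real e) * (A - a) / (3 * a)" using cd(1) a0 by (intro divide_right_mono) auto
      finally show ?thesis by (simp add: u_def)
    qed
    have "w < (2 / sqrt Y) / N" by (rule wN)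
    also have "\<dots> \<le> (2 / sqrt A) / N" using A Y N by (intro divide_right_mono divide_left_mono) auto
    also have "\<dots> = (2 / sqrt A) * (1 / N)" by simp
    also have "\<dots> \<le> (2 / sqrt A) * ((3 + 2 * real e) * u / 3)" using Nc A by (intro mult_left_mono) auto
    finally have "2 * (3 + 2 * real e) / sqrt A + w < (3 + 2 * real e) * (2 * ((1 + u / 3) / sqrt A))"
      by (simp add: add_divide_distrib distrib_left mult_ac)
    also have "\<dots> \<le> (3 + 2 * real e) * (2 * (1 / sqrt a))" using r1 by (intro mult_left_mono) auto
    also have "\<dots> \<le> (3 + 2 * real e) * central_prob m" using cp unfolding am by (intro mult_left_mono) auto
    finally show ?thesis using False unfolding A_def[symmetric] N_def[symmetric] gain m_def[symmetric] by simp
  qed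
qed

lemma loss_gain_small:
  assumes "2 \<le> n" "n \<le> 57" "e \<le> 1"
  shows "2 * (3 + 2 * real e) / sqrt (loss_radicand n e) < loss_gain n e / (real n * 2 ^ n)"
proof -
  define A where "A = loss_radicand n e"
  define B where "B = real_of_int (if e = 0 then 628 * (int n - 1) + 1400 else 314 * (2 * int n - 1) + 700)"
  define g where "g = loss_gain n e"
  define D where "D = real n * 2 ^ n"
  have D: "D > 0" using assms by (simp add: D_def)
  have row: "pascal_row 1 = [1, 1]" by (simp add: pascal_row_def upt_rec)
  have "gain_checks 56 (int 2) (pascal_row (2 - 1))" using gain_checks_56 row by simp
  from gain_checks_sound[OF this, of n] assms
  have "gain_check (int n) (pascal_row (n - 1)) (pascal_row n) (int e) (if e = 0 then 628 * (int n - 1) + 1400 else 314 * (2 * int n - 1) + 700)"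
    by (cases "e = 0") (simp_all add: le_Suc_eq)
  from gain_check_sound[OF this assms(1)]
  have g: "0 < g" "(2 * (3 + 2 * real e) * D)\<^sup>2 * 100 < g\<^sup>2 * B"
    unfolding g_def D_def B_def by (simp_all add: mult.assoc)
  have n1: "real n - 1 \<ge> 1" using assms by simp
  have pn: "628 * (real n - 1) \<le> 200 * pi * (real n - 1)" "314 * (2 * real n - 1) \<le> 100 * pi * (2 * real n - 1)"
    using pi_approx n1 by (intro mult_right_mono; simp)+
  have BA: "B \<le> 100 * A"
    using pn by (auto simp: B_def A_def loss_radicand_def algebra_simps)
  have A: "A > 0" 
  proof -
    have "B > 0" using assms by (simp add: B_def)
    then show ?thesis using BA by simp
  qed
  have "(2 * (3 + 2 * real e) * D)\<^sup>2 * 100 < g\<^sup>2 * (100 * A)"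
    using g(2) mult_left_mono[OF BA, of "g\<^sup>2"] by simp
  then have "(2 * (3 + 2 * real e) * D)\<^sup>2 < (g * sqrt A)\<^sup>2"
    using A by (simp add: power_mult_distrib)
  then have "2 * (3 + 2 * real e) * D < g * sqrt A"
    by (rule power_less_imp_less_base) (use g A in auto)
  then show ?thesis using A D unfolding A_def[symmetric] D_def[symmetric] g_def[symmetric]
    by (simp add: pos_divide_less_eq pos_less_divide_eq mult_ac)
qed

lemma expected_loss_less:
  assumes "t \<ge> 1"
  shows "expected_loss t (2 * t) < 2 - 6 / sqrt (pi * real (2 * t) + 14) + 2 / (real (2 * t) + 2)"
    and "expected_loss t (2 * t + 1) < 2 - 10 / sqrt (pi * real (2 * t + 1) + 7) + 6 / (real (2 * t + 1) + 1)"
proof -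
  define n where "n = t + 1"
  have n: "n \<ge> 1" "n - 1 = t" by (auto simp: n_def)
  have gain: "2 * (3 + 2 * real e) / sqrt (loss_radicand n e) < loss_gain n e / (real n * 2 ^ n)" if "e \<le> 1" for e
    using loss_gain_small[of n e] loss_gain_large[of n e] that assms by (cases "n \<le> 57") (auto simp: n_def)
  have "loss_radicand n 0 = pi * real (2 * t) + 14" "loss_radicand n 1 = pi * real (2 * t + 1) + 7"
    by (simp_all add: loss_radicand_def n_def algebra_simps)
  moreover have "2 / (real (2 * t) + 2) = 1 / real n" "6 / (real (2 * t + 1) + 1) = 3 / real n"
    by (simp_all add: n_def field_simps)
  ultimately show "expected_loss t (2 * t) < 2 - 6 / sqrt (pi * real (2 * t) + 14) + 2 / (real (2 * t) + 2)"
    and "expected_loss t (2 * t + 1) < 2 - 10 / sqrt (pi * real (2 * t + 1) + 7) + 6 / (real (2 * t + 1) + 1)"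
    using gain[of 0] gain[of 1] expected_loss_eq_gain[OF n(1), of 0] expected_loss_eq_gain[OF n(1), of 1] unfolding n(2)
    by simp_all
qed

section \<open>Greedy choice of the parameters\<close>

text \<open>Monotonicity lets upper bounds on hit frequencies replace exact ones, and the bound on
  the increments controls the cost of errors in them. The truncated excess has both properties and
  averaging keeps them, so they hold for every intermediate potential.\<close>

definition slow :: "(nat \<Rightarrow> real) \<Rightarrow> bool" where
  "slow g \<longleftrightarrow> (\<forall>s. g s \<le> g (Suc s) \<and> g (Suc s) \<le> g s + 1)"

text \<open>If a diagonal has \<open>s\<close> points so far, a random further hyperbola misses it with probability
  \<open>1 / 2\<close> and otherwise adds \<open>e\<close> or \<open>e + 1\<close> points; \<open>avg_step\<close> averages \<open>g\<close> over this.\<close>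

definition hit_step :: "nat \<Rightarrow> real \<Rightarrow> (nat \<Rightarrow> real) \<Rightarrow> nat \<Rightarrow> real" where
  "hit_step e v g s = v * g (s + e) + (1 - v) * g (s + e + 1)"

definition avg_step :: "nat \<Rightarrow> real \<Rightarrow> (nat \<Rightarrow> real) \<Rightarrow> nat \<Rightarrow> real" where
  "avg_step e v g s = (g s + hit_step e v g s) / 2"

lemma slowD: "slow g \<Longrightarrow> g s \<le> g (s + d)" "slow g \<Longrightarrow> g (s + d) \<le> g s + real d"
proof -
  assume g: "slow g"
  show "g s \<le> g (s + d)"
  proof (induction d)
    case (Suc d) then show ?case using g unfolding slow_def by (metis add_Suc_right order_trans)
  qed simp
  show "g (s + d) \<le> g s + real d"
  proof (induction d)
    case (Suc d)
    have "g (s + Suc d) \<le> g (s + d) + 1" using g by (simp add: slow_def)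
    then show ?case using Suc by simp
  qed simp
qed

lemma slow_hit_step:
  assumes "slow g" "0 \<le> v" "v \<le> 1"
  shows "slow (hit_step e v g)"
  unfolding slow_def
proof
  fix s
  have a: "g (s + e) \<le> g (Suc s + e)" "g (Suc s + e) \<le> g (s + e) + 1"
    "g (s + e + 1) \<le> g (Suc s + e + 1)" "g (Suc s + e + 1) \<le> g (s + e + 1) + 1"
    using assms(1) by (simp_all add: slow_def)
  have "hit_step e v g (Suc s) \<le> v * (g (s + e) + 1) + (1 - v) * (g (s + e + 1) + 1)"
    unfolding hit_step_def using a assms by (intro add_mono mult_left_mono) auto
  also have "\<dots> = hit_step e v g s + 1" by (simp add: hit_step_def algebra_simps)
  finally show "hit_step e v g s \<le> hit_step e v g (Suc s) \<and> hit_step e v g (Suc s) \<le> hit_step e v g s + 1"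
    unfolding hit_step_def using a assms by (auto intro!: add_mono mult_left_mono)
qed

lemma slow_avg_step: "slow g \<Longrightarrow> 0 \<le> v \<Longrightarrow> v \<le> 1 \<Longrightarrow> slow (avg_step e v g)"
  using slow_hit_step[of g v e] unfolding slow_def avg_step_def by (simp add: field_simps) (smt (verit))

lemma slow_avg_iter: "slow g \<Longrightarrow> 0 \<le> v \<Longrightarrow> v \<le> 1 \<Longrightarrow> slow ((avg_step e v ^^ n) g)"
  by (induction n) (simp_all add: slow_avg_step)

lemma avg_step_mono:
  assumes "\<And>s. g s \<le> g' s" "0 \<le> v" "v \<le> 1"
  shows "avg_step e v g s \<le> avg_step e v g' s"
  unfolding avg_step_def hit_step_def using assms
  by (intro divide_right_mono add_mono mult_left_mono) auto

text \<open>A larger \<open>v\<close> moves weight from \<open>e + 1\<close> to \<open>e\<close>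
  points, where a slow function is smaller. Monotonicity in \<open>v\<close> is what later bounds
  sums over diagonals by an integral.\<close>

lemma avg_iter_antimono:
  assumes "slow g" "0 \<le> v" "v \<le> v'" "v' \<le> 1"
  shows "(avg_step e v' ^^ n) g s \<le> (avg_step e v ^^ n) g s"
proof (induction n arbitrary: s)
  case (Suc n)
  define X where "X = (avg_step e v ^^ n) g"
  have X: "slow X" unfolding X_def using assms by (intro slow_avg_iter) auto
  have "avg_step e v' ((avg_step e v' ^^ n) g) s \<le> avg_step e v' X s"
    unfolding X_def using assms Suc by (intro avg_step_mono) auto
  also have "\<dots> \<le> avg_step e v X s"
  proof -
    have "(v' - v) * X (s + e) \<le> (v' - v) * X (s + e + 1)"
      using X assms by (intro mult_left_mono) (auto simp: slow_def)
    then have "hit_step e v' X s \<le> hit_step e v X s" by (simp add: hit_step_def algebra_simps)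
    then show ?thesis by (simp add: avg_step_def)
  qed
  finally show ?case by (simp add: X_def)
qed simp

text \<open>A crude bound for the few diagonals that are left out of the Riemann sums.\<close>

lemma avg_iter_le:
  assumes "slow g" "0 \<le> v" "v \<le> 1"
  shows "(avg_step e v ^^ n) g s \<le> g s + real n * (real e + 1)"
proof (induction n)
  case (Suc n)
  define X where "X = (avg_step e v ^^ n) g"
  have X: "slow X" unfolding X_def using assms by (intro slow_avg_iter) auto
  have "v * X (s + e) + (1 - v) * X (s + e + 1) \<le> v * (X s + (real e + 1)) + (1 - v) * (X s + (real e + 1))"
    using slowD(2)[OF X, of s e] slowD(2)[OF X, of s "e + 1"] assms
    by (intro add_mono mult_left_mono) (auto simp: add.assoc)
  also have "\<dots> = X s + (real e + 1)" by (simp add: algebra_simps)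
  finally have "avg_step e v X s \<le> X s + (real e + 1)" by (simp add: avg_step_def hit_step_def)
  then show ?case using Suc by (simp add: X_def algebra_simps)
qed simp

lemma avg_iter_nonneg:
  assumes "\<And>s. g s \<ge> 0" "0 \<le> v" "v \<le> 1"
  shows "(avg_step e v ^^ n) g s \<ge> 0"
proof (induction n arbitrary: s)
  case (Suc n)
  then show ?case using assms by (simp add: avg_step_def hit_step_def)
qed (use assms in simp)

lemma sum_binomial_Suc:
  "(\<Sum>j\<le>Suc h. real (Suc h choose j) * f j) = (\<Sum>j\<le>h. real (h choose j) * (f j + f (Suc j)))"
proof -
  have "(\<Sum>j\<le>Suc h. real (Suc h choose j) * f j) = f 0 + (\<Sum>j\<le>h. real (Suc h choose Suc j) * f (Suc j))"
    by (subst sum.atMost_Suc_shift) simp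
  also have "(\<Sum>j\<le>h. real (Suc h choose Suc j) * f (Suc j)) = (\<Sum>j\<le>h. real (h choose j) * f (Suc j)) + (\<Sum>j\<le>h. real (h choose Suc j) * f (Suc j))"
    by (simp add: sum.distrib algebra_simps)
  also have "f 0 + (\<dots>) = (\<Sum>j\<le>h. real (h choose j) * f (Suc j)) + (\<Sum>j\<le>Suc h. real (h choose j) * f j)"
    by (subst sum.atMost_Suc_shift) simp
  also have "(\<Sum>j\<le>Suc h. real (h choose j) * f j) = (\<Sum>j\<le>h. real (h choose j) * f j)" by simp
  finally show ?thesis by (simp add: sum.distrib algebra_simps)
qed

lemma hit_iter_eq:
  "(hit_step e v ^^ h) g s = (\<Sum>j\<le>h. real (h choose j) * (v ^ (h - j) * (1 - v) ^ j * g (s + e * h + j)))"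
proof (induction h arbitrary: s)
  case (Suc h)
  have "(hit_step e v ^^ Suc h) g s = v * (hit_step e v ^^ h) g (s + e) + (1 - v) * (hit_step e v ^^ h) g (s + e + 1)"
    by (simp add: hit_step_def)
  also have "\<dots> = (\<Sum>j\<le>h. real (h choose j) * (v ^ (Suc h - j) * (1 - v) ^ j * g (s + e * Suc h + j) + 
      v ^ (Suc h - Suc j) * (1 - v) ^ Suc j * g (s + e * Suc h + Suc j)))"
    unfolding Suc sum_distrib_left sum.distrib[symmetric]
    by (intro sum.cong refl) (auto simp: Suc_diff_le algebra_simps)
  also have "\<dots> = (\<Sum>j\<le>Suc h. real (Suc h choose j) * (v ^ (Suc h - j) * (1 - v) ^ j * g (s + e * Suc h + j)))"
    by (rule sum_binomial_Suc[symmetric])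
  finally show ?case .
qed simp

lemma avg_iter_eq_hit_iter:
  "(avg_step e v ^^ n) g s = (\<Sum>h\<le>n. real (n choose h) * (hit_step e v ^^ h) g s) / 2 ^ n"
proof (induction n arbitrary: s)
  case (Suc n)
  have hs: "hit_step e v (\<lambda>s. (\<Sum>h\<le>n. real (n choose h) * (hit_step e v ^^ h) g s) / 2 ^ n) s = 
      (\<Sum>h\<le>n. real (n choose h) * (hit_step e v ^^ Suc h) g s) / 2 ^ n"
    unfolding hit_step_def[of e v "\<lambda>s. (\<Sum>h\<le>n. _ h s) / _"]
    by (simp add: hit_step_def sum_distrib_left sum.distrib add_divide_distrib distrib_left mult_ac sum_divide_distrib)
  have eq: "(avg_step e v ^^ n) g = (\<lambda>s. (\<Sum>h\<le>n. real (n choose h) * (hit_step e v ^^ h) g s) / 2 ^ n)"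
    using Suc by (rule ext)
  have "(avg_step e v ^^ Suc n) g s = avg_step e v (\<lambda>s. (\<Sum>h\<le>n. real (n choose h) * (hit_step e v ^^ h) g s) / 2 ^ n) s"
    by (simp only: funpow.simps o_apply eq)
  also have "\<dots> = (\<Sum>h\<le>n. real (n choose h) * ((hit_step e v ^^ h) g s + (hit_step e v ^^ Suc h) g s)) / 2 ^ Suc n"
    unfolding avg_step_def hs by (simp add: sum.distrib distrib_left add_divide_distrib)
  also have "\<dots> = (\<Sum>h\<le>Suc n. real (Suc n choose h) * (hit_step e v ^^ h) g s) / 2 ^ Suc n"
    unfolding sum_binomial_Suc[of n "\<lambda>h. (hit_step e v ^^ h) g s"] ..
  finally show ?case .
qed simp

section \<open>Averaging over the distance from the centre\<close>

lemma beta_has_integral: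
  "((\<lambda>v::real. v ^ a * (1 - v) ^ b) has_integral fact a * fact b / fact (a + b + 1)) {0..1}"
proof (induction b arbitrary: a)
  case 0
  have "((\<lambda>v::real. v ^ a) has_integral (1 ^ Suc a / real (Suc a) - 0 ^ Suc a / real (Suc a))) {0..1}"
    by (rule fundamental_theorem_of_calculus)
       (auto intro!: derivative_eq_intros simp flip: has_real_derivative_iff_has_vector_derivative simp del: power_Suc)
  then show ?case by (simp add: fact_Suc divide_simps)
next
  case (Suc b)
  have "((\<lambda>v::real. real (Suc a) * (v ^ a * (1 - v) ^ Suc b) - real (Suc b) * (v ^ Suc a * (1 - v) ^ b)) has_integral 
      (1 ^ Suc a * (1 - 1) ^ Suc b - 0 ^ Suc a * (1 - 0) ^ Suc b)) {0..1}"
  proof (rule fundamental_theorem_of_calculus)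
    fix v :: real
    have "((\<lambda>v. v ^ Suc a * (1 - v) ^ Suc b) has_real_derivative real (Suc a) * (v ^ a * (1 - v) ^ Suc b) - real (Suc b) * (v ^ Suc a * (1 - v) ^ b)) (at v within {0..1})"
      by (rule derivative_eq_intros refl | simp add: algebra_simps)+
    then show "((\<lambda>v. v ^ Suc a * (1 - v) ^ Suc b) has_vector_derivative real (Suc a) * (v ^ a * (1 - v) ^ Suc b) - real (Suc b) * (v ^ Suc a * (1 - v) ^ b)) (at v within {0..1})"
      by (simp only: has_real_derivative_iff_has_vector_derivative)
  qed simp
  from has_integral_mult_right[OF has_integral_add[OF this has_integral_mult_right[OF Suc[of "Suc a"], of "real (Suc b)"]], of "1 / real (Suc a)"]
  have "((\<lambda>v::real. v ^ a * (1 - v) ^ Suc b) has_integral (1 / real (Suc a) * (0 + real (Suc b) * (fact (Suc a) * fact b / fact (Suc a + b + 1))))) {0..1}"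
    by (simp del: power_Suc fact_Suc of_nat_Suc add: power_0_left)
  also have "1 / real (Suc a) * (0 + real (Suc b) * (fact (Suc a) * fact b / fact (Suc a + b + 1))) = fact a * fact (Suc b) / fact (a + Suc b + 1)"
    by (simp add: fact_Suc[of a] fact_Suc[of b] del: fact_Suc of_nat_Suc)
  finally show ?case .
qed

text \<open>The Beta integral times \<open>h choose j\<close> is \<open>1 / (h + 1)\<close> for
  every \<open>j\<close>: a binomial variable with uniform success probability is uniform. This is
  the origin of the inner sum in \<open>expected_loss\<close>.\<close>

lemma avg_iter_has_integral:
  "((\<lambda>v. (avg_step e v ^^ n) g 0) has_integral 
     (\<Sum>h\<le>n. real (n choose h) / 2 ^ n / (real h + 1) * (\<Sum>j\<le>h. g (e * h + j)))) {0..1}"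
proof -
  have 1: "((\<lambda>v. (hit_step e v ^^ h) g 0) has_integral (\<Sum>j\<le>h. g (e * h + j)) / (real h + 1)) {0..1}" for h
  proof -
    have "((\<lambda>v. \<Sum>j\<le>h. real (h choose j) * g (e * h + j) * (v ^ (h - j) * (1 - v) ^ j)) has_integral 
       (\<Sum>j\<le>h. real (h choose j) * g (e * h + j) * (fact (h - j) * fact j / fact (h - j + j + 1)))) {0..1}"
      by (intro has_integral_sum has_integral_mult_right beta_has_integral) auto
    also have "(\<lambda>v. \<Sum>j\<le>h. real (h choose j) * g (e * h + j) * (v ^ (h - j) * (1 - v) ^ j)) = (\<lambda>v. (hit_step e v ^^ h) g 0)"
      unfolding hit_iter_eq by (intro ext sum.cong refl) (simp add: mult_ac)
    also have "(\<Sum>j\<le>h. real (h choose j) * g (e * h + j) * (fact (h - j) * fact j / fact (h - j + j + 1))) = (\<Sum>j\<le>h. g (e * h + j) / (real h + 1))"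
    proof (intro sum.cong refl)
      fix j assume j: "j \<in> {..h}"
      then have "real (h choose j) * (fact j * fact (h - j)) = fact h"
        using binomial_fact_lemma[of j h] by (metis atMost_iff mult.commute of_nat_fact of_nat_mult)
      moreover have "(fact (h - j + j + 1) :: real) = (real h + 1) * fact h" using j by (simp add: fact_Suc add.commute)
      ultimately show "real (h choose j) * g (e * h + j) * (fact (h - j) * fact j / fact (h - j + j + 1)) = g (e * h + j) / (real h + 1)"
        by (simp add: divide_simps) (simp add: mult_ac)
    qed
    finally show ?thesis by (simp add: sum_divide_distrib)
  qed
  have "((\<lambda>v. \<Sum>h\<le>n. (real (n choose h) / 2 ^ n) * (hit_step e v ^^ h) g 0) has_integral 
     (\<Sum>h\<le>n. (real (n choose h) / 2 ^ n) * ((\<Sum>j\<le>h. g (e * h + j)) / (real h + 1)))) {0..1}"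
    by (intro has_integral_sum has_integral_mult_right 1) auto
  moreover have "(avg_step e v ^^ n) g 0 = (\<Sum>h\<le>n. (real (n choose h) / 2 ^ n) * (hit_step e v ^^ h) g 0)" for v
    unfolding avg_iter_eq_hit_iter sum_divide_distrib by (intro sum.cong refl) simp
  moreover have "(\<Sum>h\<le>n. (real (n choose h) / 2 ^ n) * ((\<Sum>j\<le>h. g (e * h + j)) / (real h + 1))) = 
     (\<Sum>h\<le>n. real (n choose h) / 2 ^ n / (real h + 1) * (\<Sum>j\<le>h. g (e * h + j)))"
    by (intro sum.cong refl) simp
  ultimately show ?thesis by (simp only:)
qed

lemma avg_iter_continuous: "continuous_on S (\<lambda>v. (avg_step e v ^^ n) g s)"
  unfolding avg_iter_eq_hit_iter hit_iter_eq by (intro continuous_intros) auto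

text \<open>Right endpoints give a lower sum. The start \<open>v0\<close> is free because the
  fractions occurring on outer diagonals are odd multiples of \<open>1 / p\<close>, so their grid
  starts at \<open>1 / p\<close> instead of 0.\<close>

lemma antimono_riemann_sum_le:
  fixes f :: "real \<Rightarrow> real"
  assumes cont: "continuous_on {0..1} f" and nonneg: "\<And>x. x \<in> {0..1} \<Longrightarrow> f x \<ge> 0"
    and anti: "\<And>x y. 0 \<le> x \<Longrightarrow> x \<le> y \<Longrightarrow> y \<le> 1 \<Longrightarrow> f y \<le> f x"
    and d: "d > 0" "v0 \<ge> 0" "v0 + real K * d \<le> 1"
  shows "(\<Sum>i=1..K. f (v0 + real i * d)) * d \<le> integral {0..1} f"
proof -
  have int: "f integrable_on {a..b}" if "0 \<le> a" "b \<le> 1" for a b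
    using that by (intro integrable_continuous_real continuous_on_subset[OF cont]) auto
  have "(\<Sum>i=1..K. f (v0 + real i * d)) * d \<le> integral {v0..v0 + real K * d} f" using d(3)
  proof (induction K)
    case (Suc K)
    define a b where "a = v0 + real K * d" and "b = v0 + real (Suc K) * d"
    have ab: "v0 \<le> a" "a \<le> b" "b \<le> 1" "b - a = d" "0 \<le> a" using d Suc.prems by (auto simp: a_def b_def algebra_simps)
    have "f b * (b - a) \<le> integral {a..b} f"
    proof -
      have "integral {a..b} (\<lambda>x. f b) \<le> integral {a..b} f"
        using ab by (intro integral_le int anti) auto
      then show ?thesis using ab by (simp add: mult.commute)
    qed
    moreover have "integral {v0..a} f + integral {a..b} f = integral {v0..b} f"
      using ab d by (intro Henstock_Kurzweil_Integration.integral_combine int) auto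
    moreover have "(\<Sum>i=1..K. f (v0 + real i * d)) * d \<le> integral {v0..a} f"
      unfolding a_def using Suc.IH ab by (simp add: a_def)
    ultimately show ?case using ab(4) by (simp add: a_def b_def algebra_simps)
  qed simp
  also have "\<dots> \<le> integral {0..1} f"
    using d nonneg by (intro integral_subset_le int) (auto intro: order_trans)
  finally show ?thesis .
qed

section \<open>Selecting parameters by conditional expectation\<close>

lemma slow_truncated_diff: "slow (\<lambda>s. real (s - k))"
  by (auto simp: slow_def)

text \<open>The value \<open>g (s + N m)\<close> is at most \<open>g s\<close> plus one increment if
  there is a hit and a second one if there are \<open>e + 1\<close> points. Both increments are
  nonnegative, so upper bounds on two counts suffice; fewer than \<open>e\<close> points on a hit
  only help.\<close>

lemma hit_average_bound:
  fixes N :: "'a \<Rightarrow> nat"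
  assumes A: "finite A" and g: "slow g" and N: "\<And>m. m \<in> A \<Longrightarrow> N m \<le> e + 1"
    and c1: "real (card {m\<in>A. N m \<ge> 1}) \<le> (1 / 2 + \<eta>) * real (card A)"
    and c2: "real (card {m\<in>A. N m \<ge> e + 1}) \<le> ((1 - v) / 2 + \<eta>) * real (card A)" and eta: "\<eta> \<ge> 0"
  shows "(\<Sum>m\<in>A. g (s + N m)) \<le> real (card A) * (avg_step e v g s + (real e + 1) * \<eta>)"
proof -
  define a where "a = real (card A)"
  have a: "a \<ge> 0" by (simp add: a_def)
  define d1 d2 where "d1 = g (s + e) - g s" and "d2 = g (s + e + 1) - g (s + e)"
  have d: "0 \<le> d1" "d1 \<le> real e" "0 \<le> d2" "d2 \<le> 1"
    using slowD[OF g, of s e] slowD[OF g, of "s + e" 1] by (auto simp: d1_def d2_def)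
  have "(\<Sum>m\<in>A. g (s + N m)) \<le> (\<Sum>m\<in>A. g s + (if N m \<ge> 1 then d1 else 0) + (if N m \<ge> e + 1 then d2 else 0))"
  proof (intro sum_mono)
    fix m assume m: "m \<in> A"
    consider "N m = 0" | "1 \<le> N m" "N m \<le> e" | "N m = e + 1" using N[OF m] by linarith
    then show "g (s + N m) \<le> g s + (if N m \<ge> 1 then d1 else 0) + (if N m \<ge> e + 1 then d2 else 0)"
    proof cases
      case 2
      have "g (s + N m) \<le> g (s + N m + (e - N m))" by (rule slowD(1)[OF g])
      then show ?thesis using 2 by (simp add: d1_def)
    next
      case 3 then show ?thesis by (simp add: d1_def d2_def add.assoc)
    qed simp
  qed
  also have "\<dots> = a * g s + real (card {m\<in>A. N m \<ge> 1}) * d1 + real (card {m\<in>A. N m \<ge> e + 1}) * d2"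
    using A by (simp add: sum.distrib a_def flip: sum.inter_filter)
  also have "\<dots> \<le> a * g s + ((1 / 2 + \<eta>) * a) * d1 + (((1 - v) / 2 + \<eta>) * a) * d2"
    using c1 c2 d unfolding a_def by (intro add_mono[OF add_mono[OF order_refl]] mult_right_mono) auto
  also have "\<dots> = a * (avg_step e v g s + \<eta> * (d1 + d2))"
    by (simp add: avg_step_def hit_step_def d1_def d2_def field_simps)
  also have "\<dots> \<le> a * (avg_step e v g s + \<eta> * (real e + 1))"
    using d a eta by (intro mult_left_mono add_left_mono) auto
  finally show ?thesis by (simp add: a_def mult.commute)
qed

lemma exists_low_loss_selection:
  fixes N :: "'l \<Rightarrow> 'a \<Rightarrow> nat"
  assumes A: "finite A" "t < card A" and Lam: "finite Lam" and g: "slow g"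
    and v: "\<And>L. L \<in> Lam \<Longrightarrow> 0 \<le> v L \<and> v L \<le> 1"
    and avg: "\<And>L A' g s. L \<in> Lam \<Longrightarrow> A' \<subseteq> A \<Longrightarrow> card A \<le> card A' + t \<Longrightarrow> slow g \<Longrightarrow>
      (\<Sum>m\<in>A'. g (s + N L m)) \<le> real (card A') * (avg_step (e L) (v L) g s + \<eta>)"
  shows "\<exists>M\<subseteq>A. card M = t \<and> (\<Sum>L\<in>Lam. g (\<Sum>m\<in>M. N L m)) \<le> (\<Sum>L\<in>Lam. (avg_step (e L) (v L) ^^ t) g 0) + real t * (real (card Lam) * \<eta>)"
proof -
  have "\<exists>M'. M \<subseteq> M' \<and> M' \<subseteq> A \<and> card M' = card M + r \<and> (\<Sum>L\<in>Lam. g (\<Sum>m\<in>M'. N L m)) \<le> 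
      (\<Sum>L\<in>Lam. (avg_step (e L) (v L) ^^ r) g (\<Sum>m\<in>M. N L m)) + real r * (real (card Lam) * \<eta>)"
    if "M \<subseteq> A" "card M + r \<le> t" for M r
    using that
  proof (induction r arbitrary: M)
    case (Suc r)
    define A' where "A' = A - M"
    have finM: "finite M" using Suc.prems A finite_subset by blast
    have cA': "card A \<le> card A' + t" "card A' > 0"
      using Suc.prems A finM by (auto simp: A'_def card_Diff_subset)
    define \<Phi> where "\<Phi> = (\<lambda>m. \<Sum>L\<in>Lam. (avg_step (e L) (v L) ^^ r) g ((\<Sum>m\<in>M. N L m) + N L m))"
    define B where "B = (\<Sum>L\<in>Lam. (avg_step (e L) (v L) ^^ Suc r) g (\<Sum>m\<in>M. N L m)) + real (card Lam) * \<eta>"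
    have "(\<Sum>m\<in>A'. \<Phi> m) = (\<Sum>L\<in>Lam. \<Sum>m\<in>A'. (avg_step (e L) (v L) ^^ r) g ((\<Sum>m\<in>M. N L m) + N L m))"
      unfolding \<Phi>_def by (rule sum.swap)
    also have "\<dots> \<le> (\<Sum>L\<in>Lam. real (card A') * (avg_step (e L) (v L) ((avg_step (e L) (v L) ^^ r) g) (\<Sum>m\<in>M. N L m) + \<eta>))"
      using v cA' by (intro sum_mono avg slow_avg_iter g) (auto simp: A'_def)
    also have "\<dots> = real (card A') * B"
      by (simp add: B_def sum.distrib flip: sum_distrib_left)
    finally have le: "(\<Sum>m\<in>A'. \<Phi> m) \<le> real (card A') * B" .
    have "\<exists>m\<in>A'. \<Phi> m \<le> B"
    proof (rule ccontr)
      assume "\<not> ?thesis"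
      then have "(\<Sum>m\<in>A'. B) < (\<Sum>m\<in>A'. \<Phi> m)"
        using cA' A by (intro sum_strict_mono) (auto simp: not_le A'_def card_gt_0_iff)
      then show False using le by simp
    qed
    then obtain m where m: "m \<in> A" "m \<notin> M" "\<Phi> m \<le> B" by (auto simp: A'_def)
    obtain M' where M': "insert m M \<subseteq> M'" "M' \<subseteq> A" "card M' = card (insert m M) + r"
      "(\<Sum>L\<in>Lam. g (\<Sum>m\<in>M'. N L m)) \<le> (\<Sum>L\<in>Lam. (avg_step (e L) (v L) ^^ r) g (\<Sum>m\<in>insert m M. N L m)) + real r * (real (card Lam) * \<eta>)"
      using Suc.IH[of "insert m M"] Suc.prems m finM by auto
    have "(\<Sum>L\<in>Lam. (avg_step (e L) (v L) ^^ r) g (\<Sum>m\<in>insert m M. N L m)) = \<Phi> m"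
      unfolding \<Phi>_def using m finM by (simp add: add.commute)
    then have "(\<Sum>L\<in>Lam. g (\<Sum>m\<in>M'. N L m)) \<le> (\<Sum>L\<in>Lam. (avg_step (e L) (v L) ^^ Suc r) g (\<Sum>m\<in>M. N L m)) + real (Suc r) * (real (card Lam) * \<eta>)"
      using M'(4) m(3) by (simp add: B_def algebra_simps)
    then show ?case using M'(1-3) m finM by (intro exI[of _ M']) auto
  qed auto
  from this[of "{}" t] show ?thesis by auto
qed

section \<open>A hyperbola on a diagonal\<close>

text \<open>The \<open>x\<close>-coordinates of the points of \<open>(x - a) (y - b) \<equiv> m\<close> on the line \<open>y = x + c\<close> in the grid.\<close>

definition line_hits :: "int \<Rightarrow> int \<Rightarrow> int \<Rightarrow> int \<Rightarrow> int \<Rightarrow> int set" where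
  "line_hits p a b c m = {x \<in> {1..2 * p - c}. p dvd (x - a) * (x + c - b) - m}"

definition line_residues :: "int \<Rightarrow> int \<Rightarrow> int \<Rightarrow> int \<Rightarrow> int \<Rightarrow> int set" where
  "line_residues p a b c m = {x \<in> {1..p}. p dvd (x - a) * (x + c - b) - m}"

lemma eq_if_cong_int:
  fixes x y p :: int
  assumes "p dvd x - y" "\<bar>x - y\<bar> < p"
  shows "x = y"
  using assms zdvd_not_zless[of "x - y" p] zdvd_not_zless[of "y - x" p] by (cases x y rule: linorder_cases) (auto simp: dvd_diff_commute)

text \<open>Every root in \<open>{1..p}\<close> gives a point, and its translate by \<open>p\<close>
  stays in the grid exactly when the root is at most \<open>p - c\<close>.\<close>

lemma line_hits_eq:
  assumes "0 \<le> c" "c < p"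
  shows "line_hits p a b c m = line_residues p a b c m \<union> (\<lambda>r. r + p) ` (line_residues p a b c m \<inter> {1..p - c})"
proof -
  have shift: "p dvd (x - p - a) * (x - p + c - b) - m \<longleftrightarrow> p dvd (x - a) * (x + c - b) - m" for x
  proof -
    have "(x - a) * (x + c - b) - m = ((x - p - a) * (x - p + c - b) - m) + p * (2 * x + c - a - b - p)"
      by (simp add: algebra_simps)
    then show ?thesis by (metis dvd_add_left_iff dvd_triv_left)
  qed
  show ?thesis
  proof (intro equalityI subsetI)
    fix x assume "x \<in> line_hits p a b c m"
    then have x: "1 \<le> x" "x \<le> 2 * p - c" "p dvd (x - a) * (x + c - b) - m" by (auto simp: line_hits_def)
    show "x \<in> line_residues p a b c m \<union> (\<lambda>r. r + p) ` (line_residues p a b c m \<inter> {1..p - c})"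
    proof (cases "x \<le> p")
      case True then show ?thesis using x by (simp add: line_residues_def)
    next
      case False
      then have "x - p \<in> line_residues p a b c m \<inter> {1..p - c}"
        using x shift[of x] assms by (auto simp: line_residues_def)
      then have "x - p + p \<in> (\<lambda>r. r + p) ` (line_residues p a b c m \<inter> {1..p - c})" by (rule imageI)
      then show ?thesis by simp
    qed
  next
    fix x assume "x \<in> line_residues p a b c m \<union> (\<lambda>r. r + p) ` (line_residues p a b c m \<inter> {1..p - c})"
    then show "x \<in> line_hits p a b c m"
      using assms shift[of x] by (auto simp: line_residues_def line_hits_def)
  qed
qed

lemma finite_line_residues [simp]: "finite (line_residues p a b c m)"
  by (rule finite_subset[of _ "{1..p}"]) (auto simp: line_residues_def)

lemma card_line_hits_le:
  assumes "0 \<le> c" "c < p"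
  shows "card (line_hits p a b c m) \<le> card (line_residues p a b c m) + card (line_residues p a b c m \<inter> {1..p - c})"
  unfolding line_hits_eq[OF assms]
  by (rule order_trans[OF card_Un_le]) (auto intro: card_image_le)

context
  fixes p h a b :: int
  assumes prime: "prime p" and p: "p = 2 * h + 1" and ab: "p dvd a + b - (h + 1)"
begin

lemma half_pos: "h \<ge> 1"
  using prime_ge_2_int[OF prime] p by simp

lemma dvd_double: "p dvd 2 * z \<Longrightarrow> p dvd z"
  using prime_dvd_mult_int[OF prime, of 2 z] zdvd_imp_le[of p 2] half_pos p by auto

text \<open>The congruence is quadratic in \<open>x\<close> with sum of roots
  \<open>a + b - c\<close>, which is \<open>h + 1 - c\<close> modulo \<open>p\<close>; two different
  roots are therefore exchanged by this reflection.\<close>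

lemma residues_cong:
  assumes "x \<in> line_residues p a b c m" "y \<in> line_residues p a b c m"
  shows "x = y \<or> p dvd x + y - (h + 1 - c)"
proof -
  have "p dvd ((x - a) * (x + c - b) - m) - ((y - a) * (y + c - b) - m)"
    by (rule dvd_diff) (use assms in \<open>auto simp: line_residues_def\<close>)
  also have "\<dots> = (x - y) * (x + y + c - a - b)" by (simp add: algebra_simps)
  finally consider "p dvd x - y" | "p dvd x + y + c - a - b"
    using prime_dvd_mult_int[OF prime] by blast
  then show ?thesis
  proof cases
    case 1
    then have "x = y" using assms by (intro eq_if_cong_int[OF 1]) (auto simp: line_residues_def)
    then show ?thesis ..
  next
    case 2
    then have "p dvd (x + y + c - a - b) + (a + b - (h + 1))" using ab by (rule dvd_add)
    then show ?thesis by (simp add: algebra_simps)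
  qed
qed

lemma residues_third:
  assumes "x \<in> line_residues p a b c m" "y \<in> line_residues p a b c m" "z \<in> line_residues p a b c m" "x \<noteq> y" "x \<noteq> z"
  shows "y = z"
proof -
  have "p dvd (x + y - (h + 1 - c)) - (x + z - (h + 1 - c))"
    by (rule dvd_diff) (use residues_cong[OF assms(1,2)] residues_cong[OF assms(1,3)] assms(4,5) in auto)
  then have "p dvd y - z" by simp
  then show ?thesis using assms by (intro eq_if_cong_int) (auto simp: line_residues_def)
qed

lemma card_line_residues_le: "card (line_residues p a b c m) \<le> 2"
proof (rule ccontr)
  assume "\<not> ?thesis"
  then obtain T where "T \<subseteq> line_residues p a b c m" "card T = 3"
    using obtain_subset_with_card_n[of 3 "line_residues p a b c m"] by auto
  then obtain x y z where "x \<in> line_residues p a b c m" "y \<in> line_residues p a b c m" "z \<in> line_residues p a b c m" "x \<noteq> y" "x \<noteq> z" "y \<noteq> z"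
    by (auto simp: card_3_iff)
  then show False using residues_third by blast
qed

lemma card_line_hits_le_4: "0 \<le> c \<Longrightarrow> c < p \<Longrightarrow> card (line_hits p a b c m) \<le> 4"
  using card_line_hits_le[of c p a b m] card_line_residues_le[of c m] card_mono[of "line_residues p a b c m" "line_residues p a b c m \<inter> {1..p - c}"]
  by simp

text \<open>Completing the square shows that \<open>m\<close> depends only on the square of
  \<open>2 * r - s\<close> modulo \<open>p\<close>, for any root \<open>r\<close>. Up to sign this
  residue has a representative in \<open>{0..h}\<close>, which leaves \<open>h + 1\<close> possible
  parameters.\<close>

lemma card_hit_params_le:
  assumes c: "0 \<le> c" "c < p"
  shows "card {m \<in> {1..p - 1}. card (line_hits p a b c m) \<ge> 1} \<le> nat (h + 1)"
proof -
  define B where "B = {m \<in> {1..p - 1}. card (line_hits p a b c m) \<ge> 1}"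
  define s where "s = h + 1 - c"
  have "\<exists>d r. d \<in> {0..h} \<and> r \<in> line_residues p a b c m \<and> (p dvd (2 * r - s) - d \<or> p dvd (2 * r - s) + d)" if "m \<in> B" for m
  proof -
    have "line_residues p a b c m \<noteq> {}"
      using that card_line_hits_le[OF c, of a b m] by (auto simp: B_def)
    then obtain r where r: "r \<in> line_residues p a b c m" by blast
    define z where "z = (2 * r - s) mod p"
    have z: "0 \<le> z" "z < p" "p dvd (2 * r - s) - z"
      using half_pos p pos_mod_bound[of p "2 * r - s"] pos_mod_sign[of p "2 * r - s"]
      by (simp_all only: z_def dvd_minus_mod)
    show ?thesis
    proof (cases "z \<le> h")
      case True then show ?thesis using z r by (intro exI[of _ z] exI[of _ r]) auto
    next
      case False
      have "p dvd ((2 * r - s) - z) + p" using z(3) by simp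
      then have "p dvd (2 * r - s) + (p - z)" by (simp add: algebra_simps)
      then show ?thesis using z r False p by (intro exI[of _ "p - z"] exI[of _ r]) auto
    qed
  qed
  then obtain D R where DR: "\<And>m. m \<in> B \<Longrightarrow> D m \<in> {0..h}" "\<And>m. m \<in> B \<Longrightarrow> R m \<in> line_residues p a b c m"
    "\<And>m. m \<in> B \<Longrightarrow> p dvd (2 * R m - s) - D m \<or> p dvd (2 * R m - s) + D m" by metis
  have "inj_on D B"
  proof (rule inj_onI)
    fix m m' assume m: "m \<in> B" "m' \<in> B" "D m = D m'"
    define d where "d = D m"
    have "p dvd 2 * (R m - R m') \<or> p dvd 2 * (R m + R m' - s)"
    proof -
      have e: "2 * (R m - R m') = (2 * R m - s - d) - (2 * R m' - s - d)" 
        "2 * (R m - R m') = (2 * R m - s + d) - (2 * R m' - s + d)"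
        "2 * (R m + R m' - s) = (2 * R m - s - d) + (2 * R m' - s + d)"
        "2 * (R m + R m' - s) = (2 * R m - s + d) + (2 * R m' - s - d)" by simp_all
      show ?thesis
        using DR(3)[OF m(1)] DR(3)[OF m(2)] m(3) unfolding d_def[symmetric]
        by (metis e d_def dvd_add dvd_diff)
    qed
    then have "p dvd R m - R m' \<or> p dvd R m + R m' - s" using dvd_double by blast
    then have "p dvd (R m - R m') * (R m + R m' + c - a - b)"
    proof
      assume "p dvd R m + R m' - s"
      then have "p dvd (R m + R m' - s) - (a + b - (h + 1))" using ab by (rule dvd_diff)
      then have "p dvd R m + R m' + c - a - b" by (simp add: s_def algebra_simps)
      then show ?thesis by (rule dvd_mult)
    qed (rule dvd_mult2)
    moreover have "(R m - R m') * (R m + R m' + c - a - b) = ((R m - a) * (R m + c - b) - m) - ((R m' - a) * (R m' + c - b) - m') + (m - m')"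
      by (simp add: algebra_simps)
    moreover have "p dvd ((R m - a) * (R m + c - b) - m) - ((R m' - a) * (R m' + c - b) - m')"
      by (rule dvd_diff) (use DR(2)[OF m(1)] DR(2)[OF m(2)] in \<open>auto simp: line_residues_def\<close>)
    ultimately have "p dvd m - m'" by (metis dvd_add_right_iff)
    then show "m = m'" using m by (intro eq_if_cong_int) (auto simp: B_def)
  qed
  then have "card B \<le> card {0..h}" using DR(1) by (intro card_inj_on_le[of D]) auto
  then show ?thesis unfolding B_def by simp
qed

text \<open>Three hits on at most two roots require a root that is repeated by its translate, so one
  in \<open>{1..p - c}\<close>; a root determines its parameter.\<close>

lemma card_double_hit_params_le:
  assumes c: "0 \<le> c" "c < p"
  shows "card {m \<in> {1..p - 1}. card (line_hits p a b c m) \<ge> 3} \<le> nat (p - c)"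
proof -
  define B where "B = {m \<in> {1..p - 1}. card (line_hits p a b c m) \<ge> 3}"
  have "\<exists>r. r \<in> line_residues p a b c m \<inter> {1..p - c}" if "m \<in> B" for m
  proof (rule ccontr)
    assume "\<not> ?thesis"
    then have "line_residues p a b c m \<inter> {1..p - c} = {}" by blast
    then have "card (line_hits p a b c m) \<le> 2"
      using card_line_hits_le[OF c, of a b m] card_line_residues_le[of c m] by simp
    then show False using that by (simp add: B_def)
  qed
  then obtain R where R: "\<And>m. m \<in> B \<Longrightarrow> R m \<in> line_residues p a b c m \<inter> {1..p - c}" by metis
  have "inj_on R B"
  proof (rule inj_onI)
    fix m m' assume m: "m \<in> B" "m' \<in> B" "R m = R m'"
    have "p dvd ((R m - a) * (R m + c - b) - m') - ((R m - a) * (R m + c - b) - m)"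
      by (rule dvd_diff) (use R[OF m(1)] R[OF m(2)] m(3) in \<open>auto simp: line_residues_def\<close>)
    then have "p dvd m - m'" by simp
    then show "m = m'" using m by (intro eq_if_cong_int) (auto simp: B_def)
  qed
  then have "card B \<le> card {1..p - c}" using R by (intro card_inj_on_le[of R]) auto
  then show ?thesis unfolding B_def by simp
qed

text \<open>A parameter hits four times only if both roots lie in \<open>{1..p - c}\<close>, which the reflection
  \<open>x \<mapsto> h + 1 - c - x\<close> nearly moves off itself: the offset \<open>h + 1\<close> is half a period.\<close>

lemma four_hits_roots:
  assumes c: "0 \<le> c" "c < p" and m: "card (line_hits p a b c m) \<ge> 4"
  obtains r r' where "r \<noteq> r'" "r \<in> line_residues p a b c m" "r' \<in> line_residues p a b c m"
    "{r, r'} \<subseteq> {1..h - c} \<union> {h + 1..p - c}"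
proof -
  have "card (line_residues p a b c m \<inter> {1..p - c}) \<ge> 2"
    using card_line_hits_le[OF c, of a b m] card_line_residues_le[of c m] m by linarith
  from obtain_subset_with_card_n[OF this]
  obtain T where "T \<subseteq> line_residues p a b c m \<inter> {1..p - c}" "card T = 2" .
  then obtain r r' where r: "r \<noteq> r'" "r \<in> line_residues p a b c m" "r' \<in> line_residues p a b c m" "r \<in> {1..p - c}" "r' \<in> {1..p - c}"
    unfolding card_2_iff by blast
  \<comment> \<open>The range of the roots leaves \<open>k = 0\<close>, where both are at most
    \<open>h - c\<close>, and \<open>k = 1\<close>, where both are at least
    \<open>h + 1\<close>.\<close>
  then obtain k where k: "r + r' - (h + 1 - c) = p * k" using residues_cong[OF r(2,3)] unfolding dvd_def by blast
  have "k \<ge> 0"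
  proof (rule ccontr)
    assume "\<not> ?thesis"
    then have "p * k \<le> p * (-1)" using half_pos p by (intro mult_left_mono) auto
    then show False using k r p c half_pos by auto
  qed
  moreover have "k \<le> 1"
  proof (rule ccontr)
    assume "\<not> ?thesis"
    then have "p * 2 \<le> p * k" using half_pos p by (intro mult_left_mono) auto
    then show False using k r p c half_pos by auto
  qed
  ultimately have "k = 0 \<or> k = 1" by auto
  then have "r \<in> {1..h - c} \<union> {h + 1..p - c}" "r' \<in> {1..h - c} \<union> {h + 1..p - c}" using k r(4,5) p by auto
  then show ?thesis using that[OF r(1-3)] by simp
qed

lemma card_line_hits_le_3:
  assumes "h < c" "c < p"
  shows "card (line_hits p a b c m) \<le> 3"
proof (rule ccontr)
  assume "\<not> ?thesis"
  then have "card (line_hits p a b c m) \<ge> 4" "0 \<le> c" using assms half_pos by auto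
  then obtain r r' where "{r, r'} \<subseteq> {1..h - c} \<union> {h + 1..p - c}" using four_hits_roots[of c m] assms by metis
  then show False using assms p by auto
qed

text \<open>Each such parameter occupies two elements of \<open>W\<close>, different parameters
  occupy disjoint pairs, and \<open>W\<close> has \<open>p - 2 * c\<close> elements.\<close>

lemma card_four_hit_params_le:
  assumes c: "0 \<le> c" "c \<le> h"
  shows "2 * card {m \<in> {1..p - 1}. card (line_hits p a b c m) \<ge> 4} \<le> nat (p - 2 * c)"
proof -
  define B where "B = {m \<in> {1..p - 1}. card (line_hits p a b c m) \<ge> 4}"
  define W where "W = {1..h - c} \<union> {h + 1..p - c}"
  have cp: "0 \<le> c" "c < p" using c p half_pos by auto
  define F where "F = (\<lambda>m. line_residues p a b c m \<inter> W)"
  have F2: "2 \<le> card (F m)" if mB: "m \<in> B" for m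
  proof -
    obtain r r' where r: "r \<noteq> r'" "r \<in> line_residues p a b c m" "r' \<in> line_residues p a b c m" "{r, r'} \<subseteq> W"
      using four_hits_roots[OF cp, of m] mB unfolding B_def W_def by auto
    then have "card {r, r'} \<le> card (F m)" by (intro card_mono) (auto simp: F_def)
    then show ?thesis using r(1) by simp
  qed
  have finB: "finite B" by (rule finite_subset[of _ "{1..p - 1}"]) (auto simp: B_def)
  have "2 * card B = (\<Sum>m\<in>B. 2)" by simp
  also have "\<dots> \<le> (\<Sum>m\<in>B. card (F m))" using F2 by (intro sum_mono)
  also have "\<dots> = card (\<Union>m\<in>B. F m)"
  proof (rule card_UN_disjoint[symmetric])
    show "\<forall>m\<in>B. \<forall>m'\<in>B. m \<noteq> m' \<longrightarrow> F m \<inter> F m' = {}"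
    proof (intro ballI impI equals0I)
      fix m m' r assume m: "m \<in> B" "m' \<in> B" "m \<noteq> m'" "r \<in> F m \<inter> F m'"
      then have "p dvd ((r - a) * (r + c - b) - m') - ((r - a) * (r + c - b) - m)"
        by (intro dvd_diff[of p "(r - a) * (r + c - b) - m'" "(r - a) * (r + c - b) - m"]) (auto simp: F_def line_residues_def)
      then have "p dvd m - m'" by simp
      then have "m = m'" using m(1,2) by (intro eq_if_cong_int) (auto simp: B_def)
      then show False using m(3) by simp
    qed
  qed (auto simp: finB F_def)
  also have "\<dots> \<le> card W" by (intro card_mono) (auto simp: F_def W_def)
  also have "\<dots> \<le> card {1..h - c} + card {h + 1..p - c}" unfolding W_def by (rule card_Un_le)
  also have "\<dots> = nat (p - 2 * c)" using c p by simp
  finally show ?thesis by (simp add: B_def)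
qed

end

section \<open>The point set\<close>

definition hyperbola :: "int \<Rightarrow> int \<Rightarrow> int \<Rightarrow> (int \<times> int) set" where
  "hyperbola p h m = {(x, y). x \<in> {1..2 * p} \<and> y \<in> {1..2 * p} \<and> p dvd (x - (h + 1)) * y - m}"

text \<open>The first component selects the slope 1 or -1. The constant \<open>2 * p + 1\<close>
  makes offset 0 the main antidiagonal, so in both families the absolute value of the second
  component measures the distance from the centre.\<close>

definition diagonal :: "int \<Rightarrow> bool \<times> int \<Rightarrow> (int \<times> int) set" where
  "diagonal p L = {(x, y). y = (if fst L then x else 2 * p + 1 - x) + snd L}"

definition diag_width :: "int \<Rightarrow> bool \<times> int \<Rightarrow> nat" where
  "diag_width h L = (if \<bar>snd L\<bar> \<le> h then 3 else 2)"

text \<open>The fractional part of \<open>2 * \<bar>snd L\<bar> / p\<close>. It plays the role of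
  \<open>v\<close>: given a hit, the share of parameters with the smaller number of points.\<close>

definition diag_frac :: "int \<Rightarrow> int \<Rightarrow> bool \<times> int \<Rightarrow> real" where
  "diag_frac p h L = 2 * real_of_int \<bar>snd L\<bar> / real_of_int p - (if \<bar>snd L\<bar> \<le> h then 0 else 1)"

lemma finite_hyperbola [simp]: "finite (hyperbola p h m)"
  by (rule finite_subset[of _ "{1..2 * p} \<times> {1..2 * p}"]) (auto simp: hyperbola_def)

text \<open>Deleting points on one diagonal only lowers the counts on the others, so treating them
  one after another costs at most the sum of the original excesses.\<close>

lemma exists_excess_removal:
  fixes D :: "'l \<Rightarrow> 'a set"
  assumes "finite Lam" "finite S0"
  shows "\<exists>S\<subseteq>S0. (\<forall>L\<in>Lam. card (S \<inter> D L) \<le> k) \<and> card S0 \<le> card S + (\<Sum>L\<in>Lam. card (S0 \<inter> D L) - k)"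
  using assms(1)
proof induction
  case (insert L Lam)
  from insert.IH obtain S where S: "S \<subseteq> S0" "\<forall>L\<in>Lam. card (S \<inter> D L) \<le> k" "card S0 \<le> card S + (\<Sum>L\<in>Lam. card (S0 \<inter> D L) - k)"
    by (elim exE conjE)
  have finS: "finite S" using S(1) assms(2) finite_subset by blast
  have "card (S \<inter> D L) - k \<le> card (S \<inter> D L)" by simp
  from obtain_subset_with_card_n[OF this]
  obtain R where R: "R \<subseteq> S \<inter> D L" "card R = card (S \<inter> D L) - k" .
  have finR: "finite R" using R(1) finS finite_subset by blast
  have "card ((S - R) \<inter> D L') \<le> k" if "L' \<in> insert L Lam" for L'
  proof (cases "L' = L")
    case True
    have "(S - R) \<inter> D L = (S \<inter> D L) - R" by blast
    then show ?thesis using True R finR by (simp add: card_Diff_subset)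
  next
    case False
    then have "card (S \<inter> D L') \<le> k" using that S(2) by auto
    then show ?thesis using card_mono[of "S \<inter> D L'" "(S - R) \<inter> D L'"] finS by fastforce
  qed
  moreover have "card S = card (S - R) + card R"
    using R finR finS card_mono[of S R] by (subst card_Diff_subset) auto
  moreover have "card (S \<inter> D L) \<le> card (S0 \<inter> D L)" using S(1) assms(2) by (intro card_mono) auto
  ultimately show ?case using S(1,3) R(2) insert.hyps
    by (intro exI[of _ "S - R"]) auto
qed (use assms in auto)

lemma card_le_2_if_cong:
  fixes T :: "int set"
  assumes "T \<subseteq> {1..2 * p}" "\<And>x y. x \<in> T \<Longrightarrow> y \<in> T \<Longrightarrow> p dvd x - y" "p > 0"
  shows "card T \<le> 2"
proof (rule ccontr)
  assume "\<not> ?thesis"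
  then have "3 \<le> card T" by simp
  from obtain_subset_with_card_n[OF this] obtain U where U: "U \<subseteq> T" "card U = 3" .
  then obtain x y z where xyz: "x \<in> T" "y \<in> T" "z \<in> T" "x \<noteq> y" "x \<noteq> z" "y \<noteq> z"
    unfolding card_3_iff by blast
  have d: "u - w = p \<or> w - u = p" if uw: "u \<in> T" "w \<in> T" "u \<noteq> w" for u w
  proof -
    obtain q where q: "u - w = p * q" using assms(2)[OF uw(1,2)] unfolding dvd_def by blast
    have "u \<in> {1..2 * p}" "w \<in> {1..2 * p}" using uw(1,2) assms(1) by auto
    then have "\<bar>u - w\<bar> < 2 * p" by (simp only: atLeastAtMost_iff) linarith
    then have "p * \<bar>q\<bar> < p * 2" using assms(3) unfolding q by (simp add: abs_mult)
    then have "\<bar>q\<bar> < 2" using assms(3) by simp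
    moreover have "q \<noteq> 0" using q uw(3) by auto
    ultimately have "q = 1 \<or> q = -1" by auto
    then show ?thesis using q by auto
  qed
  show False using d[of x y] d[of x z] d[of y z] xyz assms(3) by auto
qed

lemma parallel_lattice_shift:
  fixes p u w d1 d2 :: int
  assumes "p > 0" and u: "u = 0 \<or> u = p \<or> u = - p" and w: "w = 0 \<or> w = p \<or> w = - p"
    and "u * d2 = w * d1" "d1 \<noteq> 0" "d2 \<noteq> 0" "d2 \<noteq> d1" "d2 \<noteq> - d1"
  shows "u = 0 \<and> w = 0"
proof -
  obtain a where a: "u = p * a" "a = 0 \<or> a = 1 \<or> a = -1" using u by (metis mult_zero_right mult.right_neutral mult_minus_right)
  obtain b where b: "w = p * b" "b = 0 \<or> b = 1 \<or> b = -1" using w by (metis mult_zero_right mult.right_neutral mult_minus_right)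
  have "p * (a * d2) = p * (b * d1)" using assms(4) by (simp add: a(1) b(1) mult.assoc)
  then have "a * d2 = b * d1" using assms(1) by simp
  then have "a = 0 \<and> b = 0" using a(2) b(2) assms(5-8) by (elim disjE) auto
  then show ?thesis by (simp add: a b)
qed

context
  fixes p h :: int
  assumes prime: "prime p" and p: "p = 2 * h + 1"
begin

lemma p_gt_2: "p > 2" and h_pos: "h \<ge> 1"
  using prime_ge_2_int[OF prime] p by auto

text \<open>Offsets of negative sign are handled by using \<open>y\<close> instead of
  \<open>x\<close> as parameter. On lines of slope -1 the reflection of \<open>x\<close> reverses
  the sign of the product, which turns \<open>m\<close> into \<open>p - m\<close> and the centre
  \<open>h + 1\<close> into \<open>2 * p - h\<close>, again \<open>h + 1\<close> modulo
  \<open>p\<close>. That \<open>a\<close> and \<open>b\<close> do not depend on \<open>m\<close> is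
  what permits counting over \<open>m\<close>.\<close>

lemma diagonal_hits:
  assumes c: "\<bar>snd L\<bar> < p"
  shows "\<exists>a b. p dvd a + b - (h + 1) \<and> 
     ((\<forall>m. card (hyperbola p h m \<inter> diagonal p L) = card (line_hits p a b \<bar>snd L\<bar> m)) \<or>
      (\<forall>m. card (hyperbola p h m \<inter> diagonal p L) = card (line_hits p a b \<bar>snd L\<bar> (p - m))))"
proof -
  obtain u c where L: "L = (u, c)" by (cases L) auto
  have flip: "p dvd - z - m \<longleftrightarrow> p dvd z - (p - m)" for z m
  proof -
    have "- z - m = - (z - (p - m)) - p" by simp
    then show ?thesis by (metis dvd_add_left_iff dvd_minus_iff dvd_refl minus_diff_eq diff_conv_add_uminus)
  qed
  have "p dvd 2 * p - h - (h + 1)" using p by simp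
  then have ab: "p dvd (2 * p - h) + 0 - (h + 1)" "p dvd 0 + (2 * p - h) - (h + 1)" by simp_all
  consider "u" "c \<ge> 0" | "u" "c < 0" | "\<not> u" "c \<ge> 0" | "\<not> u" "c < 0" by linarith
  then show ?thesis
  proof cases
    case 1
    have "hyperbola p h m \<inter> diagonal p L = (\<lambda>x. (x, x + c)) ` line_hits p (h + 1) 0 c m" for m
      using 1 c by (auto simp: hyperbola_def diagonal_def line_hits_def L)
    then have "\<forall>m. card (hyperbola p h m \<inter> diagonal p L) = card (line_hits p (h + 1) 0 \<bar>snd L\<bar> m)"
      using 1 by (auto simp: L card_image inj_on_def)
    then show ?thesis by (intro exI[of _ "h + 1"] exI[of _ 0]) auto
  next
    case 2
    have "hyperbola p h m \<inter> diagonal p L = (\<lambda>y. (y - c, y)) ` line_hits p 0 (h + 1) (- c) m" for m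
      using 2 c by (auto simp: hyperbola_def diagonal_def line_hits_def L image_iff algebra_simps)
    then have "\<forall>m. card (hyperbola p h m \<inter> diagonal p L) = card (line_hits p 0 (h + 1) \<bar>snd L\<bar> m)"
      using 2 by (auto simp: L card_image inj_on_def)
    then show ?thesis by (intro exI[of _ 0] exI[of _ "h + 1"]) auto
  next
    case 3
    have "hyperbola p h m \<inter> diagonal p L = (\<lambda>x. (2 * p + 1 - x, x + c)) ` line_hits p (2 * p - h) 0 c (p - m)" for m
    proof -
      have eq: "p dvd (x - (h + 1)) * y - m \<longleftrightarrow> p dvd (2 * p + 1 - x - (2 * p - h)) * y - (p - m)" for x y
        using flip[of "(2 * p + 1 - x - (2 * p - h)) * y" m] by (simp add: algebra_simps)
      have eq2: "h + (x - 2 * p) = x - (2 * p - h)" for x by simp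
      show ?thesis
        using 3 c by (auto simp: hyperbola_def diagonal_def line_hits_def L image_iff eq eq2)
    qed
    then have "\<forall>m. card (hyperbola p h m \<inter> diagonal p L) = card (line_hits p (2 * p - h) 0 \<bar>snd L\<bar> (p - m))"
      using 3 by (auto simp: L card_image inj_on_def)
    then show ?thesis using ab by (intro exI[of _ "2 * p - h"] exI[of _ 0]) auto
  next
    case 4
    have "hyperbola p h m \<inter> diagonal p L = (\<lambda>y. (2 * p + 1 - y + c, y)) ` line_hits p 0 (2 * p - h) (- c) (p - m)" for m
    proof -
      have eq: "p dvd (x - (h + 1)) * y - m \<longleftrightarrow> p dvd y * (2 * p + 1 - x - (2 * p - h)) - (p - m)" for x y
        using flip[of "(2 * p + 1 - x - (2 * p - h)) * y" m] by (simp add: algebra_simps)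
      have eq2: "h + (x - c - 2 * p) = x - c - (2 * p - h)" for x by simp
      show ?thesis
        using 4 c by (auto simp: hyperbola_def diagonal_def line_hits_def L image_iff eq eq2)
    qed
    then have "\<forall>m. card (hyperbola p h m \<inter> diagonal p L) = card (line_hits p 0 (2 * p - h) \<bar>snd L\<bar> (p - m))"
      using 4 by (auto simp: L card_image inj_on_def)
    then show ?thesis using ab by (intro exI[of _ 0] exI[of _ "2 * p - h"]) auto
  qed
qed

lemma diagonal_profile:
  assumes c: "\<bar>snd L\<bar> < p"
  defines "N \<equiv> \<lambda>m. card (hyperbola p h m \<inter> diagonal p L)"
  shows "N m \<le> diag_width h L + 1"
    and "card {m \<in> {1..p - 1}. N m \<ge> 1} \<le> nat (h + 1)"
    and "real (card {m \<in> {1..p - 1}. N m \<ge> diag_width h L + 1}) \<le> (1 - diag_frac p h L) / 2 * real_of_int p"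
proof -
  define c' where "c' = \<bar>snd L\<bar>"
  have c': "0 \<le> c'" "c' < p" using c by (auto simp: c'_def)
  obtain a b where ab: "p dvd a + b - (h + 1)" and
    hits: "(\<forall>m. N m = card (line_hits p a b c' m)) \<or> (\<forall>m. N m = card (line_hits p a b c' (p - m)))"
    using diagonal_hits[OF c] unfolding N_def c'_def by blast
  define l where "l = (\<lambda>m. card (line_hits p a b c' m))"
  \<comment> \<open>Replacing \<open>m\<close> by \<open>p - m\<close> permutes
    \<open>{1..p - 1}\<close>, so the counts agree in both cases.\<close>
  have cardeq: "card {m \<in> {1..p - 1}. N m \<ge> j} = card {m \<in> {1..p - 1}. l m \<ge> j}" for j
    using hits
  proof
    assume N: "\<forall>m. N m = card (line_hits p a b c' (p - m))"
    have "{m \<in> {1..p - 1}. N m \<ge> j} = (\<lambda>m. p - m) ` {m \<in> {1..p - 1}. l m \<ge> j}"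
      by (auto simp: N l_def image_iff) (metis diff_diff_eq2 add_diff_cancel_left' diff_ge_0_iff_ge diff_gt_0_iff_gt zle_diff1_eq add.commute le_diff_eq int_one_le_iff_zero_less)
    then show ?thesis by (simp add: card_image inj_on_def)
  qed (simp add: l_def)
  have Nl: "\<exists>m'. N m = l m'" for m using hits by (auto simp: l_def)
  note lems = card_line_hits_le_4[OF prime p ab] card_line_hits_le_3[OF prime p ab]
    card_hit_params_le[OF prime p ab] card_double_hit_params_le[OF prime p ab] card_four_hit_params_le[OF prime p ab]
  show "N m \<le> diag_width h L + 1"
    using Nl[of m] lems(1)[of c'] lems(2)[of c'] c' by (auto simp: diag_width_def l_def c'_def[symmetric] not_le)
  show "card {m \<in> {1..p - 1}. N m \<ge> 1} \<le> nat (h + 1)"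
    unfolding cardeq l_def by (rule lems(3)[OF c'])
  have pr: "real_of_int p > 0" using p_gt_2 by simp
  show "real (card {m \<in> {1..p - 1}. N m \<ge> diag_width h L + 1}) \<le> (1 - diag_frac p h L) / 2 * real_of_int p"
  proof (cases "c' \<le> h")
    case True
    have "2 * card {m \<in> {1..p - 1}. l m \<ge> 4} \<le> nat (p - 2 * c')"
      unfolding l_def by (rule lems(5)[OF c'(1) True])
    then have "int (2 * card {m \<in> {1..p - 1}. l m \<ge> 4}) \<le> p - 2 * c'" using True p by linarith
    then have "real_of_int (int (2 * card {m \<in> {1..p - 1}. l m \<ge> 4})) \<le> real_of_int (p - 2 * c')" by (simp only: of_int_le_iff)
    moreover have "(1 - 2 * real_of_int c' / real_of_int p) / 2 * real_of_int p = (real_of_int p - 2 * real_of_int c') / 2"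
      using pr by (simp add: field_simps)
    ultimately show ?thesis
      using True unfolding diag_width_def diag_frac_def c'_def[symmetric] cardeq by simp
  next
    case False
    have "card {m \<in> {1..p - 1}. l m \<ge> 3} \<le> nat (p - c')"
      unfolding l_def by (rule lems(4)[OF c'])
    then have "int (card {m \<in> {1..p - 1}. l m \<ge> 3}) \<le> p - c'" using c' by linarith
    then have "real_of_int (int (card {m \<in> {1..p - 1}. l m \<ge> 3})) \<le> real_of_int (p - c')" by (simp only: of_int_le_iff)
    moreover have "(1 - (2 * real_of_int c' / real_of_int p - 1)) / 2 * real_of_int p = real_of_int p - real_of_int c'"
      using pr by (simp add: field_simps)
    ultimately show ?thesis
      using False unfolding diag_width_def diag_frac_def c'_def[symmetric] cardeq by simp
  qed
qed

lemma diag_frac_bounds: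
  assumes "\<bar>snd L\<bar> < p"
  shows "0 \<le> diag_frac p h L" "diag_frac p h L \<le> 1"
proof -
  define c where "c = \<bar>snd L\<bar>"
  have pr: "real_of_int p > 0" using p_gt_2 by simp
  have "0 \<le> c" "c < p" using assms by (auto simp: c_def)
  then have "c \<le> h \<Longrightarrow> 2 * c \<le> p" "\<not> c \<le> h \<Longrightarrow> p \<le> 2 * c" "c \<le> p" using p by auto
  then have "c \<le> h \<Longrightarrow> 2 * real_of_int c \<le> real_of_int p" "\<not> c \<le> h \<Longrightarrow> real_of_int p \<le> 2 * real_of_int c" "real_of_int c \<le> real_of_int p"
    by linarith+
  then show "0 \<le> diag_frac p h L" "diag_frac p h L \<le> 1"
    using pr \<open>0 \<le> c\<close> unfolding diag_frac_def c_def[symmetric] by (auto simp: field_simps)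
qed

text \<open>Removing at most \<open>t\<close> parameters leaves the counts of hits bounded as before
  but shrinks the total from about \<open>p\<close> to \<open>n\<close>. The relative error
  \<open>\<eta>\<close> is chosen such that \<open>\<eta> * n >= t + 2\<close>, which uses
  \<open>2 * n >= p\<close>; the factor 8 is 2 from \<open>\<eta>\<close> times the bound 4 on the
  number of points.\<close>

lemma diagonal_average:
  assumes c: "\<bar>snd L\<bar> < p" and A': "A' \<subseteq> {1..p - 1}" "card {1..p - 1} \<le> card A' + t" and g: "slow g"
    and tp: "2 * int t + 2 \<le> p"
  shows "(\<Sum>m\<in>A'. g (s + card (hyperbola p h m \<inter> diagonal p L))) \<le> 
     real (card A') * (avg_step (diag_width h L) (diag_frac p h L) g s + 8 * (real t + 2) / real_of_int p)"
proof -
  define N where "N = (\<lambda>m. card (hyperbola p h m \<inter> diagonal p L))"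
  define v where "v = diag_frac p h L"
  define n where "n = real (card A')"
  define \<eta> where "\<eta> = 2 * (real t + 2) / real_of_int p"
  have pr: "real_of_int p > 0" using p_gt_2 by simp
  have v: "0 \<le> v" "v \<le> 1" using diag_frac_bounds[OF c] by (auto simp: v_def)
  have finA: "finite A'" using A'(1) finite_subset by blast
  have "int (card {1..p - 1}) = p - 1" using p_gt_2 by simp
  then have "p - 1 \<le> int (card A') + int t" using A'(2) by linarith
  then have np: "real_of_int p \<le> n + real t + 1" unfolding n_def by linarith
  have "2 * real t + 2 \<le> real_of_int p" using tp by linarith
  then have n2: "2 * n \<ge> real_of_int p" using np by linarith
  have en: "\<eta> * n \<ge> real t + 2"
  proof -
    have "(real t + 2) * (real_of_int p) \<le> (real t + 2) * (2 * n)" using n2 by (intro mult_left_mono) auto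
    then show ?thesis using pr by (simp add: \<eta>_def field_simps)
  qed
  have "(\<Sum>m\<in>A'. g (s + N m)) \<le> real (card A') * (avg_step (diag_width h L) v g s + (real (diag_width h L) + 1) * \<eta>)"
  proof (rule hit_average_bound[OF finA g])
    show "N m \<le> diag_width h L + 1" for m unfolding N_def by (rule diagonal_profile(1)[OF c])
    have finN: "finite {m \<in> {1..p - 1}. N m \<ge> j}" for j by (rule finite_subset[of _ "{1..p - 1}"]) auto
    have "card {m \<in> A'. N m \<ge> 1} \<le> card {m \<in> {1..p - 1}. N m \<ge> 1}" using A'(1) by (intro card_mono finN) blast
    also have "\<dots> \<le> nat (h + 1)" unfolding N_def by (rule diagonal_profile(2)[OF c])
    finally have "real (card {m \<in> A'. N m \<ge> 1}) \<le> real_of_int h + 1" using h_pos by linarith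
    also have "\<dots> = (real_of_int p + 1) / 2" using p by simp
    also have "\<dots> \<le> (1 / 2 + \<eta>) * n" using np en by (simp add: distrib_right) 
    finally show "real (card {m \<in> A'. N m \<ge> 1}) \<le> (1 / 2 + \<eta>) * real (card A')" by (simp add: n_def)
    have "card {m \<in> A'. N m \<ge> diag_width h L + 1} \<le> card {m \<in> {1..p - 1}. N m \<ge> diag_width h L + 1}"
      using A'(1) by (intro card_mono finN) blast
    then have "real (card {m \<in> A'. N m \<ge> diag_width h L + 1}) \<le> real (card {m \<in> {1..p - 1}. N m \<ge> diag_width h L + 1})" by simp
    also have "\<dots> \<le> (1 - v) / 2 * real_of_int p" unfolding N_def v_def by (rule diagonal_profile(3)[OF c])
    also have "\<dots> \<le> (1 - v) / 2 * (n + real t + 1)" using np v by (intro mult_left_mono) auto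
    also have "\<dots> = (1 - v) / 2 * n + (1 - v) * ((real t + 1) / 2)" by (simp add: field_simps)
    also have "(1 - v) * ((real t + 1) / 2) \<le> 1 * ((real t + 1) / 2)" using v by (intro mult_right_mono) auto
    also have "(1 - v) / 2 * n + 1 * ((real t + 1) / 2) \<le> ((1 - v) / 2 + \<eta>) * n" using en by (simp add: distrib_right)
    finally show "real (card {m \<in> A'. N m \<ge> diag_width h L + 1}) \<le> ((1 - v) / 2 + \<eta>) * real (card A')" by (simp add: n_def)
    show "\<eta> \<ge> 0" using pr by (simp add: \<eta>_def)
  qed
  also have "\<dots> \<le> real (card A') * (avg_step (diag_width h L) v g s + 4 * \<eta>)"
    using pr by (intro mult_left_mono add_left_mono mult_right_mono) (auto simp: diag_width_def \<eta>_def)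
  finally show ?thesis by (simp add: N_def v_def \<eta>_def)
qed

section \<open>Collinear points of a hyperbola\<close>

lemma hyperbola_x_unit: "(x, y) \<in> hyperbola p h m \<Longrightarrow> m \<in> {1..p - 1} \<Longrightarrow> \<not> p dvd x - (h + 1) \<and> \<not> p dvd y"
proof -
  assume *: "(x, y) \<in> hyperbola p h m" "m \<in> {1..p - 1}"
  have "\<not> p dvd (x - (h + 1)) * y"
  proof
    assume "p dvd (x - (h + 1)) * y"
    then have "p dvd (x - (h + 1)) * y - ((x - (h + 1)) * y - m)"
      by (rule dvd_diff) (use * in \<open>auto simp: hyperbola_def\<close>)
    then have "p dvd m" by simp
    then show False using *(2) zdvd_not_zless[of m p] by auto
  qed
  then show ?thesis by (meson dvd_mult dvd_mult2)
qed

lemma hyperbola_cong_iff: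
  assumes "(x, y) \<in> hyperbola p h m" "(x', y') \<in> hyperbola p h m" "m \<in> {1..p - 1}"
  shows "p dvd x - x' \<longleftrightarrow> p dvd y - y'"
proof -
  have "p dvd ((x - (h + 1)) * y - m) - ((x' - (h + 1)) * y' - m)"
    by (rule dvd_diff) (use assms in \<open>auto simp: hyperbola_def\<close>)
  also have "\<dots> = (x - x') * y + (x' - (h + 1)) * (y - y')" by (simp add: algebra_simps)
  finally have *: "p dvd (x - x') * y + (x' - (h + 1)) * (y - y')" .
  have nd: "\<not> p dvd y" "\<not> p dvd x' - (h + 1)" using hyperbola_x_unit assms by blast+
  show ?thesis
  proof
    assume "p dvd x - x'"
    then have "p dvd (x' - (h + 1)) * (y - y')" using * dvd_add_right_iff dvd_mult2 by blast
    then show "p dvd y - y'" using prime_dvd_mult_int[OF prime] nd by blast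
  next
    assume "p dvd y - y'"
    then have "p dvd (x - x') * y" using * dvd_add_left_iff dvd_mult by blast
    then show "p dvd x - x'" using prime_dvd_mult_int[OF prime] nd by blast
  qed
qed

text \<open>Multiplying the collinearity determinant by \<open>X1 * X2 * X3\<close> and replacing
  each \<open>X * y\<close> by \<open>m\<close> turns it into \<open>m\<close> times a Vandermonde
  product. The multipliers \<open>k1\<close>, \<open>k2\<close>, \<open>k3\<close> keep this an
  identity of integers, in which the other side is a multiple of \<open>p\<close>.\<close>

lemma hyperbola_collinear:
  assumes "(x1, y1) \<in> hyperbola p h m" "(x2, y2) \<in> hyperbola p h m" "(x3, y3) \<in> hyperbola p h m" "m \<in> {1..p - 1}"
    and col: "(x2 - x1) * (y3 - y1) = (x3 - x1) * (y2 - y1)"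
  shows "p dvd x2 - x1 \<or> p dvd x1 - x3 \<or> p dvd x2 - x3"
proof -
  define X1 X2 X3 where "X1 = x1 - (h + 1)" and "X2 = x2 - (h + 1)" and "X3 = x3 - (h + 1)"
  obtain k1 k2 k3 where k: "X1 * y1 = m + p * k1" "X2 * y2 = m + p * k2" "X3 * y3 = m + p * k3"
    using assms(1-3) unfolding hyperbola_def X1_def X2_def X3_def dvd_def by (auto simp: algebra_simps)
  have col': "(X2 - X1) * (y3 - y1) = (X3 - X1) * (y2 - y1)" using col by (simp add: X1_def X2_def X3_def)
  have "m * ((X2 - X1) * ((X1 - X3) * (X2 - X3))) = p * ((X3 - X1) * X3 * (X1 * k2 - X2 * k1) - (X2 - X1) * X2 * (X1 * k3 - X3 * k1))"
  proof -
    have "(X2 - X1) * X2 * (X1 * (X3 * y3) - X3 * (X1 * y1)) - (X3 - X1) * X3 * (X1 * (X2 * y2) - X2 * (X1 * y1))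
       = X1 * X2 * X3 * ((X2 - X1) * (y3 - y1) - (X3 - X1) * (y2 - y1))"
      by (simp add: algebra_simps)
    also have "\<dots> = 0" using col' by simp
    finally show ?thesis unfolding k by (simp add: algebra_simps)
  qed
  then have "p dvd m * ((X2 - X1) * ((X1 - X3) * (X2 - X3)))" by simp
  moreover have "\<not> p dvd m" using assms(4) zdvd_not_zless[of m p] by auto
  ultimately show ?thesis
    using prime_dvd_mult_int[OF prime] by (auto simp: X1_def X2_def X3_def)
qed

lemma card_collinear_le_2:
  assumes C: "C \<subseteq> hyperbola p h m" "m \<in> {1..p - 1}"
    and col: "\<And>x1 y1 x2 y2 x3 y3. (x1, y1) \<in> C \<Longrightarrow> (x2, y2) \<in> C \<Longrightarrow> (x3, y3) \<in> C \<Longrightarrow> (x2 - x1) * (y3 - y1) = (x3 - x1) * (y2 - y1)"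
    and nc: "\<And>x y x' y'. (x, y) \<in> C \<Longrightarrow> (x', y') \<in> C \<Longrightarrow> p dvd x - x' \<Longrightarrow> p dvd y - y' \<Longrightarrow> (x, y) = (x', y')"
  shows "card C \<le> 2"
proof (rule ccontr)
  assume "\<not> ?thesis"
  then have "3 \<le> card C" by simp
  from obtain_subset_with_card_n[OF this] obtain U where U: "U \<subseteq> C" "card U = 3" .
  then obtain P1 P2 P3 where P: "P1 \<in> C" "P2 \<in> C" "P3 \<in> C" "P1 \<noteq> P2" "P1 \<noteq> P3" "P2 \<noteq> P3"
    unfolding card_3_iff by blast
  obtain x1 y1 x2 y2 x3 y3 where xy: "P1 = (x1, y1)" "P2 = (x2, y2)" "P3 = (x3, y3)" by (cases P1; cases P2; cases P3) auto
  have mem: "(x1, y1) \<in> hyperbola p h m" "(x2, y2) \<in> hyperbola p h m" "(x3, y3) \<in> hyperbola p h m"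
    using P C xy by auto
  have ncx: "(x, y) = (x', y')" if "(x, y) \<in> C" "(x', y') \<in> C" "p dvd x - x'" for x y x' y'
    using nc[OF that(1,2,3)] hyperbola_cong_iff[of x y m x' y'] that C by auto
  show False
    using hyperbola_collinear[OF mem C(2) col] P xy ncx[of x2 y2 x1 y1] ncx[of x1 y1 x3 y3] ncx[of x2 y2 x3 y3] by auto
qed

lemma card_row_le_2:
  assumes "C \<subseteq> hyperbola p h m" "m \<in> {1..p - 1}" and col: "(\<forall>P\<in>C. fst P = z) \<or> (\<forall>P\<in>C. snd P = z)"
  shows "card C \<le> 2"
  using col
proof
  assume *: "\<forall>P\<in>C. fst P = z"
  have "card (snd ` C) \<le> 2"
  proof (rule card_le_2_if_cong[of _ p])
    show "snd ` C \<subseteq> {1..2 * p}" using assms(1) by (auto simp: hyperbola_def)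
    fix y y' assume "y \<in> snd ` C" "y' \<in> snd ` C"
    then have "(z, y) \<in> hyperbola p h m" "(z, y') \<in> hyperbola p h m" using * assms(1) by force+
    then show "p dvd y - y'" using hyperbola_cong_iff[of z y m z y'] assms(2) by simp
  qed (use p_gt_2 in simp)
  moreover have "inj_on snd C" using * by (auto simp: inj_on_def prod_eq_iff)
  ultimately show ?thesis by (simp add: card_image)
next
  assume *: "\<forall>P\<in>C. snd P = z"
  have "card (fst ` C) \<le> 2"
  proof (rule card_le_2_if_cong[of _ p])
    show "fst ` C \<subseteq> {1..2 * p}" using assms(1) by (auto simp: hyperbola_def)
    fix x x' assume "x \<in> fst ` C" "x' \<in> fst ` C"
    then have "(x, z) \<in> hyperbola p h m" "(x', z) \<in> hyperbola p h m" using * assms(1) by force+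
    then show "p dvd x - x'" using hyperbola_cong_iff[of x z m x' z] assms(2) by simp
  qed (use p_gt_2 in simp)
  moreover have "inj_on fst C" using * by (auto simp: inj_on_def prod_eq_iff)
  ultimately show ?thesis by (simp add: card_image)
qed

lemma cong_in_square_cases:
  assumes "x \<in> {1..2 * p}" "x' \<in> {1..2 * p}" "p dvd x - x'"
  shows "x - x' = 0 \<or> x - x' = p \<or> x - x' = - p"
proof -
  obtain q where q: "x - x' = p * q" using assms(3) unfolding dvd_def by blast
  have "\<bar>x - x'\<bar> < 2 * p" using assms(1,2) by auto
  then have "p * \<bar>q\<bar> < p * 2" using p_gt_2 unfolding q by (simp add: abs_mult)
  then have "\<bar>q\<bar> < 2" using p_gt_2 by simp
  then have "q = 0 \<or> q = 1 \<or> q = -1" by auto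
  then show ?thesis using q by auto
qed

text \<open>Two points per hyperbola and \<open>2 * t <= k\<close> settle every line without two
  different congruent points, as well as the axis-parallel ones. The diagonals with offset below
  \<open>p\<close> are covered by \<open>diag\<close>. On the outer ones a shift by \<open>p\<close>
  in both coordinates leaves the square, so they count as lines without congruent points.\<close>

lemma card_line_le:
  assumes M: "finite M" "M \<subseteq> {1..p - 1}" "card M = t" and S: "S \<subseteq> (\<Union>m\<in>M. hyperbola p h m)" "2 * t \<le> k"
    and diag: "\<And>L. \<bar>snd L\<bar> < p \<Longrightarrow> card (S \<inter> diagonal p L) \<le> k"
    and PQ: "(x0, y0) \<in> S" "(d1, d2) \<noteq> (0, 0)"
  shows "card {(x, y) \<in> S. (x - x0) * d2 = (y - y0) * d1} \<le> k"
proof -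
  define C where "C = {(x, y) \<in> S. (x - x0) * d2 = (y - y0) * d1}"
  have finS: "finite S" by (rule finite_subset[OF S(1)]) (use M(1) in auto)
  have box: "x \<in> {1..2 * p}" "y \<in> {1..2 * p}" if "(x, y) \<in> S" for x y
    using that S(1) by (auto simp: hyperbola_def)
  have reduce: "card C \<le> k" if "\<And>m. m \<in> M \<Longrightarrow> card (C \<inter> hyperbola p h m) \<le> 2"
  proof -
    have "C = (\<Union>m\<in>M. C \<inter> hyperbola p h m)" using S(1) by (auto simp: C_def)
    then have "card C \<le> (\<Sum>m\<in>M. card (C \<inter> hyperbola p h m))" using card_UN_le[OF M(1), of "\<lambda>m. C \<inter> hyperbola p h m"] by simp
    also have "\<dots> \<le> (\<Sum>m\<in>M. 2)" by (intro sum_mono that)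
    finally show ?thesis using M(3) S(2) by simp
  qed
  have par: "(x - x') * d2 = (y - y') * d1" if "(x, y) \<in> C" "(x', y') \<in> C" for x y x' y'
    using that by (auto simp: C_def algebra_simps)
  have col: "(x2 - x1) * (y3 - y1) = (x3 - x1) * (y2 - y1)"
    if "(x1, y1) \<in> C" "(x2, y2) \<in> C" "(x3, y3) \<in> C" for x1 y1 x2 y2 x3 y3
  proof -
    have e: "(x2 - x1) * d2 = (y2 - y1) * d1" "(x3 - x1) * d2 = (y3 - y1) * d1" using par that by blast+
    have "((x2 - x1) * (y3 - y1) - (x3 - x1) * (y2 - y1)) * d1 = (x2 - x1) * ((y3 - y1) * d1) - (x3 - x1) * ((y2 - y1) * d1)"
      by (simp only: left_diff_distrib mult.assoc)
    also have "\<dots> = 0" unfolding e[symmetric] by simp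
    finally have 1: "((x2 - x1) * (y3 - y1) - (x3 - x1) * (y2 - y1)) * d1 = 0" .
    have "((x2 - x1) * (y3 - y1) - (x3 - x1) * (y2 - y1)) * d2 = ((x2 - x1) * d2) * (y3 - y1) - ((x3 - x1) * d2) * (y2 - y1)"
      by (simp add: algebra_simps)
    also have "\<dots> = 0" unfolding e by simp
    finally have 2: "((x2 - x1) * (y3 - y1) - (x3 - x1) * (y2 - y1)) * d2 = 0" .
    from 1 2 show ?thesis using PQ(2) by auto
  qed
  have noncong: "card C \<le> k"
    if nc: "\<And>x y x' y'. (x, y) \<in> C \<Longrightarrow> (x', y') \<in> C \<Longrightarrow> p dvd x - x' \<Longrightarrow> p dvd y - y' \<Longrightarrow> (x, y) = (x', y')"
  proof (rule reduce)
    fix m assume m: "m \<in> M"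
    show "card (C \<inter> hyperbola p h m) \<le> 2"
      by (rule card_collinear_le_2) (use m M(2) col nc in auto)
  qed
  have CS: "(x, y) \<in> S" if "(x, y) \<in> C" for x y using that by (simp add: C_def)
  consider "d1 = 0" | "d2 = 0" | "d1 \<noteq> 0" "d2 = d1" | "d1 \<noteq> 0" "d2 = - d1" | "d1 \<noteq> 0" "d2 \<noteq> 0" "d2 \<noteq> d1" "d2 \<noteq> - d1" by blast
  then have "card C \<le> k"
  proof cases
    case 1
    then have "\<forall>P\<in>C. fst P = x0" using PQ(2) by (auto simp: C_def)
    then show ?thesis using M(2) by (intro reduce card_row_le_2[where z = x0]) auto
  next
    case 2
    then have "\<forall>P\<in>C. snd P = y0" using PQ(2) by (auto simp: C_def)
    then show ?thesis using M(2) by (intro reduce card_row_le_2[where z = y0]) auto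
  next
    case 3
    define c where "c = y0 - x0"
    have lin: "y = x + c" if "(x, y) \<in> C" for x y using that 3 by (auto simp: C_def c_def)
    show ?thesis
    proof (cases "\<bar>c\<bar> < p")
      case True
      have "C \<subseteq> S \<inter> diagonal p (True, c)" using lin CS by (auto simp: diagonal_def)
      then have "card C \<le> card (S \<inter> diagonal p (True, c))" using finS by (intro card_mono) auto
      then show ?thesis using diag[of "(True, c)"] True by simp
    next
      case False
      show ?thesis
      proof (rule noncong)
        fix x y x' y' assume xy: "(x, y) \<in> C" "(x', y') \<in> C" "p dvd x - x'" "p dvd y - y'"
        then show "(x, y) = (x', y')"
          using cong_in_square_cases[of x x'] box[OF CS[OF xy(1)]] box[OF CS[OF xy(2)]] lin[OF xy(1)] lin[OF xy(2)] False by auto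
      qed
    qed
  next
    case 4
    define c where "c = y0 + x0 - (2 * p + 1)"
    have lin: "y = 2 * p + 1 - x + c" if "(x, y) \<in> C" for x y
    proof -
      have "(x - x0) * (- d1) = (y - y0) * d1" using that 4 by (auto simp: C_def)
      then have "(x - x0 + (y - y0)) * d1 = 0" by (simp add: algebra_simps)
      then show ?thesis using 4 by (simp add: c_def)
    qed
    show ?thesis
    proof (cases "\<bar>c\<bar> < p")
      case True
      have "C \<subseteq> S \<inter> diagonal p (False, c)" using lin CS by (auto simp: diagonal_def)
      then have "card C \<le> card (S \<inter> diagonal p (False, c))" using finS by (intro card_mono) auto
      then show ?thesis using diag[of "(False, c)"] True by simp
    next
      case False
      show ?thesis
      proof (rule noncong)
        fix x y x' y' assume xy: "(x, y) \<in> C" "(x', y') \<in> C" "p dvd x - x'" "p dvd y - y'"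
        then show "(x, y) = (x', y')"
          using cong_in_square_cases[of x x'] box[OF CS[OF xy(1)]] box[OF CS[OF xy(2)]] lin[OF xy(1)] lin[OF xy(2)] False by auto
      qed
    qed
  next
    case 5
    show ?thesis
    proof (rule noncong)
      fix x y x' y' assume xy: "(x, y) \<in> C" "(x', y') \<in> C" "p dvd x - x'" "p dvd y - y'"
      have "x - x' = 0 \<or> x - x' = p \<or> x - x' = - p" "y - y' = 0 \<or> y - y' = p \<or> y - y' = - p"
        using xy box CS cong_in_square_cases by metis+
      moreover have "(x - x') * d2 = (y - y') * d1" using par xy by blast
      ultimately have "x - x' = 0 \<and> y - y' = 0" using 5 p_gt_2 by (intro parallel_lattice_shift[of p _ _ d2 d1]) auto
      then show "(x, y) = (x', y')" by simp
    qed
  qed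
  then show ?thesis by (simp add: C_def)
qed

text \<open>Only the two columns with \<open>x\<close> congruent to \<open>h + 1\<close> are empty.
  In each of the other \<open>2 * p - 2\<close> columns \<open>y\<close> is determined modulo
  \<open>p\<close>, which gives two points.\<close>

lemma card_hyperbola_ge:
  assumes "m \<in> {1..p - 1}"
  shows "4 * (p - 1) \<le> int (card (hyperbola p h m))"
proof -
  define G where "G = {1..2 * p} - {h + 1, h + 1 + p}"
  have "\<exists>y. y \<in> {1..p} \<and> p dvd (x - (h + 1)) * y - m" if x: "x \<in> G" for x
  proof -
    have "\<not> p dvd x - (h + 1)"
    proof
      assume "p dvd x - (h + 1)"
      then have "x - (h + 1) = 0 \<or> x - (h + 1) = p \<or> x - (h + 1) = - p"
        using x p h_pos by (intro cong_in_square_cases) (auto simp: G_def)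
      then show False using x p h_pos by (auto simp: G_def)
    qed
    then have "coprime (x - (h + 1)) p" using prime prime_imp_coprime coprime_commute by metis
    then obtain u where "[(x - (h + 1)) * u = 1] (mod p)" using cong_solve_coprime_int by blast
    then have u: "p dvd (x - (h + 1)) * u - 1" by (simp add: cong_iff_dvd_diff)
    define y where "y = (u * m - 1) mod p + 1"
    have "0 < p" using p_gt_2 by simp
    then have y1: "y \<in> {1..p}" using pos_mod_bound[of p "u * m - 1"] pos_mod_sign[of p "u * m - 1"]
      unfolding y_def atLeastAtMost_iff by linarith
    have "p dvd (u * m - 1) - (u * m - 1) mod p" by (rule dvd_minus_mod)
    then have yu: "p dvd u * m - y" by (simp add: y_def algebra_simps)
    have "(x - (h + 1)) * y - m = ((x - (h + 1)) * u - 1) * m - (x - (h + 1)) * (u * m - y)" by (simp add: algebra_simps)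
    then have "p dvd (x - (h + 1)) * y - m" using u yu by (metis dvd_diff dvd_mult dvd_mult2)
    then show ?thesis using y1 by blast
  qed
  then obtain Y where Y: "\<And>x. x \<in> G \<Longrightarrow> Y x \<in> {1..p}" "\<And>x. x \<in> G \<Longrightarrow> p dvd (x - (h + 1)) * Y x - m" by metis
  have inj: "inj_on (\<lambda>(x, i). (x, Y x + i * p)) (G \<times> {0, 1})" using p_gt_2 by (auto simp: inj_on_def)
  have "(\<lambda>(x, i). (x, Y x + i * p)) ` (G \<times> {0, 1}) \<subseteq> hyperbola p h m"
  proof (rule image_subsetI)
    fix z :: "int \<times> int" assume "z \<in> G \<times> {0, 1}"
    then obtain x where x: "x \<in> G" and z: "z = (x, 0) \<or> z = (x, 1)" by auto
    have e: "(x - (h + 1)) * (Y x + p) - m = ((x - (h + 1)) * Y x - m) + p * (x - (h + 1))" by (simp add: algebra_simps)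
    have "p dvd (x - (h + 1)) * (Y x + p) - m" unfolding e using Y(2)[OF x] by simp
    then have "(x, Y x) \<in> hyperbola p h m" "(x, Y x + p) \<in> hyperbola p h m"
      using Y[OF x] x by (auto simp: hyperbola_def G_def)
    then show "(case z of (x, i) \<Rightarrow> (x, Y x + i * p)) \<in> hyperbola p h m" using z by auto
  qed
  then have "card ((\<lambda>(x, i). (x, Y x + i * p)) ` (G \<times> {0, 1 :: int})) \<le> card (hyperbola p h m)" by (intro card_mono) auto
  moreover have "card ((\<lambda>(x, i). (x, Y x + i * p)) ` (G \<times> {0, 1 :: int})) = card G * 2"
    by (subst card_image[OF inj]) (simp add: card_cartesian_product)
  ultimately have "card G * 2 \<le> card (hyperbola p h m)" by (simp only:)
  then have "int (card G * 2) \<le> int (card (hyperbola p h m))" by (simp only: of_nat_le_iff)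
  moreover have "int (card G) = 2 * p - 2"
    unfolding G_def using p h_pos by (subst card_Diff_subset) auto
  then have "int (card G * 2) = 4 * (p - 1)" by simp
  ultimately show ?thesis by (simp only:)
qed

lemma hyperbola_disjoint:
  assumes "m \<in> {1..p - 1}" "m' \<in> {1..p - 1}" "m \<noteq> m'"
  shows "hyperbola p h m \<inter> hyperbola p h m' = {}"
proof (rule equals0I, clarsimp simp: hyperbola_def)
  fix x y assume "p dvd (x - (h + 1)) * y - m" "p dvd (x - (h + 1)) * y - m'"
  then have "p dvd ((x - (h + 1)) * y - m') - ((x - (h + 1)) * y - m)" by (intro dvd_diff[of p "(x - (h + 1)) * y - m'" "(x - (h + 1)) * y - m"])
  then have "p dvd m - m'" by simp
  then have "m = m'" using assms by (intro eq_if_cong_int) auto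
  then show False using assms by simp
qed

end

section \<open>Total loss over all diagonals\<close>

lemma sum_symmetric_int_le:
  fixes f :: "int \<Rightarrow> real"
  assumes "\<And>c. f c \<ge> 0"
  shows "(\<Sum>c\<in>{-n..n}. f \<bar>c\<bar>) \<le> 2 * (\<Sum>c\<in>{0..n}. f c)"
proof -
  have "(\<Sum>c\<in>{-n..n}. f \<bar>c\<bar>) \<le> (\<Sum>c\<in>{0..n} \<union> uminus ` {0..n}. f \<bar>c\<bar>)"
  proof (intro sum_mono2)
    show "{-n..n} \<subseteq> {0..n} \<union> uminus ` {0..n}"
    proof
      fix x assume "x \<in> {-n..n}"
      then have "x \<in> {0..n} \<or> - x \<in> {0..n}" by auto
      then show "x \<in> {0..n} \<union> uminus ` {0..n}" using image_eqI[of x uminus "- x" "{0..n}"] by auto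
    qed
  qed (auto simp: assms)
  also have "\<dots> \<le> (\<Sum>c\<in>{0..n}. f \<bar>c\<bar>) + (\<Sum>c\<in>uminus ` {0..n}. f \<bar>c\<bar>)"
    by (subst sum_Un) (auto intro!: sum_nonneg assms)
  also have "(\<Sum>c\<in>uminus ` {0..n}. f \<bar>c\<bar>) = (\<Sum>c\<in>{0..n}. f \<bar>c\<bar>)"
    by (subst sum.reindex) auto
  also have "(\<Sum>c\<in>{0..n}. f \<bar>c\<bar>) = (\<Sum>c\<in>{0..n}. f c)" by (intro sum.cong) auto
  finally show ?thesis by simp
qed

text \<open>Two slopes and two signs give a factor 4 over the offsets \<open>0..p - 1\<close>. There
  the fractions run through multiples of \<open>1 / p\<close> with step \<open>2 / p\<close>, even
  ones up to \<open>h\<close> and odd ones beyond, so each half is at most \<open>p / 2\<close>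
  times an integral over \<open>v\<close>. The first point of each half, at offset 0 and
  \<open>h + 1\<close>, is not a right endpoint; it is bounded by \<open>4 * t\<close>, hence
  \<open>32 * t\<close> in all.\<close>

lemma diagonal_loss_sum_le:
  fixes p h :: int and t k :: nat
  assumes prime: "prime p" and p: "p = 2 * h + 1"
  shows "(\<Sum>L\<in>UNIV \<times> {-(p - 1)..p - 1}. (avg_step (diag_width h L) (diag_frac p h L) ^^ t) (\<lambda>s. real (s - k)) 0)
     \<le> 2 * real_of_int p * expected_loss t k + 32 * real t"
proof -
  define g where "g = (\<lambda>s. real (s - k))"
  have g: "slow g" unfolding g_def by (rule slow_truncated_diff)
  have g0: "g s \<ge> 0" for s by (simp add: g_def)
  define I where "I = (\<lambda>e. \<Sum>i\<le>t. real (t choose i) / 2 ^ t / (real i + 1) * (\<Sum>j\<le>i. g (e * i + j)))"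
  define Q where "Q = (\<lambda>e v. (avg_step e v ^^ t) g 0)"
  have h: "h \<ge> 1" by (rule h_pos[OF prime p])
  define H where "H = nat h"
  have H: "int H = h" "H \<ge> 1" using h by (auto simp: H_def)
  define P where "P = real_of_int p"
  have hH: "real_of_int h = real H" using H(1) by (metis of_int_of_nat_eq)
  have P: "P = 2 * real H + 1" unfolding P_def p by (simp add: hH)
  \<comment> \<open>The default 0 outside the range makes \<open>F\<close> nonnegative everywhere,
    as the symmetrisation of the sum requires.\<close>
  define F where "F = (\<lambda>c. if 0 \<le> c \<and> c \<le> p - 1 then Q (diag_width h (True, c)) (diag_frac p h (True, c)) else 0)"
  have frac: "0 \<le> diag_frac p h (True, c)" "diag_frac p h (True, c) \<le> 1" if "0 \<le> c" "c \<le> p - 1" for c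
    using diag_frac_bounds[OF prime p, of "(True, c)"] that by auto
  have F0: "F c \<ge> 0" for c
    unfolding F_def Q_def using frac by (auto intro!: avg_iter_nonneg g0)
  have F4: "F c \<le> 4 * real t" for c
  proof (cases "0 \<le> c \<and> c \<le> p - 1")
    case True
    have "F c \<le> g 0 + real t * (real (diag_width h (True, c)) + 1)"
      using True frac[of c] unfolding F_def Q_def by (simp add: avg_iter_le[OF g])
    also have "\<dots> \<le> real t * 4" unfolding g_def by (auto intro!: mult_left_mono simp: diag_width_def)
    finally show ?thesis by simp
  next
    case False
    then have "F c = 0" unfolding F_def by (rule if_not_P)
    then show ?thesis by simp
  qed
  have riemann: "(\<Sum>i=1..K. Q e (v0 + real i * (2 / P))) \<le> P / 2 * I e" if "v0 \<ge> 0" "v0 + real K * (2 / P) \<le> 1" for K e v0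
  proof -
    have "(\<Sum>i=1..K. Q e (v0 + real i * (2 / P))) * (2 / P) \<le> integral {0..1} (Q e)"
      unfolding Q_def
    proof (rule antimono_riemann_sum_le)
      show "(avg_step e x ^^ t) g 0 \<ge> 0" if "x \<in> {0..1}" for x
        using that by (intro avg_iter_nonneg g0) auto
      show "(avg_step e y ^^ t) g 0 \<le> (avg_step e x ^^ t) g 0" if "0 \<le> x" "x \<le> y" "y \<le> 1" for x y
        by (rule avg_iter_antimono[OF g that])
      show "0 < 2 / P" using P by simp
    qed (fact that avg_iter_continuous)+
    also have "integral {0..1} (Q e) = I e"
      unfolding Q_def I_def by (rule integral_unique[OF avg_iter_has_integral])
    finally show ?thesis using P by (simp add: field_simps)
  qed
  have s3: "(\<Sum>c\<in>{1..h}. F c) \<le> P / 2 * I 3"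
  proof -
    have "(\<Sum>c\<in>{1..h}. F c) = (\<Sum>i=1..H. Q 3 (0 + real i * (2 / P)))"
    proof (rule sum.reindex_bij_witness[of _ int nat])
      fix c assume "c \<in> {1..h}"
      then show "Q 3 (0 + real (nat c) * (2 / P)) = F c"
        using p by (simp add: F_def diag_width_def diag_frac_def P_def mult.commute)
    qed (use H in auto)
    also have "\<dots> \<le> P / 2 * I 3" using P by (intro riemann) (auto simp: field_simps)
    finally show ?thesis .
  qed
  have s2: "(\<Sum>c\<in>{h + 2..p - 1}. F c) \<le> P / 2 * I 2"
  proof -
    have "(\<Sum>c\<in>{h + 2..p - 1}. F c) = (\<Sum>i=1..H - 1. Q 2 (1 / P + real i * (2 / P)))"
    proof (rule sum.reindex_bij_witness[of _ "\<lambda>i. h + 1 + int i" "\<lambda>c. nat (c - (h + 1))"])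
      fix c assume c: "c \<in> {h + 2..p - 1}"
      have "real (nat (c - (h + 1))) = real_of_int (c - (h + 1))" using c by simp
      then have "real (nat (c - (h + 1))) = real_of_int c - (real H + 1)" by (simp add: hH)
      then have "1 / P + real (nat (c - (h + 1))) * (2 / P) = 2 * real_of_int c / P - 1"
        using P by (simp add: field_simps)
      then show "Q 2 (1 / P + real (nat (c - (h + 1))) * (2 / P)) = F c"
        using c h by (simp add: F_def diag_width_def diag_frac_def P_def)
    qed (use H p in auto)
    also have "\<dots> \<le> P / 2 * I 2" using P H(2) by (intro riemann) (auto simp: field_simps of_nat_diff)
    finally show ?thesis .
  qed
  have "{0..p - 1} = insert 0 ({1..h} \<union> insert (h + 1) {h + 2..p - 1})" using p h by auto
  moreover have "sum F (insert 0 ({1..h} \<union> insert (h + 1) {h + 2..p - 1})) = F 0 + sum F ({1..h} \<union> insert (h + 1) {h + 2..p - 1})"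
    using h by (intro sum.insert) auto
  moreover have "sum F ({1..h} \<union> insert (h + 1) {h + 2..p - 1}) = sum F {1..h} + sum F (insert (h + 1) {h + 2..p - 1})"
    by (intro sum.union_disjoint) auto
  moreover have "sum F (insert (h + 1) {h + 2..p - 1}) = F (h + 1) + sum F {h + 2..p - 1}"
    by (intro sum.insert) auto
  ultimately have "(\<Sum>c\<in>{0..p - 1}. F c) = F 0 + (\<Sum>c\<in>{1..h}. F c) + F (h + 1) + (\<Sum>c\<in>{h + 2..p - 1}. F c)"
    by simp
  also have "\<dots> \<le> 4 * real t + P / 2 * I 3 + 4 * real t + P / 2 * I 2"
    by (intro add_mono s2 s3 F4)
  also have "\<dots> = 8 * real t + P / 2 * (I 3 + I 2)" by (simp add: algebra_simps)
  also have "I 3 + I 2 = expected_loss t k"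
    unfolding I_def expected_loss_def g_def sum.distrib[symmetric] distrib_left[symmetric] ..
  finally have Fsum: "(\<Sum>c\<in>{0..p - 1}. F c) \<le> 8 * real t + P / 2 * expected_loss t k" .
  have "(\<Sum>L\<in>UNIV \<times> {-(p - 1)..p - 1}. (avg_step (diag_width h L) (diag_frac p h L) ^^ t) g 0) = 
     (\<Sum>L\<in>(UNIV :: bool set) \<times> {-(p - 1)..p - 1}. F \<bar>snd L\<bar>)"
    by (intro sum.cong refl) (auto simp: F_def Q_def diag_width_def diag_frac_def)
  also have "\<dots> = (\<Sum>u\<in>(UNIV :: bool set). \<Sum>c\<in>{-(p - 1)..p - 1}. F \<bar>c\<bar>)"
    by (simp only: sum.cartesian_product case_prod_unfold snd_conv)
  also have "\<dots> = 2 * (\<Sum>c\<in>{-(p - 1)..p - 1}. F \<bar>c\<bar>)" by (simp add: UNIV_bool)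
  also have "\<dots> \<le> 2 * (2 * (\<Sum>c\<in>{0..p - 1}. F c))"
    by (intro mult_left_mono sum_symmetric_int_le F0) auto
  also have "\<dots> \<le> 2 * (2 * (8 * real t + P / 2 * expected_loss t k))" using Fsum by simp
  finally show ?thesis by (simp add: g_def P_def)
qed

text \<open>The hyperbolas are disjoint and have \<open>4 * t * (p - 1)\<close> points at least. The
  error collects \<open>4 * t\<close> from the \<open>- 1\<close>, \<open>32 * t\<close> from the
  Riemann sums, and \<open>t\<close> choices times at most \<open>4 * p\<close> diagonals times
  \<open>8 * (t + 2) / p\<close>. A line is given by a point and a direction, so that incidence
  remains integer arithmetic.\<close>

lemma exists_integer_point_set:
  fixes p h :: int and t k :: nat
  assumes prime: "prime p" and p: "p = 2 * h + 1" and tp: "2 * int t + 2 \<le> p" and k: "2 * t \<le> k"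
  shows "\<exists>S. S \<subseteq> {1..2 * p} \<times> {1..2 * p} \<and> 
    (\<forall>x0 y0 d1 d2. (x0, y0) \<in> S \<longrightarrow> (d1, d2) \<noteq> (0, 0) \<longrightarrow> card {(x, y) \<in> S. (x - x0) * d2 = (y - y0) * d1} \<le> k) \<and>
    real (card S) \<ge> 2 * real_of_int p * (2 * real t - expected_loss t k) - (36 * real t + 32 * real t * (real t + 2))"
proof -
  define A where "A = {1..p - 1}"
  define Lam where "Lam = (UNIV :: bool set) \<times> {-(p - 1)..p - 1}"
  define N where "N = (\<lambda>L m. card (hyperbola p h m \<inter> diagonal p L))"
  define g where "g = (\<lambda>s. real (s - k))"
  have p2: "p > 2" by (rule p_gt_2[OF prime p])
  have Lam: "finite Lam" "real (card Lam) \<le> 4 * real_of_int p" using p2 by (auto simp: Lam_def card_cartesian_product UNIV_bool)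
  have LamD: "L \<in> Lam \<longleftrightarrow> \<bar>snd L\<bar> < p" for L by (cases L) (auto simp: Lam_def)
  have "\<exists>M\<subseteq>A. card M = t \<and> (\<Sum>L\<in>Lam. g (\<Sum>m\<in>M. N L m)) \<le> 
     (\<Sum>L\<in>Lam. (avg_step (diag_width h L) (diag_frac p h L) ^^ t) g 0) + real t * (real (card Lam) * (8 * (real t + 2) / real_of_int p))"
  proof (rule exists_low_loss_selection)
    show "t < card A" using tp by (simp add: A_def)
    show "slow g" unfolding g_def by (rule slow_truncated_diff)
    show "0 \<le> diag_frac p h L \<and> diag_frac p h L \<le> 1" if "L \<in> Lam" for L
      using diag_frac_bounds[OF prime p, of L] that LamD by simp
    show "(\<Sum>m\<in>A'. g (s + N L m)) \<le> real (card A') * (avg_step (diag_width h L) (diag_frac p h L) g s + 8 * (real t + 2) / real_of_int p)"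
      if "L \<in> Lam" "A' \<subseteq> A" "card A \<le> card A' + t" "slow g" for L A' g s
      unfolding N_def using that LamD tp by (intro diagonal_average[OF prime p]) (auto simp: A_def)
  qed (use Lam in \<open>auto simp: A_def\<close>)
  then obtain M where M: "M \<subseteq> A" "card M = t" and loss: "(\<Sum>L\<in>Lam. g (\<Sum>m\<in>M. N L m)) \<le> 
     (\<Sum>L\<in>Lam. (avg_step (diag_width h L) (diag_frac p h L) ^^ t) g 0) + real t * (real (card Lam) * (8 * (real t + 2) / real_of_int p))"
    by (elim exE conjE)
  have finM: "finite M" using M(1) finite_subset by (auto simp: A_def)
  define S0 where "S0 = (\<Union>m\<in>M. hyperbola p h m)"
  have finS0: "finite S0" using finM by (simp add: S0_def)
  obtain S where S: "S \<subseteq> S0" "\<forall>L\<in>Lam. card (S \<inter> diagonal p L) \<le> k" 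
    and cS: "card S0 \<le> card S + (\<Sum>L\<in>Lam. card (S0 \<inter> diagonal p L) - k)"
    using exists_excess_removal[OF Lam(1) finS0, of "diagonal p" k] by (elim exE conjE)
  have "real (\<Sum>L\<in>Lam. card (S0 \<inter> diagonal p L) - k) \<le> (\<Sum>L\<in>Lam. g (\<Sum>m\<in>M. N L m))"
    unfolding of_nat_sum
  proof (intro sum_mono)
    fix L
    have "S0 \<inter> diagonal p L = (\<Union>m\<in>M. hyperbola p h m \<inter> diagonal p L)" by (auto simp: S0_def)
    then have "card (S0 \<inter> diagonal p L) \<le> (\<Sum>m\<in>M. N L m)"
      using card_UN_le[OF finM, of "\<lambda>m. hyperbola p h m \<inter> diagonal p L"] by (simp add: N_def)
    then show "real (card (S0 \<inter> diagonal p L) - k) \<le> g (\<Sum>m\<in>M. N L m)" unfolding g_def by (intro of_nat_mono diff_le_mono)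
  qed
  also note loss
  also have "(\<Sum>L\<in>Lam. (avg_step (diag_width h L) (diag_frac p h L) ^^ t) g 0) \<le> 2 * real_of_int p * expected_loss t k + 32 * real t"
    unfolding Lam_def g_def by (rule diagonal_loss_sum_le[OF prime p])
  also have "real t * (real (card Lam) * (8 * (real t + 2) / real_of_int p)) \<le> real t * ((4 * real_of_int p) * (8 * (real t + 2) / real_of_int p))"
    using Lam(2) p2 by (intro mult_left_mono mult_right_mono) auto
  also have "\<dots> = 32 * real t * (real t + 2)" using p2 by simp
  finally have removed: "real (\<Sum>L\<in>Lam. card (S0 \<inter> diagonal p L) - k) \<le> 2 * real_of_int p * expected_loss t k + 32 * real t + 32 * real t * (real t + 2)"
    by simp
  have "card S0 = (\<Sum>m\<in>M. card (hyperbola p h m))"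
    unfolding S0_def using finM M(1) hyperbola_disjoint[OF prime p] by (intro card_UN_disjoint) (auto simp: A_def subset_iff)
  then have "int (card S0) = (\<Sum>m\<in>M. int (card (hyperbola p h m)))" by simp
  also have "\<dots> \<ge> (\<Sum>m\<in>M. 4 * (p - 1))"
    using card_hyperbola_ge[OF prime p] M(1) by (intro sum_mono) (auto simp: A_def)
  finally have "int t * (4 * (p - 1)) \<le> int (card S0)" using M(2) by simp
  then have "real_of_int (int t * (4 * (p - 1))) \<le> real_of_int (int (card S0))" by (simp only: of_int_le_iff)
  then have cS0: "4 * real t * (real_of_int p - 1) \<le> real (card S0)" by (simp add: mult.commute mult.left_commute)
  have "real (card S0) \<le> real (card S) + real (\<Sum>L\<in>Lam. card (S0 \<inter> diagonal p L) - k)" using cS by (metis of_nat_add of_nat_le_iff)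
  then have "real (card S) \<ge> 4 * real t * (real_of_int p - 1) - (2 * real_of_int p * expected_loss t k + 32 * real t + 32 * real t * (real t + 2))"
    using cS0 removed by linarith
  also have "4 * real t * (real_of_int p - 1) - (2 * real_of_int p * expected_loss t k + 32 * real t + 32 * real t * (real t + 2)) =
     2 * real_of_int p * (2 * real t - expected_loss t k) - (36 * real t + 32 * real t * (real t + 2))"
    by (simp add: algebra_simps)
  finally have card: "real (card S) \<ge> 2 * real_of_int p * (2 * real t - expected_loss t k) - (36 * real t + 32 * real t * (real t + 2))" .
  have "card {(x, y) \<in> S. (x - x0) * d2 = (y - y0) * d1} \<le> k" if "(x0, y0) \<in> S" "(d1, d2) \<noteq> (0, 0)" for x0 y0 d1 d2
    by (rule card_line_le[OF prime p finM _ M(2) _ k _ that]) (use M(1) S LamD in \<open>auto simp: A_def S0_def\<close>)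
  moreover have "S \<subseteq> {1..2 * p} \<times> {1..2 * p}" using S(1) by (auto simp: S0_def hyperbola_def)
  ultimately show ?thesis using card by blast
qed

section \<open>From integer points to Euclidean lines\<close>

lemma finite_grid [simp]: "finite (grid n)"
  by (simp add: grid_def)

lemma max_pts_ge:
  assumes "S \<subseteq> grid n" "at_most_per_line k S"
  shows "card S \<le> max_pts k n"
  unfolding max_pts_def
proof (rule Max_ge)
  have "{card S |S. S \<subseteq> grid n \<and> at_most_per_line k S} \<subseteq> card ` Pow (grid n)" by blast
  then show "finite {card S |S. S \<subseteq> grid n \<and> at_most_per_line k S}" by (rule finite_subset) simp
qed (use assms in blast)

lemma is_line_vertical: "is_line {q :: real \<times> real. fst q = c}"
proof -
  have eq: "{q :: real \<times> real. fst q = c} = affine hull {(c, 0), (c, 1)}"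
  proof (intro equalityI subsetI)
    fix q :: "real \<times> real" assume "q \<in> {q. fst q = c}"
    then have "q = (1 - snd q) *\<^sub>R (c, 0) + snd q *\<^sub>R (c, 1)" by (auto simp: prod_eq_iff algebra_simps)
    moreover have "(1 - snd q) + snd q = 1" by simp
    ultimately show "q \<in> affine hull {(c, 0), (c, 1)}" unfolding affine_hull_2 by blast
  next
    fix q assume "q \<in> affine hull {(c, 0), (c, 1 :: real)}"
    then obtain u v where "u + v = 1" "q = u *\<^sub>R (c, 0) + v *\<^sub>R (c, 1)" unfolding affine_hull_2 by blast
    then show "q \<in> {q. fst q = c}" by (auto simp flip: distrib_right)
  qed
  have "aff_dim {(c, 0), (c, 1 :: real)} = 1" by (simp add: aff_dim_2)
  then show ?thesis unfolding is_line_def eq by (simp add: affine_affine_hull)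
qed

lemma max_pts_le: "max_pts k n \<le> k * n"
  unfolding max_pts_def
proof (rule Max.boundedI)
  have "{card S |S. S \<subseteq> grid n \<and> at_most_per_line k S} \<subseteq> card ` Pow (grid n)" by blast
  then show "finite {card S |S. S \<subseteq> grid n \<and> at_most_per_line k S}" by (rule finite_subset) simp
  have "at_most_per_line k {}" by (simp add: at_most_per_line_def)
  then show "{card S |S. S \<subseteq> grid n \<and> at_most_per_line k S} \<noteq> {}" by blast
  fix a assume "a \<in> {card S |S. S \<subseteq> grid n \<and> at_most_per_line k S}"
  then obtain S where S: "a = card S" "S \<subseteq> grid n" "at_most_per_line k S" by blast
  have "S = (\<Union>i\<in>{1..n}. S \<inter> {q. fst q = real i})" using S(2) by (force simp: grid_def)
  then have "card S \<le> (\<Sum>i=1..n. card (S \<inter> {q. fst q = real i}))"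
    using card_UN_le[of "{1..n}" "\<lambda>i. S \<inter> {q. fst q = real i}"] by simp
  also have "\<dots> \<le> (\<Sum>i=1..n. k)"
    using S(3) is_line_vertical by (intro sum_mono) (auto simp: at_most_per_line_def)
  finally show "a \<le> k * n" using S(1) by (simp add: mult.commute)
qed

text \<open>A Euclidean line with two points of the set is their affine hull, hence has an integer
  direction and satisfies the integer equation; any other line has at most one point, which
  \<open>k >= 1\<close> allows.\<close>

lemma max_pts_ge_integer_set:
  fixes S :: "(int \<times> int) set"
  assumes S: "S \<subseteq> {1..N} \<times> {1..N}" "N \<le> int n" and k: "k \<ge> 1"
    and line: "\<forall>x0 y0 d1 d2. (x0, y0) \<in> S \<longrightarrow> (d1, d2) \<noteq> (0, 0) \<longrightarrow> card {(x, y) \<in> S. (x - x0) * d2 = (y - y0) * d1} \<le> k"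
  shows "card S \<le> max_pts k n"
proof -
  define f where "f = (\<lambda>(x, y). (real_of_int x, real_of_int y))"
  have inj: "inj f" by (auto simp: f_def inj_def)
  have finS: "finite S" using S(1) finite_subset by blast
  have "f ` S \<subseteq> grid n"
  proof
    fix q assume "q \<in> f ` S"
    then obtain x y where xy: "(x, y) \<in> S" "q = (real_of_int x, real_of_int y)" by (auto simp: f_def)
    then have "1 \<le> x" "x \<le> int n" "1 \<le> y" "y \<le> int n" using S by auto
    then have "nat x \<in> {1..n}" "nat y \<in> {1..n}" "q = (real (nat x), real (nat y))" using xy(2) by auto
    then show "q \<in> grid n" unfolding grid_def by (intro image_eqI[of _ _ "(nat x, nat y)"]) auto
  qed
  moreover have "at_most_per_line k (f ` S)"
    unfolding at_most_per_line_def
  proof (intro allI impI)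
    fix L assume L: "is_line L"
    define C where "C = {z \<in> S. f z \<in> L}"
    have finC: "finite C" using finS by (simp add: C_def)
    have "f ` S \<inter> L = f ` C" by (auto simp: C_def)
    then have cardC: "card (f ` S \<inter> L) = card C" by (simp add: card_image inj_on_subset[OF inj])
    show "card (f ` S \<inter> L) \<le> k"
    proof (cases "card C \<le> 1")
      case True then show ?thesis using cardC k by simp
    next
      case False
      then have "2 \<le> card C" by simp
      from obtain_subset_with_card_n[OF this] obtain T where "T \<subseteq> C" "card T = 2" .
      then obtain P Q where PQ: "P \<in> C" "Q \<in> C" "P \<noteq> Q" unfolding card_2_iff by blast
      obtain x0 y0 x1 y1 where xy: "P = (x0, y0)" "Q = (x1, y1)" by (cases P; cases Q) auto
      have fPQ: "f P \<noteq> f Q" using PQ(3) inj by (auto dest: injD)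
      have sub: "{f P, f Q} \<subseteq> L" using PQ by (auto simp: C_def)
      have "aff_dim (affine hull {f P, f Q}) = aff_dim L"
        using L fPQ by (simp add: is_line_def aff_dim_2)
      moreover have "affine hull {f P, f Q} \<subseteq> L" using sub L by (simp add: is_line_def hull_minimal)
      ultimately have Leq: "affine hull {f P, f Q} = L"
        using L by (intro affine_dim_equal) (auto simp: is_line_def affine_affine_hull)
      have "C \<subseteq> {(x, y) \<in> S. (x - x0) * (y1 - y0) = (y - y0) * (x1 - x0)}"
      proof
        fix z assume z: "z \<in> C"
        obtain x y where zxy: "z = (x, y)" by (cases z)
        have "f z \<in> affine hull {f P, f Q}" using z Leq by (simp add: C_def)
        then obtain u v where uv: "u + v = 1" "f z = u *\<^sub>R f P + v *\<^sub>R f Q" unfolding affine_hull_2 by blast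
        have u: "u = 1 - v" using uv(1) by simp
        have "real_of_int x - real_of_int x0 = v * (real_of_int x1 - real_of_int x0)" "real_of_int y - real_of_int y0 = v * (real_of_int y1 - real_of_int y0)"
          using uv(2) unfolding u by (auto simp: f_def xy zxy algebra_simps)
        then have "(real_of_int x - real_of_int x0) * (real_of_int y1 - real_of_int y0) = (real_of_int y - real_of_int y0) * (real_of_int x1 - real_of_int x0)"
          by simp
        then have "real_of_int ((x - x0) * (y1 - y0)) = real_of_int ((y - y0) * (x1 - x0))" by simp
        then have "(x - x0) * (y1 - y0) = (y - y0) * (x1 - x0)" by (simp only: of_int_eq_iff)
        then show "z \<in> {(x, y) \<in> S. (x - x0) * (y1 - y0) = (y - y0) * (x1 - x0)}" using z by (simp add: C_def zxy)
      qed
      then have "card C \<le> card {(x, y) \<in> S. (x - x0) * (y1 - y0) = (y - y0) * (x1 - x0)}"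
        by (intro card_mono finite_subset[OF _ finS]) auto
      also have "\<dots> \<le> k" using line PQ xy by (auto simp: C_def)
      finally show ?thesis using cardC by simp
    qed
  qed
  ultimately have "card (f ` S) \<le> max_pts k n" by (rule max_pts_ge)
  then show ?thesis by (simp add: card_image inj_on_subset[OF inj])
qed

lemma eventually_max_pts_ge:
  assumes k: "2 * t \<le> k" "k \<ge> 1" and R: "0 \<le> R" "R < 2 * real t - expected_loss t k"
  shows "\<forall>\<^sub>F n in sequentially. R * real n \<le> real (max_pts k n)"
proof -
  define G where "G = 2 * real t - expected_loss t k"
  \<comment> \<open>Half of the gap \<open>G - R\<close> pays for \<open>2 * q\<close> falling short
    of \<open>n\<close>, the other half for the constant \<open>C\<close>.\<close>
  define \<delta> where "\<delta> = (G - R) / (2 * G)"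
  define C where "C = 36 * real t + 32 * real t * (real t + 2)"
  have G: "G > 0" "G > R" using R by (auto simp: G_def)
  have d: "0 < \<delta>" "\<delta> < 1" using G R(1) by (auto simp: \<delta>_def field_simps)
  have dG: "(1 - \<delta>) * G = (G + R) / 2" using G by (simp add: \<delta>_def field_simps)
  have "filterlim (\<lambda>n. real n / 2) at_top sequentially" by real_asymp
  from eventually_compose_filterlim[OF eventually_prime_in_short_interval[OF d(1)] this]
  have 1: "\<forall>\<^sub>F n in sequentially. \<exists>q. prime q \<and> (1 - \<delta>) * (real n / 2) < real q \<and> real q < real n / 2" .
  have lin: "filterlim (\<lambda>n. c * real n) at_top sequentially" if "c > 0" for c :: real
    using that by real_asymp
  have 2: "\<forall>\<^sub>F n in sequentially. 2 * real t + 4 \<le> (1 - \<delta>) / 2 * real n"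
  proof -
    have "0 < (1 - \<delta>) / 2" using d by simp
    from lin[OF this] show ?thesis unfolding filterlim_at_top by blast
  qed
  have 3: "\<forall>\<^sub>F n in sequentially. C \<le> (G - R) / 2 * real n"
  proof -
    have "0 < (G - R) / 2" using G by simp
    from lin[OF this] show ?thesis unfolding filterlim_at_top by blast
  qed
  from 1 2 3 show ?thesis
  proof eventually_elim
    case (elim n)
    then obtain q :: nat where q: "prime q" "(1 - \<delta>) * (real n / 2) < real q" "real q < real n / 2" by blast
    have qt: "2 * real t + 4 < real q" using q(2) elim(2) by simp
    then have "q > 2" by simp
    then have "odd q" using q(1) prime_odd_nat by auto
    define h where "h = int q div 2"
    have p: "int q = 2 * h + 1" using \<open>odd q\<close> by (simp add: h_def)
    have prime: "prime (int q)" using q(1) by simp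
    have tp: "2 * int t + 2 \<le> int q" using qt by linarith
    obtain S where S: "S \<subseteq> {1..2 * int q} \<times> {1..2 * int q}"
      "\<forall>x0 y0 d1 d2. (x0, y0) \<in> S \<longrightarrow> (d1, d2) \<noteq> (0, 0) \<longrightarrow> card {(x, y) \<in> S. (x - x0) * d2 = (y - y0) * d1} \<le> k"
      "real (card S) \<ge> 2 * real_of_int (int q) * (2 * real t - expected_loss t k) - (36 * real t + 32 * real t * (real t + 2))"
      using exists_integer_point_set[OF prime p tp k(1)] by (elim exE conjE)
    have "2 * real q \<le> real n" using q(3) by simp
    then have "2 * int q \<le> int n" by linarith
    from max_pts_ge_integer_set[OF S(1) this k(2) S(2)]
    have "real (card S) \<le> real (max_pts k n)" by simp
    moreover have "real (card S) \<ge> 2 * real q * G - C" using S(3) by (simp add: G_def C_def)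
    moreover have "(1 - \<delta>) * real n * G \<le> 2 * real q * G"
      using q(2) G by (intro mult_right_mono) auto
    moreover have "(1 - \<delta>) * real n * G = (G + R) / 2 * real n" using dG by (metis mult.commute mult.left_commute)
    moreover have "(G + R) / 2 * real n = R * real n + (G - R) / 2 * real n" by (simp add: field_simps)
    ultimately show ?case using elim(3) by linarith
  qed
qed

lemma rate_mult_eq:
  fixes K :: real
  assumes "K \<noteq> 0"
  shows "(1 - a / K + b / (K * s) - c / (K * d)) * (K * n) = (K - a + b / s - c / d) * n"
proof -
  have "(1 - a / K + b / (K * s) - c / (K * d)) * K = K - a + b / s - c / d"
    using assms by (simp add: left_diff_distrib distrib_right)
  then show ?thesis by (metis mult.assoc)
qed

theorem theorem1p5:
  fixes k :: nat
  assumes "k \<ge> 2"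
  shows "\<exists>N::nat. \<forall>n\<ge>N.
    (even k \<longrightarrow>
       real k * real n - 2 * real n
         < (1 - 2 / real k + 6 / (real k * sqrt (pi * real k + 14))
              - 2 / (real k * (real k + 2))) * (real k * real n) \<and>
       (1 - 2 / real k + 6 / (real k * sqrt (pi * real k + 14))
              - 2 / (real k * (real k + 2))) * (real k * real n) \<le> real (max_pts k n) \<and>
       real (max_pts k n) \<le> real k * real n) \<and>
    (odd k \<longrightarrow>
       real k * real n - 3 * real n
         < (1 - 3 / real k + 10 / (real k * sqrt (pi * real k + 7))
              - 6 / (real k * (real k + 1))) * (real k * real n) \<and>
       (1 - 3 / real k + 10 / (real k * sqrt (pi * real k + 7))
              - 6 / (real k * (real k + 1))) * (real k * real n) \<le> real (max_pts k n) \<and>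
       real (max_pts k n) \<le> real k * real n)"
proof -
  define K where "K = real k"
  have K: "K \<ge> 2" using assms by (simp add: K_def)
  have upper: "real (max_pts k n) \<le> real k * real n" for n
    using max_pts_le[of k n] by (metis of_nat_le_iff of_nat_mult)
  have pK: "0 < pi * K" "pi * K < 4 * K" using K pi_less_4 by auto
  show ?thesis
  proof (cases "even k")
    case True
    then obtain t where t: "k = 2 * t" by blast
    define R where "R = K - 2 + 6 / sqrt (pi * K + 14) - 2 / (K + 2)"
    have eq: "(1 - 2 / real k + 6 / (real k * sqrt (pi * real k + 14)) - 2 / (real k * (real k + 2))) * (real k * real n) = R * real n" for n
      unfolding R_def K_def by (rule rate_mult_eq) (use assms in simp)
    \<comment> \<open>Equivalent to \<open>2 / (K + 2) < 6 / sqrt (pi * K + 14)\<close>, that is, to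
      the positivity of the improvement over \<open>K - 2\<close>.\<close>
    have "sqrt (pi * K + 14) < 3 * (K + 2)"
    proof (rule real_less_lsqrt)
      have "(3 * (K + 2))\<^sup>2 = 9 * (K * K) + 36 * K + 36" by (simp add: power2_eq_square algebra_simps)
      moreover have "K * K \<ge> 0" by simp
      ultimately show "pi * K + 14 < (3 * (K + 2))\<^sup>2" using pK K by linarith
    qed (use K pK in auto)
    then have "6 / (3 * (K + 2)) < 6 / sqrt (pi * K + 14)"
      using pK K by (intro divide_strict_left_mono mult_pos_pos) (auto intro: add_pos_pos)
    moreover have "6 / (3 * (K + 2)) = 2 / (K + 2)" using K by (simp add: divide_simps)
    ultimately have "2 / (K + 2) < 6 / sqrt (pi * K + 14)" by simp
    then have gt: "K - 2 < R" by (simp add: R_def)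
    have "R < 2 * real t - expected_loss t k"
      using expected_loss_less(1)[of t] assms t by (simp add: R_def K_def)
    moreover have "0 \<le> R" using gt K by simp
    ultimately have "\<forall>\<^sub>F n in sequentially. R * real n \<le> real (max_pts k n)"
      using t assms by (intro eventually_max_pts_ge[of t]) auto
    then obtain N where N: "\<And>n. n \<ge> N \<Longrightarrow> R * real n \<le> real (max_pts k n)" by (auto simp: eventually_sequentially)
    \<comment> \<open>The strict inequality fails at \<open>n = 0\<close>, hence the threshold
      \<open>max N 1\<close>.\<close>
    have "real k * real n - 2 * real n < R * real n" if "n \<ge> 1" for n
      using mult_strict_right_mono[OF gt, of "real n"] that by (simp add: K_def algebra_simps)
    then show ?thesis using N upper True unfolding eq by (intro exI[of _ "max N 1"]) auto
  next
    case False
    then obtain t where t: "k = 2 * t + 1" by (rule oddE)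
    define R where "R = K - 3 + 10 / sqrt (pi * K + 7) - 6 / (K + 1)"
    have eq: "(1 - 3 / real k + 10 / (real k * sqrt (pi * real k + 7)) - 6 / (real k * (real k + 1))) * (real k * real n) = R * real n" for n
      unfolding R_def K_def by (rule rate_mult_eq) (use assms in simp)
    have K3: "K \<ge> 3" using t assms by (simp add: K_def)
    have "sqrt (pi * K + 7) < 5 / 3 * (K + 1)"
    proof (rule real_less_lsqrt)
      have "(5 / 3 * (K + 1))\<^sup>2 = 25 / 9 * (K * K) + 50 / 9 * K + 25 / 9" by (simp add: power2_eq_square algebra_simps)
      moreover have "K * K \<ge> 3 * K" using K3 by (intro mult_right_mono) auto
      ultimately show "pi * K + 7 < (5 / 3 * (K + 1))\<^sup>2" using pK K3 by linarith
    qed (use K pK in auto)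
    then have "10 / (5 / 3 * (K + 1)) < 10 / sqrt (pi * K + 7)"
      using pK K by (intro divide_strict_left_mono mult_pos_pos) (auto intro: add_pos_pos)
    moreover have "10 / (5 / 3 * (K + 1)) = 6 / (K + 1)" using K by (simp add: divide_simps)
    ultimately have "6 / (K + 1) < 10 / sqrt (pi * K + 7)" by simp
    then have gt: "K - 3 < R" by (simp add: R_def)
    \<comment> \<open>Here \<open>2 * t = K - 1\<close>: one point per row is given up, which with
      the leading 2 of the loss makes the 3 of the odd case.\<close>
    have "R < 2 * real t - expected_loss t k"
      using expected_loss_less(2)[of t] assms t by (simp add: R_def K_def)
    moreover have "0 \<le> R" using gt K3 by simp
    ultimately have "\<forall>\<^sub>F n in sequentially. R * real n \<le> real (max_pts k n)"
      using t assms by (intro eventually_max_pts_ge[of t]) auto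
    then obtain N where N: "\<And>n. n \<ge> N \<Longrightarrow> R * real n \<le> real (max_pts k n)" by (auto simp: eventually_sequentially)
    have "real k * real n - 3 * real n < R * real n" if "n \<ge> 1" for n
      using mult_strict_right_mono[OF gt, of "real n"] that by (simp add: K_def algebra_simps)
    then show ?thesis using N upper False unfolding eq by (intro exI[of _ "max N 1"]) auto
  qed
qed

end
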